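(* Let $X\subset\mathbb C^4$ be an affine algebraic variety of degree $d$ and dimension one or two, and let $P,Q\subset\mathbb C^2$ be finite sets, where we regard $P\times Q\subset\mathbb C^2\times\mathbb C^2=\mathbb C^4$. Then \[|X\cap(P\times Q)|=O_d(|P|+|Q|),\] unless $X$ is Cartesian.
   Context: Coordinates on $\mathbb C^4$ are $(x,y,s,t)$. Given $G\in\mathbb C[x,y]\setminus\mathbb C$ and $K\in\mathbb C[s,t]\setminus\mathbb C$, a polynomial $F\in\mathbb C[x,y,s,t]$ is called $(G,K)$-Cartesian if $F=G(x,y)H(x,y,s,t)+K(s,t)L(x,y,s,t)$ for some $H,L\in\mathbb C[x,y,s,t]$. A variety $X\subset\mathbb C^4$ with defining ideal $I(X)=\{F\in\mathbb C[x,y,s,t]: F\text{ vanishes on }X\}$ is Cartesian if there exist $G\in\mathbb C[x,y]\setminus\mathbb C$ and $K\in\mathbb C[s,t]\setminus\mathbb C$ such that every $F\in I(X)$ is $(G,K)$-Cartesian. (A variety may be reducible with components of different dimensions; its dimension is the maximum over components.) The notation $O_d(\cdot)$ means the implied constant depends only on $d$. *)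

theory Defs
  imports "HOL-Computational_Algebra.Polynomial"
begin

(* Polynomials in C[x,y,s,t] as nested univariate polynomials:
   outermost variable x, then y, then s, innermost t. *)
type_synonym mpoly4 = "complex poly poly poly poly"
(* Polynomials in two variables: outer variable first (x resp. s), inner second (y resp. t). *)
type_synonym mpoly2 = "complex poly poly"
type_synonym pt4 = "(complex \<times> complex) \<times> (complex \<times> complex)"

definition eval4 :: "mpoly4 \<Rightarrow> pt4 \<Rightarrow> complex" where
  "eval4 F p = (case p of ((x,y),(s,t)) \<Rightarrow>
      poly (poly (poly (poly F [:[:[:x:]:]:]) [:[:y:]:]) [:s:]) t)"

definition zero_set :: "mpoly4 set \<Rightarrow> pt4 set" where
  "zero_set S = {p. \<forall>F\<in>S. eval4 F p = 0}"

definition is_variety :: "pt4 set \<Rightarrow> bool" where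
  "is_variety X \<longleftrightarrow> (\<exists>S. X = zero_set S)"

definition vanishing_ideal :: "pt4 set \<Rightarrow> mpoly4 set" where
  "vanishing_ideal X = {F. \<forall>p\<in>X. eval4 F p = 0}"

definition irreducible_variety :: "pt4 set \<Rightarrow> bool" where
  "irreducible_variety V \<longleftrightarrow> is_variety V \<and> V \<noteq> {} \<and>
     (\<forall>A B. is_variety A \<and> is_variety B \<and> V \<subseteq> A \<union> B \<longrightarrow> V \<subseteq> A \<or> V \<subseteq> B)"

definition has_chain :: "pt4 set \<Rightarrow> nat \<Rightarrow> bool" where
  "has_chain X n \<longleftrightarrow> (\<exists>f :: nat \<Rightarrow> pt4 set.
      (\<forall>i\<le>n. irreducible_variety (f i)) \<and> (\<forall>i<n. f i \<subset> f (Suc i)) \<and> f n \<subseteq> X)"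

definition has_dim :: "pt4 set \<Rightarrow> nat \<Rightarrow> bool" where
  "has_dim X n \<longleftrightarrow> has_chain X n \<and> \<not> has_chain X (Suc n)"

definition variety_dim :: "pt4 set \<Rightarrow> nat" where
  "variety_dim X = (GREATEST n. has_chain X n)"

definition irreducible_components :: "pt4 set \<Rightarrow> pt4 set set" where
  "irreducible_components X = {V. irreducible_variety V \<and> V \<subseteq> X \<and>
      (\<forall>W. irreducible_variety W \<and> V \<subseteq> W \<and> W \<subseteq> X \<longrightarrow> W = V)}"

definition lin_set :: "(complex \<times> complex \<times> complex \<times> complex \<times> complex) list \<Rightarrow> pt4 set" where
  "lin_set eqs = {((x,y),(s,t)). \<forall>(a,b,c,e,f)\<in>set eqs. a*x + b*y + c*s + e*t = f}"

(* degree of an irreducible variety V of dimension k: the maximal (= generic) number of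
   points of V \<inter> L for affine subspaces L cut out by k affine equations with V \<inter> L finite *)
definition irr_degree :: "pt4 set \<Rightarrow> nat" where
  "irr_degree V = Sup {card (V \<inter> lin_set eqs) | eqs.
      length eqs = variety_dim V \<and> finite (V \<inter> lin_set eqs)}"

definition variety_degree :: "pt4 set \<Rightarrow> nat" where
  "variety_degree X = (\<Sum>V\<in>irreducible_components X. irr_degree V)"

definition nonconst2 :: "mpoly2 \<Rightarrow> bool" where
  "nonconst2 G \<longleftrightarrow> \<not> (\<exists>c. G = [:[:c:]:])"

definition embXY :: "mpoly2 \<Rightarrow> mpoly4" where
  "embXY G = map_poly (map_poly (\<lambda>c. [:[:c:]:])) G"

definition embST :: "mpoly2 \<Rightarrow> mpoly4" where
  "embST K = [:[:K:]:]"

definition cartesian_poly :: "mpoly2 \<Rightarrow> mpoly2 \<Rightarrow> mpoly4 \<Rightarrow> bool" where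
  "cartesian_poly G K F \<longleftrightarrow> (\<exists>H L. F = embXY G * H + embST K * L)"

definition cartesian :: "pt4 set \<Rightarrow> bool" where
  "cartesian X \<longleftrightarrow> (\<exists>G K. nonconst2 G \<and> nonconst2 K \<and>
      (\<forall>F\<in>vanishing_ideal X. cartesian_poly G K F))"

end

theory Submission
  imports Defs
    "HOL-Computational_Algebra.Fundamental_Theorem_Algebra"
    "HOL-Computational_Algebra.Field_as_Ring"
    "Subresultants.Subresultant_Gcd"
begin

text \<open>
  A component of dimension at most one has finite fibres over one of the two planes, or lies over a
  single point of the first one, and fibres that are finite are linear sections, hence bounded by the
  degree. On a two-dimensional component \<open>V\<close> whose coordinates \<open>(x, y)\<close> are algebraically
  independent, the fibre over a point is infinite only if one of the irreducible equations
  \<open>F(x, y, s) = 0\<close>, \<open>F'(x, y, t) = 0\<close> of \<open>V\<close> holds identically in its last variable there. Each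
  root in \<open>x\<close> over a generic \<open>(y, s)\<close> lifts to a finite section of \<open>V\<close>, so the degrees of \<open>F\<close> in
  \<open>x\<close> and \<open>y\<close> are at most the degree of \<open>V\<close>, and a resultant bounds the number of exceptional
  points in terms of that degree alone. The same holds for \<open>(s, t)\<close>. If neither pair is independent,
  \<open>V\<close> lies in a product of irreducible plane curves, equals it by dimension, and its ideal is
  generated by the two equations, so \<open>V\<close> is Cartesian.

  Dimension theory enters only through quantifier elimination: images of varieties are constructible,
  and a constructible set either contains the complement of a hypersurface or lies in a hypersurface.
  Quantifier elimination with parameters also bounds the finite linear sections of a variety, without
  which the supremum defining the degree would be meaningless.
\<close>

hide_const (open) Module.smult

section \<open>Constructible sets and quantifier elimination\<close>

text \<open>The constant may depend on \<open>d\<close> alone, while \<open>d\<close> is visible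
  only through the sizes of finite linear sections; so all degrees of polynomials have to be read
  off from such sections. The exceptional points of a relation are the common zeros of its
  coefficients in the last variable, and two combinations of these suffice to catch them. Hence only
  the degrees in the other two variables enter, and these are measured by letting each of those
  variables in turn play the unknown. An exceptional point of one factor costs at most the size of
  the other, which is affordable because the number of such points is bounded. The passage from
  \<open>X\<close> to its components is free: the ideal of \<open>X\<close> is contained in that of
  a component, so a Cartesian component would make \<open>X\<close> Cartesian, and each component
  has degree at least one. Polynomials appear in two forms. Functions on valuations
  \<open>nat \<Rightarrow> complex\<close> leave room for parameters beside the coordinates of a
  point and make projection the elimination of one slot; nested polynomials are used where
  divisibility and degrees matter.\<close>

inductive_set polyfun :: "((nat \<Rightarrow> complex) \<Rightarrow> complex) set" where
  polyfun_const: "(\<lambda>_. c) \<in> polyfun"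
| polyfun_var: "(\<lambda>v. v i) \<in> polyfun"
| polyfun_add: "f \<in> polyfun \<Longrightarrow> g \<in> polyfun \<Longrightarrow> (\<lambda>v. f v + g v) \<in> polyfun"
| polyfun_mult: "f \<in> polyfun \<Longrightarrow> g \<in> polyfun \<Longrightarrow> (\<lambda>v. f v * g v) \<in> polyfun"

lemma polyfun_uminus: "f \<in> polyfun \<Longrightarrow> (\<lambda>v. - f v) \<in> polyfun"
  using polyfun_mult[OF polyfun_const[of "-1"]] by simp

lemma polyfun_diff: "f \<in> polyfun \<Longrightarrow> g \<in> polyfun \<Longrightarrow> (\<lambda>v. f v - g v) \<in> polyfun"
  using polyfun_add[OF _ polyfun_uminus] by fastforce

lemma polyfun_sum: "(\<And>a. a \<in> A \<Longrightarrow> f a \<in> polyfun) \<Longrightarrow> (\<lambda>v. \<Sum>a\<in>A. f a v) \<in> polyfun"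
  by (induction A rule: infinite_finite_induct) (auto intro: polyfun_const polyfun_add)

lemma polyfun_prod: "(\<And>a. a \<in> A \<Longrightarrow> f a \<in> polyfun) \<Longrightarrow> (\<lambda>v. \<Prod>a\<in>A. f a v) \<in> polyfun"
  by (induction A rule: infinite_finite_induct) (auto intro: polyfun_const polyfun_mult)

lemma polyfun_subst:
  "f \<in> polyfun \<Longrightarrow> (\<And>i. (\<lambda>v. g v i) \<in> polyfun) \<Longrightarrow> (\<lambda>v. f (g v)) \<in> polyfun"
  by (induction rule: polyfun.induct) (auto intro: polyfun.intros)

lemmas polyfun_intros = polyfun.intros polyfun_uminus polyfun_diff polyfun_sum polyfun_prod

text \<open>Univariate polynomials whose coefficients are polynomial functions of parameters. The
  index counts coefficients, so it strictly bounds the degree of a nonzero value; at special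
  parameters the degree may drop further, and elimination recurses on the index instead of the
  degree.\<close>

definition polyfam :: "nat \<Rightarrow> ((nat \<Rightarrow> complex) \<Rightarrow> complex poly) set" where
  "polyfam n = {P. \<forall>k. (\<lambda>v. coeff (P v) k) \<in> polyfun \<and> (k \<ge> n \<longrightarrow> (\<forall>v. coeff (P v) k = 0))}"

lemma polyfamI:
  "(\<And>k. (\<lambda>v. coeff (P v) k) \<in> polyfun) \<Longrightarrow> (\<And>k v. n \<le> k \<Longrightarrow> coeff (P v) k = 0) \<Longrightarrow> P \<in> polyfam n"
  by (auto simp: polyfam_def)

lemma polyfam_coeff: "P \<in> polyfam n \<Longrightarrow> (\<lambda>v. coeff (P v) k) \<in> polyfun"
  by (auto simp: polyfam_def)

lemma polyfam_coeff_0: "P \<in> polyfam n \<Longrightarrow> k \<ge> n \<Longrightarrow> coeff (P v) k = 0"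
  by (auto simp: polyfam_def)

lemma polyfam_mono: "P \<in> polyfam m \<Longrightarrow> m \<le> n \<Longrightarrow> P \<in> polyfam n"
  by (auto simp: polyfam_def)

lemma polyfam_0: "P \<in> polyfam 0 \<Longrightarrow> P v = 0"
  by (auto simp: polyfam_def poly_eq_iff)

lemma polyfam_degree: "P \<in> polyfam n \<Longrightarrow> P v \<noteq> 0 \<Longrightarrow> degree (P v) < n"
  by (metis leading_coeff_0_iff not_less polyfam_coeff_0)

lemma polyfam_pCons:
  assumes "f \<in> polyfun" "P \<in> polyfam n"
  shows "(\<lambda>v. pCons (f v) (P v)) \<in> polyfam (Suc n)"
proof -
  have "(\<lambda>v. coeff (pCons (f v) (P v)) k) \<in> polyfun" for k
    using assms by (cases k) (auto intro: polyfam_coeff)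
  then show ?thesis using assms by (auto simp: polyfam_def coeff_pCons split: nat.split)
qed

lemma polyfam_zero: "(\<lambda>_. 0) \<in> polyfam n"
  by (auto simp: polyfam_def intro: polyfun_const)

lemma polyfam_add:
  "P \<in> polyfam n \<Longrightarrow> Q \<in> polyfam n \<Longrightarrow> (\<lambda>v. P v + Q v) \<in> polyfam n"
  by (auto simp: polyfam_def intro!: polyfun_intros)

lemma polyfam_mult:
  assumes P: "P \<in> polyfam m" and Q: "Q \<in> polyfam n"
  shows "(\<lambda>v. P v * Q v) \<in> polyfam (m + n)"
proof -
  have "coeff (P v * Q v) k = 0" if "m + n \<le> k" for k v
  proof -
    have "coeff (P v) i * coeff (Q v) (k - i) = 0" if "i \<le> k" for i
      using polyfam_coeff_0[OF P, of i v] polyfam_coeff_0[OF Q, of "k - i" v] that \<open>m + n \<le> k\<close>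
      by (cases "i \<ge> m") auto
    then show ?thesis by (auto simp: coeff_mult intro: sum.neutral)
  qed
  moreover have "(\<lambda>v. coeff (P v * Q v) k) \<in> polyfun" for k
    unfolding coeff_mult using P Q by (auto intro!: polyfun_intros polyfam_coeff)
  ultimately show ?thesis by (rule polyfamI[rotated])
qed

lemma polyfam_power: "P \<in> polyfam m \<Longrightarrow> \<exists>n. (\<lambda>v. P v ^ k) \<in> polyfam n"
proof (induction k)
  case 0
  have "(\<lambda>v. pCons ((\<lambda>_. 1) v) ((\<lambda>_. 0) v)) \<in> polyfam 1"
    using polyfam_pCons[OF polyfun_const polyfam_zero, of 1 0] by simp
  then show ?case unfolding power_0 one_pCons by blast
next
  case (Suc k)
  then obtain n where "(\<lambda>v. P v ^ k) \<in> polyfam n" by auto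
  from polyfam_mult[OF Suc.prems this] show ?case by auto
qed

lemma polyfam_truncate:
  assumes "P \<in> polyfam (Suc n)"
  shows "(\<lambda>v. P v - monom (coeff (P v) n) n) \<in> polyfam n"
proof -
  have "(\<lambda>v. coeff (P v - monom (coeff (P v) n) n) k) \<in> polyfun" for k
    using polyfun_diff[OF polyfam_coeff[OF assms, of k] polyfam_coeff[OF assms, of k]] polyfam_coeff[OF assms, of k]
    by (cases "n = k") auto
  moreover have "coeff (P v - monom (coeff (P v) n) n) k = 0" if "n \<le> k" for k v
    using that polyfam_coeff_0[OF assms, of k v] by (cases "n = k") auto
  ultimately show ?thesis by (rule polyfamI)
qed

text \<open>One step of pseudo-division: cross-multiplying by the leading coefficients cancels the
  top term without dividing, so the coefficients stay polynomial in the parameters.\<close>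

lemma polyfam_cancel:
  assumes "P \<in> polyfam (Suc n)" "Q \<in> polyfam (Suc m)" "n \<le> m"
  shows "(\<lambda>v. smult (coeff (P v) n) (Q v) - monom (coeff (Q v) m) (m - n) * P v) \<in> polyfam m"
proof -
  have "coeff (smult (coeff (P v) n) (Q v) - monom (coeff (Q v) m) (m - n) * P v) k = 0" if "k \<ge> m" for k v
    using that polyfam_coeff_0[OF assms(1), of "k - (m - n)" v] polyfam_coeff_0[OF assms(2), of k v] assms(3)
    by (cases "k = m") (auto simp: coeff_monom_mult)
  moreover have "(\<lambda>v. coeff (smult (coeff (P v) n) (Q v) - monom (coeff (Q v) m) (m - n) * P v) k) \<in> polyfun" for k
    using assms by (cases "m - n \<le> k") (auto simp: coeff_monom_mult intro!: polyfun_intros polyfam_coeff)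
  ultimately show ?thesis by (rule polyfamI[rotated])
qed

lemma polyfun_as_polyfam:
  assumes "f \<in> polyfun"
  shows "\<exists>n. \<exists>P\<in>polyfam n. \<forall>v z. f (v(i := z)) = poly (P v) z"
  using assms
proof (induction rule: polyfun.induct)
  case (polyfun_const c)
  show ?case
    using polyfam_pCons[OF polyfun.polyfun_const[of c] polyfam_zero]
    by (intro exI bexI[of _ "\<lambda>_. [:c:]"]) auto
next
  case (polyfun_var j)
  show ?case
  proof (cases "j = i")
    case True
    then show ?thesis
      using polyfam_pCons[OF polyfun.polyfun_const[of 0] polyfam_pCons[OF polyfun.polyfun_const[of 1] polyfam_zero]]
      by (intro exI bexI[of _ "\<lambda>_. [:0, 1:]"]) auto
  next
    case False
    then show ?thesis
      using polyfam_pCons[OF polyfun.polyfun_var[of j] polyfam_zero]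
      by (intro exI bexI[of _ "\<lambda>v. [:v j:]"]) auto
  qed
next
  case (polyfun_add f g)
  then obtain n P m Q where "P \<in> polyfam n" "\<forall>v z. f (v(i := z)) = poly (P v) z"
    "Q \<in> polyfam m" "\<forall>v z. g (v(i := z)) = poly (Q v) z" by blast
  then show ?case
    by (intro exI[of _ "max n m"] bexI[of _ "\<lambda>v. P v + Q v"])
      (auto simp del: fun_upd_apply intro!: polyfam_add intro: polyfam_mono)
next
  case (polyfun_mult f g)
  then obtain n P m Q where "P \<in> polyfam n" "\<forall>v z. f (v(i := z)) = poly (P v) z"
    "Q \<in> polyfam m" "\<forall>v z. g (v(i := z)) = poly (Q v) z" by blast
  then show ?case
    by (intro exI[of _ "n + m"] bexI[of _ "\<lambda>v. P v * Q v"])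
      (auto simp del: fun_upd_apply intro!: polyfam_mult)
qed

lemma polyfun_line:
  assumes "f \<in> polyfun"
  shows "\<exists>p. \<forall>z. f (\<lambda>i. v i + z * (w i - v i)) = poly p z"
  using assms
proof (induction rule: polyfun.induct)
  case (polyfun_const c)
  show ?case by (rule exI[of _ "[:c:]"]) auto
next
  case (polyfun_var i)
  show ?case by (rule exI[of _ "[:v i, w i - v i:]"]) auto
next
  case (polyfun_add f g)
  then show ?case by (metis poly_add)
next
  case (polyfun_mult f g)
  then show ?case by (metis poly_mult)
qed

text \<open>On the line through \<open>v\<close> and \<open>w\<close> both functions become nonzero
  univariate polynomials, whose product has only finitely many roots.\<close>

lemma polyfun_no_zero_divisors:
  assumes f: "f \<in> polyfun" "f v \<noteq> 0" and g: "g \<in> polyfun" "g w \<noteq> 0"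
  shows "\<exists>u. f u \<noteq> 0 \<and> g u \<noteq> 0"
proof -
  obtain p q where p: "\<And>z. f (\<lambda>i. v i + z * (w i - v i)) = poly p z"
    and q: "\<And>z. g (\<lambda>i. v i + z * (w i - v i)) = poly q z"
    using polyfun_line f g by meson
  have "poly p 0 \<noteq> 0" "poly q 1 \<noteq> 0" using f g p[of 0] q[of 1] by auto
  then have "p * q \<noteq> 0" by auto
  then have "finite {z. poly (p * q) z = 0}" by (rule poly_roots_finite)
  then obtain z where "poly (p * q) z \<noteq> 0"
    using infinite_UNIV_char_0 by (metis (mono_tags, lifting) UNIV_eq_I mem_Collect_eq)
  then show ?thesis using p q by (metis mult_eq_0_iff poly_mult)
qed

lemma polyfun_prod_nonzero:
  assumes "finite A" "\<And>a. a \<in> A \<Longrightarrow> f a \<in> polyfun" "\<And>a. a \<in> A \<Longrightarrow> \<exists>v. f a v \<noteq> 0"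
  shows "\<exists>v. (\<Prod>a\<in>A. f a v) \<noteq> 0"
  using assms
proof (induction A rule: finite_induct)
  case (insert a A)
  then obtain v w where "f a v \<noteq> 0" "(\<Prod>a\<in>A. f a w) \<noteq> 0"
    by (metis insertI1 insertI2)
  moreover have "(\<lambda>v. \<Prod>a\<in>A. f a v) \<in> polyfun" "f a \<in> polyfun"
    using insert.prems by (auto intro: polyfun_prod)
  ultimately obtain u where "f a u \<noteq> 0" "(\<Prod>a\<in>A. f a u) \<noteq> 0"
    using polyfun_no_zero_divisors[of "f a" v "\<lambda>v. \<Prod>a\<in>A. f a v"] by blast
  then show ?case using insert.hyps by auto
qed auto

inductive_set constructible :: "(nat \<Rightarrow> complex) set set" where
  constructible_zero: "f \<in> polyfun \<Longrightarrow> {v. f v = 0} \<in> constructible"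
| constructible_Compl: "S \<in> constructible \<Longrightarrow> - S \<in> constructible"
| constructible_Int: "S \<in> constructible \<Longrightarrow> T \<in> constructible \<Longrightarrow> S \<inter> T \<in> constructible"

lemma constructible_Un: "S \<in> constructible \<Longrightarrow> T \<in> constructible \<Longrightarrow> S \<union> T \<in> constructible"
  using constructible_Compl[OF constructible_Int[OF constructible_Compl constructible_Compl]]
  by fastforce

lemma constructible_UNIV: "UNIV \<in> constructible"
  using constructible_zero[OF polyfun_const[of 0]] by simp

lemma constructible_empty: "{} \<in> constructible"
  using constructible_Compl[OF constructible_UNIV] by simp

lemma constructible_INT:
  "finite A \<Longrightarrow> (\<And>a. a \<in> A \<Longrightarrow> S a \<in> constructible) \<Longrightarrow> (\<Inter>a\<in>A. S a) \<in> constructible"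
  by (induction A rule: finite_induct) (auto intro: constructible_UNIV constructible_Int)

lemma constructible_UN:
  "finite A \<Longrightarrow> (\<And>a. a \<in> A \<Longrightarrow> S a \<in> constructible) \<Longrightarrow> (\<Union>a\<in>A. S a) \<in> constructible"
  by (induction A rule: finite_induct) (auto intro: constructible_empty constructible_Un)

lemma constructible_subst:
  assumes "S \<in> constructible" "\<And>i. (\<lambda>v. g v i) \<in> polyfun"
  shows "{v. g v \<in> S} \<in> constructible"
  using assms(1)
proof (induction rule: constructible.induct)
  case (constructible_zero f)
  then show ?case using constructible.constructible_zero[OF polyfun_subst[OF _ assms(2)]] by simp
next
  case (constructible_Compl S)
  then show ?case using constructible.constructible_Compl by (simp add: Collect_neg_eq)
next
  case (constructible_Int S T)
  then show ?case using constructible.constructible_Int by (simp add: Collect_conj_eq)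
qed

lemma constructible_polyfam_zero:
  assumes "R \<in> polyfam n"
  shows "{v. R v = 0} \<in> constructible"
proof -
  have "{v. R v = 0} = (\<Inter>k\<in>{..<n}. {v. coeff (R v) k = 0})"
    using polyfam_coeff_0[OF assms] by (auto simp: poly_eq_iff) (metis lessThan_iff not_less)
  also have "\<dots> \<in> constructible"
    using polyfam_coeff[OF assms] by (intro constructible_INT constructible_zero) auto
  finally show ?thesis .
qed

text \<open>\<open>R\<close> is a pseudo-remainder of \<open>H\<close> by \<open>F\<close>. Where
  the formal leading coefficient of \<open>F\<close> is nonzero it is a unit, so the scaling by it
  during the reduction does not affect divisibility.\<close>

lemma polyfam_dvd_reduce:
  assumes F: "F \<in> polyfam (Suc n)" and H: "H \<in> polyfam m"
  shows "\<exists>R\<in>polyfam n. \<forall>v. coeff (F v) n \<noteq> 0 \<longrightarrow> (F v dvd H v \<longleftrightarrow> R v = 0)"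
  using H
proof (induction m arbitrary: H)
  case 0
  then show ?case
    by (intro bexI[of _ H]) (auto simp: polyfam_0 intro: polyfam_mono)
next
  case (Suc m)
  show ?case
  proof (cases "Suc m \<le> n")
    case True
    have "H v = 0" if "coeff (F v) n \<noteq> 0" "F v dvd H v" for v
    proof (rule ccontr)
      assume "H v \<noteq> 0"
      then have "degree (F v) \<le> degree (H v)" "degree (H v) < Suc m"
        using dvd_imp_degree_le that polyfam_degree[OF Suc.prems] by auto
      then show False using le_degree[OF that(1)] True by linarith
    qed
    then show ?thesis using polyfam_mono[OF Suc.prems True] by (intro bexI[of _ H]) auto
  next
    case False
    define H' where "H' = (\<lambda>v. smult (coeff (F v) n) (H v) - monom (coeff (H v) m) (m - n) * F v)"
    have "H' \<in> polyfam m" unfolding H'_def using F Suc.prems False by (intro polyfam_cancel) auto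
    then obtain R where "R \<in> polyfam n" and R: "\<And>v. coeff (F v) n \<noteq> 0 \<Longrightarrow> (F v dvd H' v \<longleftrightarrow> R v = 0)"
      using Suc.IH by blast
    moreover have "F v dvd H' v \<longleftrightarrow> F v dvd H v" if "coeff (F v) n \<noteq> 0" for v
    proof -
      have "smult (coeff (F v) n) (H v) = H' v + monom (coeff (H v) m) (m - n) * F v"
        by (simp add: H'_def)
      then show ?thesis
        using that by (metis dvd_add_left_iff dvd_smult_iff dvd_triv_right)
    qed
    ultimately show ?thesis by blast
  qed
qed

text \<open>Euclid's algorithm with parameters. A vanishing formal leading coefficient truncates its
  equation; a nonvanishing one reduces another equation that is at least as long. Both lower the sum
  of the formal lengths, and counting the equations as well lets those that have become zero be
  dropped.\<close>

lemma constructible_projection_basic: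
  assumes "\<forall>(n, F) \<in> set Fs. F \<in> polyfam n" and "G \<in> polyfam m"
  shows "{v. \<exists>z. (\<forall>(n, F) \<in> set Fs. poly (F v) z = 0) \<and> poly (G v) z \<noteq> 0} \<in> constructible"
  using assms(1)
proof (induction "sum_list (map fst Fs) + length Fs" arbitrary: Fs rule: less_induct)
  case less
  define E where
    "E Fs = {v. \<exists>z. (\<forall>(n, F) \<in> set Fs. poly (F v) z = 0) \<and> poly (G v) z \<noteq> 0}" for Fs :: "(nat \<times> ((nat \<Rightarrow> complex) \<Rightarrow> complex poly)) list"
  have IH: "E Fs' \<in> constructible" if "sum_list (map fst Fs') + length Fs' < sum_list (map fst Fs) + length Fs"
    "\<forall>(n, F) \<in> set Fs'. F \<in> polyfam n" for Fs'
    unfolding E_def using less.hyps[OF that] .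
  have reduce: "E ((Suc p, A) # (Suc q, B) # r) \<in> constructible"
    if pq: "p \<le> q" and AB: "A \<in> polyfam (Suc p)" "B \<in> polyfam (Suc q)" "\<forall>(n, F) \<in> set r. F \<in> polyfam n"
      and len: "sum_list (map fst ((Suc p, A) # (Suc q, B) # r)) + length ((Suc p, A) # (Suc q, B) # r)
        = sum_list (map fst Fs) + length Fs" for p q A B r
  proof -
    define A' where "A' = (\<lambda>v. A v - monom (coeff (A v) p) p)"
    define B' where "B' = (\<lambda>v. smult (coeff (A v) p) (B v) - monom (coeff (B v) q) (q - p) * A v)"
    let ?c = "{v. coeff (A v) p = 0}"
    have "E ((p, A') # (Suc q, B) # r) \<in> constructible"
      using that polyfam_truncate[OF AB(1)] by (intro IH) (auto simp: A'_def)
    moreover have "E ((Suc p, A) # (q, B') # r) \<in> constructible"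
      using that polyfam_cancel[OF AB(1,2) pq] by (intro IH) (auto simp: B'_def)
    moreover have "?c \<in> constructible" by (intro constructible_zero polyfam_coeff[OF AB(1)])
    moreover have "E ((Suc p, A) # (Suc q, B) # r) =
      (?c \<inter> E ((p, A') # (Suc q, B) # r)) \<union> (- ?c \<inter> E ((Suc p, A) # (q, B') # r))"
      by (auto simp: E_def A'_def B'_def)
    ultimately show ?thesis
      by (auto intro!: constructible_Un constructible_Int constructible_Compl)
  qed
  have drop: "E ((0, A) # r) = E r" if "A \<in> polyfam 0" for A r
    using polyfam_0[OF that] by (auto simp: E_def)
  have "E Fs \<in> constructible"
  proof (cases Fs)
    case Nil
    have "E Fs = - {v. G v = 0}"
      using poly_all_0_iff_0 by (auto simp: E_def Nil)
    then show ?thesis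
      using constructible_polyfam_zero[OF assms(2)] by (auto intro: constructible_Compl)
  next
    case (Cons a r)
    obtain n A where a: "a = (n, A)" by force
    show ?thesis
    proof (cases n)
      case 0
      then show ?thesis using Cons a less.prems drop[of A r] IH[of r] by auto
    next
      case (Suc p)
      have A: "A \<in> polyfam (Suc p)" using less.prems Cons a Suc by auto
      show ?thesis
      proof (cases r)
        case Nil
        define A' where "A' = (\<lambda>v. A v - monom (coeff (A v) p) p)"
        let ?c = "{v. coeff (A v) p = 0}"
        obtain k where "(\<lambda>v. G v ^ p) \<in> polyfam k" using polyfam_power[OF assms(2)] by auto
        then obtain R where R: "R \<in> polyfam p"
          "\<And>v. coeff (A v) p \<noteq> 0 \<Longrightarrow> A v dvd G v ^ p \<longleftrightarrow> R v = 0"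
          using polyfam_dvd_reduce[OF A] by blast
        \<comment> \<open>A root of \<open>A v\<close> outside the zeros of \<open>G v\<close> is
          missing exactly if every root of \<open>A v\<close> is one of \<open>G v\<close>, that is,
          if \<open>A v\<close> divides a power of \<open>G v\<close>; the exponent \<open>p\<close>
          suffices, as no multiplicity exceeds the degree.\<close>
        have *: "v \<in> E Fs \<longleftrightarrow> R v \<noteq> 0" if "coeff (A v) p \<noteq> 0" for v
        proof -
          have "A v \<noteq> 0" using that by auto
          moreover have "degree (A v) = p"
            using polyfam_degree[OF A] le_degree[OF that] calculation by (metis le_antisym less_Suc_eq_le)
          ultimately show ?thesis
            using nullstellensatz_univariate[of "A v" "G v"] R(2)[OF that]
            by (auto simp: E_def Cons a Nil)
        qed
        have "E Fs = (?c \<inter> E [(p, A')]) \<union> (- ?c \<inter> - {v. R v = 0})"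
          (is "_ = ?R")
        proof -
          have "v \<in> E Fs \<longleftrightarrow> v \<in> ?R" for v
            using *[of v] by (cases "coeff (A v) p = 0") (auto simp: E_def A'_def Cons a Nil)
          then show ?thesis by blast
        qed
        moreover have "E [(p, A')] \<in> constructible"
          using polyfam_truncate[OF A] by (intro IH) (auto simp: A'_def Cons a Nil Suc)
        moreover have "?c \<in> constructible" by (intro constructible_zero polyfam_coeff[OF A])
        ultimately show ?thesis using constructible_polyfam_zero[OF R(1)]
          by (auto intro!: constructible_Un constructible_Int constructible_Compl)
      next
        case r: (Cons b s)
        obtain k B where b: "b = (k, B)" by force
        show ?thesis
        proof (cases k)
          case 0
          have "E Fs = E (b # a # s)" by (auto simp: E_def Cons r)
          also have "\<dots> = E (a # s)" unfolding b 0 using less.prems Cons r b 0 by (intro drop) auto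
          finally show ?thesis using IH[of "a # s"] less.prems Cons r b by auto
        next
          case k: (Suc q)
          have B: "B \<in> polyfam (Suc q)" "\<forall>(n, F) \<in> set s. F \<in> polyfam n"
            using less.prems Cons r b k by auto
          show ?thesis
          proof (cases "p \<le> q")
            case True
            then show ?thesis using reduce[of p q A B s] A B Cons a r b Suc k by auto
          next
            case False
            have "E Fs = E (b # a # s)" by (auto simp: E_def Cons r)
            then show ?thesis using False reduce[of q p B A s] A B Cons a r b Suc k by auto
          qed
        qed
      qed
    qed
  qed
  then show ?case by (simp add: E_def)
qed

section \<open>Disjunctive normal forms and projections\<close>

definition basic_constructible :: "(((nat \<Rightarrow> complex) \<Rightarrow> complex) list \<times> ((nat \<Rightarrow> complex) \<Rightarrow> complex)) \<Rightarrow> (nat \<Rightarrow> complex) set" where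
  "basic_constructible = (\<lambda>(A, g). {v. (\<forall>f\<in>set A. f v = 0) \<and> g v \<noteq> 0})"

text \<open>Existential quantifiers commute with unions but not with complements, so projection
  needs unions of basic sets; one inequation per basic set is enough because several can be
  multiplied together.\<close>

definition dnf_constructible :: "(nat \<Rightarrow> complex) set \<Rightarrow> bool" where
  "dnf_constructible S \<longleftrightarrow> (\<exists>D. (\<forall>(A, g)\<in>set D. set A \<subseteq> polyfun \<and> g \<in> polyfun) \<and>
     S = (\<Union>d\<in>set D. basic_constructible d))"

lemma dnf_constructible_Un:
  assumes "dnf_constructible S" "dnf_constructible T"
  shows "dnf_constructible (S \<union> T)"
proof -
  obtain D E where "\<forall>(A, g)\<in>set D. set A \<subseteq> polyfun \<and> g \<in> polyfun" "S = (\<Union>d\<in>set D. basic_constructible d)"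
    "\<forall>(A, g)\<in>set E. set A \<subseteq> polyfun \<and> g \<in> polyfun" "T = (\<Union>d\<in>set E. basic_constructible d)"
    using assms unfolding dnf_constructible_def by blast
  then show ?thesis unfolding dnf_constructible_def by (intro exI[of _ "D @ E"]) auto
qed

lemma dnf_constructible_Int:
  assumes "dnf_constructible S" "dnf_constructible T"
  shows "dnf_constructible (S \<inter> T)"
proof -
  obtain D E where D: "\<forall>(A, g)\<in>set D. set A \<subseteq> polyfun \<and> g \<in> polyfun" "S = (\<Union>d\<in>set D. basic_constructible d)"
    and E: "\<forall>(A, g)\<in>set E. set A \<subseteq> polyfun \<and> g \<in> polyfun" "T = (\<Union>d\<in>set E. basic_constructible d)"
    using assms unfolding dnf_constructible_def by blast
  let ?F = "map (\<lambda>((A, g), (B, h)). (A @ B, \<lambda>v. g v * h v)) (List.product D E)"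
  have "\<forall>(A, g)\<in>set ?F. set A \<subseteq> polyfun \<and> g \<in> polyfun"
    using D(1) E(1) by (fastforce intro: polyfun_mult)
  moreover have "(\<Union>d\<in>set ?F. basic_constructible d) =
    (\<Union>(A, g)\<in>set D. \<Union>(B, h)\<in>set E. basic_constructible (A @ B, \<lambda>v. g v * h v))"
    by (force simp: split_beta)
  moreover have "basic_constructible (A @ B, \<lambda>v. g v * h v) =
    basic_constructible (A, g) \<inter> basic_constructible (B, h)" for A B g h
    by (auto simp: basic_constructible_def)
  ultimately have "S \<inter> T = (\<Union>d\<in>set ?F. basic_constructible d)"
    unfolding D(2) E(2) by auto
  with \<open>\<forall>(A, g)\<in>set ?F. set A \<subseteq> polyfun \<and> g \<in> polyfun\<close> show ?thesis
    unfolding dnf_constructible_def by blast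
qed

lemma dnf_constructible_basic:
  "set A \<subseteq> polyfun \<Longrightarrow> g \<in> polyfun \<Longrightarrow> dnf_constructible {v. (\<forall>f\<in>set A. f v = 0) \<and> g v \<noteq> 0}"
  unfolding dnf_constructible_def
  by (intro exI[of _ "[(A, g)]"]) (auto simp: basic_constructible_def)

lemma dnf_constructible_zero: "f \<in> polyfun \<Longrightarrow> dnf_constructible {v. f v = 0}"
  using dnf_constructible_basic[of "[f]" "\<lambda>_. 1"] by (auto intro: polyfun_const)

lemma dnf_constructible_nonzero: "f \<in> polyfun \<Longrightarrow> dnf_constructible {v. f v \<noteq> 0}"
  using dnf_constructible_basic[of "[]" f] by auto

lemma dnf_constructible_UNIV: "dnf_constructible UNIV"
  using dnf_constructible_zero[of "\<lambda>_. 0"] by (auto intro: polyfun_const)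

lemma dnf_constructible_Compl_basic:
  assumes "set A \<subseteq> polyfun" "g \<in> polyfun"
  shows "dnf_constructible (- basic_constructible (A, g))"
proof -
  have "dnf_constructible {v. \<exists>f\<in>set A. f v \<noteq> 0}"
    using assms(1)
  proof (induction A)
    case Nil
    show ?case by (auto simp: dnf_constructible_def intro: exI[of _ "[]"])
  next
    case (Cons f A)
    have "{v. \<exists>f\<in>set (f # A). f v \<noteq> 0} = {v. f v \<noteq> 0} \<union> {v. \<exists>f\<in>set A. f v \<noteq> 0}" by auto
    then show ?case using Cons by (auto intro!: dnf_constructible_Un dnf_constructible_nonzero)
  qed
  moreover have "- basic_constructible (A, g) = {v. \<exists>f\<in>set A. f v \<noteq> 0} \<union> {v. g v = 0}"
    by (auto simp: basic_constructible_def)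
  ultimately show ?thesis using assms by (auto intro!: dnf_constructible_Un dnf_constructible_zero)
qed

lemma dnf_constructible_Compl:
  assumes "dnf_constructible S"
  shows "dnf_constructible (- S)"
proof -
  obtain D where "\<forall>(A, g)\<in>set D. set A \<subseteq> polyfun \<and> g \<in> polyfun" "S = (\<Union>d\<in>set D. basic_constructible d)"
    using assms unfolding dnf_constructible_def by blast
  then show ?thesis
  proof (induction D arbitrary: S)
    case Nil
    then show ?case by (auto intro: dnf_constructible_UNIV)
  next
    case (Cons d D)
    have "- S = - basic_constructible d \<inter> - (\<Union>d\<in>set D. basic_constructible d)"
      using Cons.prems by auto
    then show ?case using Cons
      by (cases d) (auto intro!: dnf_constructible_Int dnf_constructible_Compl_basic)
  qed
qed

lemma constructible_imp_dnf: "S \<in> constructible \<Longrightarrow> dnf_constructible S"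
  by (induction rule: constructible.induct)
    (auto intro: dnf_constructible_zero dnf_constructible_Compl dnf_constructible_Int)

theorem constructible_projection:
  assumes "S \<in> constructible"
  shows "{v. \<exists>z. v(i := z) \<in> S} \<in> constructible"
proof -
  obtain D where D: "\<forall>(A, g)\<in>set D. set A \<subseteq> polyfun \<and> g \<in> polyfun" "S = (\<Union>d\<in>set D. basic_constructible d)"
    using constructible_imp_dnf[OF assms] unfolding dnf_constructible_def by blast
  have "{v. \<exists>z. v(i := z) \<in> basic_constructible (A, g)} \<in> constructible"
    if A: "set A \<subseteq> polyfun" and g: "g \<in> polyfun" for A g
  proof -
    have "\<exists>nF. snd nF \<in> polyfam (fst nF) \<and> (\<forall>v z. f (v(i := z)) = poly (snd nF v) z)" if "f \<in> polyfun" for f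
      using polyfun_as_polyfam[OF that, of i] by (metis fst_conv snd_conv)
    then obtain rep where rep: "\<And>f. f \<in> polyfun \<Longrightarrow> snd (rep f) \<in> polyfam (fst (rep f))"
      "\<And>f v z. f \<in> polyfun \<Longrightarrow> f (v(i := z)) = poly (snd (rep f) v) z" by metis
    have "{v. \<exists>z. v(i := z) \<in> basic_constructible (A, g)} =
      {v. \<exists>z. (\<forall>(n, F) \<in> set (map rep A). poly (F v) z = 0) \<and> poly (snd (rep g) v) z \<noteq> 0}"
      using A rep(2) g by (auto simp: basic_constructible_def split_beta subset_iff)
    also have "\<dots> \<in> constructible"
      using A g rep(1) by (intro constructible_projection_basic[where m = "fst (rep g)"]) (auto simp: split_beta subset_iff)
    finally show ?thesis .
  qed
  then have "(\<Union>d\<in>set D. {v. \<exists>z. v(i := z) \<in> basic_constructible d}) \<in> constructible"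
    using D(1) by (intro constructible_UN) auto
  moreover have "(\<Union>d\<in>set D. {v. \<exists>z. v(i := z) \<in> basic_constructible d}) = {v. \<exists>z. v(i := z) \<in> S}"
    using D(2) by auto
  ultimately show ?thesis by simp
qed

text \<open>On a coordinate line a constructible set is finite or cofinite. The finite side is
  bounded uniformly in the parameters, and the symmetric form lets the induction pass through
  complements.\<close>

lemma constructible_fibres_bounded:
  assumes "S \<in> constructible"
  shows "\<exists>N. \<forall>v. (finite {z. v(i := z) \<in> S} \<and> card {z. v(i := z) \<in> S} \<le> N) \<or>
    (finite {z. v(i := z) \<notin> S} \<and> card {z. v(i := z) \<notin> S} \<le> N)"
  using assms
proof (induction rule: constructible.induct)
  case (constructible_zero f)
  obtain n P where P: "P \<in> polyfam n" "\<And>v z. f (v(i := z)) = poly (P v) z"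
    using polyfun_as_polyfam[OF constructible_zero] by metis
  show ?case
  proof (intro exI[of _ n] allI)
    fix v
    show "(finite {z. v(i := z) \<in> {v. f v = 0}} \<and> card {z. v(i := z) \<in> {v. f v = 0}} \<le> n) \<or>
      (finite {z. v(i := z) \<notin> {v. f v = 0}} \<and> card {z. v(i := z) \<notin> {v. f v = 0}} \<le> n)"
    proof (cases "P v = 0")
      case False
      then show ?thesis
        using card_poly_roots_bound[OF False] polyfam_degree[OF P(1) False] poly_roots_finite[OF False] P(2) by auto
    qed (auto simp: P(2))
  qed
next
  case (constructible_Compl S)
  then show ?case by (simp add: disj_commute)
next
  case (constructible_Int S T)
  then obtain M N where M: "\<And>v. (finite {z. v(i := z) \<in> S} \<and> card {z. v(i := z) \<in> S} \<le> M) \<or>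
    (finite {z. v(i := z) \<notin> S} \<and> card {z. v(i := z) \<notin> S} \<le> M)"
    and N: "\<And>v. (finite {z. v(i := z) \<in> T} \<and> card {z. v(i := z) \<in> T} \<le> N) \<or>
    (finite {z. v(i := z) \<notin> T} \<and> card {z. v(i := z) \<notin> T} \<le> N)" by metis
  show ?case
  proof (intro exI[of _ "M + N"] allI)
    fix v
    let ?S = "{z. v(i := z) \<in> S}" let ?T = "{z. v(i := z) \<in> T}"
    have I: "{z. v(i := z) \<in> S \<inter> T} = ?S \<inter> ?T" and
      C: "{z. v(i := z) \<notin> S \<inter> T} = {z. v(i := z) \<notin> S} \<union> {z. v(i := z) \<notin> T}" by auto
    consider "finite ?S" "card ?S \<le> M" | "finite ?T" "card ?T \<le> N"
      | "finite {z. v(i := z) \<notin> S}" "card {z. v(i := z) \<notin> S} \<le> M"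
        "finite {z. v(i := z) \<notin> T}" "card {z. v(i := z) \<notin> T} \<le> N"
      using M[of v] N[of v] by blast
    then show "(finite {z. v(i := z) \<in> S \<inter> T} \<and> card {z. v(i := z) \<in> S \<inter> T} \<le> M + N) \<or>
      (finite {z. v(i := z) \<notin> S \<inter> T} \<and> card {z. v(i := z) \<notin> S \<inter> T} \<le> M + N)"
      unfolding I C
    proof cases
      case 1
      then show "(finite (?S \<inter> ?T) \<and> card (?S \<inter> ?T) \<le> M + N) \<or> (finite ({z. v(i := z) \<notin> S} \<union> {z. v(i := z) \<notin> T}) \<and>
        card ({z. v(i := z) \<notin> S} \<union> {z. v(i := z) \<notin> T}) \<le> M + N)"
        using card_mono[of ?S "?S \<inter> ?T"] by auto
    next
      case 2
      then show "(finite (?S \<inter> ?T) \<and> card (?S \<inter> ?T) \<le> M + N) \<or> (finite ({z. v(i := z) \<notin> S} \<union> {z. v(i := z) \<notin> T}) \<and>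
        card ({z. v(i := z) \<notin> S} \<union> {z. v(i := z) \<notin> T}) \<le> M + N)"
        using card_mono[of ?T "?S \<inter> ?T"] by auto
    next
      case 3
      then show "(finite (?S \<inter> ?T) \<and> card (?S \<inter> ?T) \<le> M + N) \<or> (finite ({z. v(i := z) \<notin> S} \<union> {z. v(i := z) \<notin> T}) \<and>
        card ({z. v(i := z) \<notin> S} \<union> {z. v(i := z) \<notin> T}) \<le> M + N)"
        using card_Un_le[of "{z. v(i := z) \<notin> S}" "{z. v(i := z) \<notin> T}"] by auto
    qed
  qed
qed

text \<open>A basic set with only trivial equations and a nonzero inequation contains the complement
  of a hypersurface. If the normal form has none, each basic set lies in a hypersurface, and the
  product of the equations serves for the union.\<close>

lemma constructible_dense_or_thin:
  assumes "S \<in> constructible"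
  shows "\<exists>h\<in>polyfun. (\<exists>v. h v \<noteq> 0) \<and> ({v. h v \<noteq> 0} \<subseteq> S \<or> S \<subseteq> {v. h v = 0})"
proof -
  obtain D where D: "\<forall>(A, g)\<in>set D. set A \<subseteq> polyfun \<and> g \<in> polyfun" "S = (\<Union>d\<in>set D. basic_constructible d)"
    using constructible_imp_dnf[OF assms] unfolding dnf_constructible_def by blast
  show ?thesis
  proof (cases "\<exists>(A, g)\<in>set D. (\<forall>f\<in>set A. \<forall>v. f v = 0) \<and> (\<exists>v. g v \<noteq> 0)")
    case True
    then obtain A g where "(A, g) \<in> set D" "\<forall>f\<in>set A. \<forall>v. f v = 0" "\<exists>v. g v \<noteq> 0" by blast
    moreover from this have "{v. g v \<noteq> 0} \<subseteq> S" by (auto simp: D(2) basic_constructible_def)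
    ultimately show ?thesis using D(1) by blast
  next
    case False
    have "\<exists>h\<in>polyfun. (\<exists>v. h v \<noteq> 0) \<and> basic_constructible d \<subseteq> {v. h v = 0}" if d: "d \<in> set D" for d
    proof -
      obtain A g where [simp]: "d = (A, g)" by force
      consider f where "f \<in> set A" "\<exists>v. f v \<noteq> 0" | "\<forall>v. g v = 0" using False d by force
      then show ?thesis
      proof cases
        case 1
        then show ?thesis using D(1) d by (intro bexI[of _ f]) (auto simp: basic_constructible_def)
      next
        case 2
        then show ?thesis
          by (intro bexI[of _ "\<lambda>_. 1"]) (auto simp: basic_constructible_def intro: polyfun_const)
      qed
    qed
    then obtain h where h: "\<And>d. d \<in> set D \<Longrightarrow> h d \<in> polyfun" "\<And>d. d \<in> set D \<Longrightarrow> \<exists>v. h d v \<noteq> 0"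
      "\<And>d. d \<in> set D \<Longrightarrow> basic_constructible d \<subseteq> {v. h d v = 0}" by metis
    have "S \<subseteq> {v. (\<Prod>d\<in>set D. h d v) = 0}" using h(3) by (auto simp: D(2))
    then show ?thesis
      using polyfun_prod_nonzero[of "set D" h] h
      by (intro bexI[of _ "\<lambda>v. \<Prod>d\<in>set D. h d v"]) (auto intro: polyfun_prod)
  qed
qed

section \<open>Noetherianity and irreducible components\<close>

definition lin_combs :: "(nat \<Rightarrow> 'a::comm_ring_1) \<Rightarrow> nat \<Rightarrow> 'a set" where
  "lin_combs f n = range (\<lambda>c. \<Sum>i<n. c i * f i)"

text \<open>The ascending chain condition stated for a sequence of elements: some term lies in the
  ideal generated by its predecessors. Ideals as objects are thereby avoided; \<open>n = 0\<close>
  means that the first term is zero.\<close>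

definition noetherian_on :: "'a::comm_ring_1 itself \<Rightarrow> bool" where
  "noetherian_on _ \<longleftrightarrow> (\<forall>f :: nat \<Rightarrow> 'a. \<exists>n. f n \<in> lin_combs f n)"

lemma lin_combs_mem: "i < n \<Longrightarrow> f i \<in> lin_combs f n"
  unfolding lin_combs_def
  by (rule range_eqI[of _ _ "\<lambda>j. if j = i then 1 else 0"]) (simp add: if_distrib if_distribR cong: if_cong)

lemma lin_combs_zero: "0 \<in> lin_combs f n"
  unfolding lin_combs_def by (rule range_eqI[of _ _ "\<lambda>_. 0"]) simp

lemma lin_combs_add: "a \<in> lin_combs f n \<Longrightarrow> b \<in> lin_combs f n \<Longrightarrow> a + b \<in> lin_combs f n"
  unfolding lin_combs_def
  by (clarsimp simp: sum.distrib[symmetric] distrib_right[symmetric])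

lemma lin_combs_mult: "a \<in> lin_combs f n \<Longrightarrow> r * a \<in> lin_combs f n"
  unfolding lin_combs_def
  by (clarsimp simp: sum_distrib_left mult.assoc[symmetric])

lemma lin_combs_sum: "(\<And>i. i \<in> A \<Longrightarrow> a i \<in> lin_combs f n) \<Longrightarrow> (\<Sum>i\<in>A. a i) \<in> lin_combs f n"
  by (induction A rule: infinite_finite_induct) (auto intro: lin_combs_zero lin_combs_add)

lemma lin_combs_trans:
  assumes "\<And>i. i < n \<Longrightarrow> f i \<in> lin_combs g m"
  shows "lin_combs f n \<subseteq> lin_combs g m"
  unfolding lin_combs_def[of f] using assms by (auto intro!: lin_combs_sum lin_combs_mult)

lemma lin_combs_mono: "m \<le> n \<Longrightarrow> lin_combs f m \<subseteq> lin_combs f n"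
  by (intro lin_combs_trans lin_combs_mem) auto

text \<open>Hilbert's argument: from a bad sequence \<open>g\<close>, choose each \<open>f n\<close>
  of least degree in the ideal \<open>I\<close> of \<open>g\<close> among the elements outside the
  ideal of its predecessors. A relation between leading coefficients then yields an element of
  smaller degree.\<close>

theorem hilbert_basis:
  assumes "noetherian_on TYPE('a::comm_ring_1)"
  shows "noetherian_on TYPE('a poly)"
  unfolding noetherian_on_def
proof (intro allI, rule ccontr)
  fix g :: "nat \<Rightarrow> 'a poly"
  assume "\<nexists>n. g n \<in> lin_combs g n"
  then have g: "g n \<notin> lin_combs g n" for n by auto
  define I where "I = (\<Union>n. lin_combs g n)"
  have I_diff: "a - r * b \<in> I" if ab: "a \<in> I" "b \<in> I" for a b r
  proof -
    obtain m n where "a \<in> lin_combs g m" "b \<in> lin_combs g n" using ab by (auto simp: I_def)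
    then have "a \<in> lin_combs g (max m n)" "b \<in> lin_combs g (max m n)"
      using lin_combs_mono[of m "max m n" g] lin_combs_mono[of n "max m n" g] by auto
    then have "a + (- r) * b \<in> lin_combs g (max m n)" by (intro lin_combs_add lin_combs_mult)
    then show ?thesis by (auto simp: I_def)
  qed
  define P where "P f n r \<longleftrightarrow> r \<in> I \<and> r \<notin> lin_combs f n \<and>
    (\<forall>q\<in>I. q \<notin> lin_combs f n \<longrightarrow> degree r \<le> degree q)" for f n and r :: "'a poly"
  have "\<exists>f. \<forall>n. P f n (f n)"
  proof (rule dependent_wellorder_choice)
    fix r n and f h :: "nat \<Rightarrow> 'a poly"
    assume "\<And>m. m < n \<Longrightarrow> f m = h m"
    then have "lin_combs f n = lin_combs h n" by (simp add: lin_combs_def)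
    then show "P f n r = P h n r" by (simp add: P_def)
  next
    fix n and f :: "nat \<Rightarrow> 'a poly"
    assume "\<And>m. m < n \<Longrightarrow> P f m (f m)"
    then have "\<forall>m\<in>{..<n}. \<exists>k. f m \<in> lin_combs g k" by (auto simp: P_def I_def)
    then obtain k where k: "\<And>m. m < n \<Longrightarrow> f m \<in> lin_combs g (k m)" by (metis lessThan_iff)
    define K where "K = Max (insert 0 (k ` {..<n}))"
    have "f m \<in> lin_combs g K" if "m < n" for m
      using k[OF that] lin_combs_mono[of "k m" K g] that by (auto simp: K_def)
    then have "lin_combs f n \<subseteq> lin_combs g K" by (rule lin_combs_trans)
    \<comment> \<open>\<open>g K\<close> witnesses that the finitely many earlier choices do not
      generate \<open>I\<close>: they all lie in \<open>lin_combs g K\<close>, which misses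
      it.\<close>
    then have "g K \<in> I" "g K \<notin> lin_combs f n" using g[of K] lin_combs_mem[of K "Suc K" g] by (auto simp: I_def)
    then show "\<exists>r. P f n r"
      using ex_has_least_nat[of "\<lambda>q. q \<in> I \<and> q \<notin> lin_combs f n" "g K" degree] by (auto simp: P_def)
  qed
  then obtain f where f: "\<And>n. f n \<in> I" "\<And>n. f n \<notin> lin_combs f n"
    "\<And>n q. q \<in> I \<Longrightarrow> q \<notin> lin_combs f n \<Longrightarrow> degree (f n) \<le> degree q"
    unfolding P_def by blast
  have mono: "degree (f i) \<le> degree (f n)" if "i \<le> n" for i n
    using f lin_combs_mono[OF that, of f] by blast
  obtain n where "lead_coeff (f n) \<in> lin_combs (\<lambda>n. lead_coeff (f n)) n"
    using assms unfolding noetherian_on_def by meson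
  then obtain c where c: "lead_coeff (f n) = (\<Sum>i<n. c i * lead_coeff (f i))"
    by (auto simp: lin_combs_def)
  define d where "d = degree (f n)"
  \<comment> \<open>The monomials raise every \<open>f i\<close> to degree \<open>d\<close>, which
    is possible as the degrees do not decrease; in degree \<open>d\<close> the coefficient of
    \<open>s\<close> is then the leading coefficient of \<open>f n\<close>.\<close>
  define s where "s = (\<Sum>i<n. monom (c i) (d - degree (f i)) * f i)"
  define q where "q = f n - s"
  have s: "s \<in> lin_combs f n" unfolding s_def
    by (intro lin_combs_sum lin_combs_mult lin_combs_mem) auto
  have q: "q \<notin> lin_combs f n" using lin_combs_add[OF _ s, of q] f(2)[of n] by (auto simp: q_def)
  have "f n - (\<Sum>i<k. monom (c i) (d - degree (f i)) * f i) \<in> I" for k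
  proof (induction k)
    case (Suc k)
    then show ?case using I_diff[OF Suc f(1)[of k], of "monom (c k) (d - degree (f k))"]
      by (simp add: diff_diff_add add.commute)
  qed (use f in auto)
  then have "q \<in> I" by (auto simp: q_def s_def)
  then have "d \<le> degree q" using f(3) q by (auto simp: d_def)
  have "degree s \<le> d" unfolding s_def
  proof (intro degree_sum_le)
    fix i assume "i \<in> {..<n}"
    then show "degree (monom (c i) (d - degree (f i)) * f i) \<le> d"
      using mono[of i n] degree_mult_le[of "monom (c i) (d - degree (f i))" "f i"]
        degree_monom_le[of "c i" "d - degree (f i)"] by (auto simp: d_def)
  qed auto
  then have "degree q \<le> d" by (auto simp: q_def d_def intro: degree_diff_le)
  have "coeff s d = (\<Sum>i<n. c i * lead_coeff (f i))"
    unfolding s_def coeff_sum using mono by (intro sum.cong) (auto simp: coeff_monom_mult d_def)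
  then have "coeff q d = 0" using c by (auto simp: q_def d_def)
  then have "q = 0" using \<open>d \<le> degree q\<close> \<open>degree q \<le> d\<close> by (metis le_antisym leading_coeff_0_iff)
  then show False using q lin_combs_zero by auto
qed

lemma noetherian_on_field: "noetherian_on TYPE('a::field)"
  unfolding noetherian_on_def
proof
  fix f :: "nat \<Rightarrow> 'a"
  show "\<exists>n. f n \<in> lin_combs f n"
  proof (cases "f 0 = 0")
    case True
    then show ?thesis using lin_combs_zero[of f 0] by (intro exI[of _ 0]) auto
  next
    case False
    have "f 1 \<in> lin_combs f 1"
      unfolding lin_combs_def using False by (intro range_eqI[of _ _ "\<lambda>_. f 1 / f 0"]) auto
    then show ?thesis ..
  qed
qed

lemma noetherian_on_mpoly4: "noetherian_on TYPE(mpoly4)"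
  by (intro hilbert_basis noetherian_on_field)

section \<open>Points of complex 4-space as valuations\<close>

lemma eval4_add: "eval4 (F + G) p = eval4 F p + eval4 G p"
  by (cases p) (auto simp: eval4_def)

lemma eval4_mult: "eval4 (F * G) p = eval4 F p * eval4 G p"
  by (cases p) (auto simp: eval4_def)

lemma eval4_zero: "eval4 0 p = 0"
  by (cases p) (auto simp: eval4_def)

lemma eval4_sum: "eval4 (\<Sum>a\<in>A. f a) p = (\<Sum>a\<in>A. eval4 (f a) p)"
  by (induction A rule: infinite_finite_induct) (auto simp: eval4_add eval4_zero)

definition coords :: "pt4 \<Rightarrow> nat \<Rightarrow> complex" where
  "coords p = (case p of ((x, y), (s, t)) \<Rightarrow>
     (\<lambda>i. if i = 0 then x else if i = 1 then y else if i = 2 then s else if i = 3 then t else 0))"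

definition of_coords :: "(nat \<Rightarrow> complex) \<Rightarrow> pt4" where
  "of_coords v = ((v 0, v 1), (v 2, v 3))"

lemma coords_simps [simp]:
  "coords p 0 = fst (fst p)" "coords p (Suc 0) = snd (fst p)" "coords p 2 = fst (snd p)" "coords p 3 = snd (snd p)"
  by (auto simp: coords_def split: prod.splits)

lemma coords_ge_4: "i \<ge> 4 \<Longrightarrow> coords p i = 0"
  by (auto simp: coords_def split: prod.splits)

lemma of_coords_coords [simp]: "of_coords (coords p) = p"
  by (auto simp: of_coords_def)

lemma less_4_cases: "(i::nat) < 4 \<longleftrightarrow> i = 0 \<or> i = 1 \<or> i = 2 \<or> i = 3" by auto

lemma coords_eqI: "(\<And>i. i < 4 \<Longrightarrow> coords p i = coords q i) \<Longrightarrow> p = q"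
proof -
  assume eq: "\<And>i. i < 4 \<Longrightarrow> coords p i = coords q i"
  have "of_coords (coords p) = of_coords (coords q)"
    using eq[of 0] eq[of 1] eq[of 2] eq[of 3] by (simp add: of_coords_def prod_eq_iff)
  then show "p = q" by simp
qed

lemma eval1_polyfun: "(\<lambda>v. poly p (v i)) \<in> polyfun"
  by (induction p) (auto intro!: polyfun_intros)

lemma eval2_polyfun: "(\<lambda>v. poly (poly p [:v i:]) (v j)) \<in> polyfun"
  by (induction p) (auto intro!: polyfun_intros eval1_polyfun)

lemma eval3_polyfun: "(\<lambda>v. poly (poly (poly p [:[:v i:]:]) [:v j:]) (v k)) \<in> polyfun"
  by (induction p) (auto intro!: polyfun_intros eval2_polyfun)

lemma eval4_polyfun: "(\<lambda>v. eval4 F (of_coords v)) \<in> polyfun"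
  unfolding eval4_def of_coords_def
  by (induction F) (auto intro!: polyfun_intros eval3_polyfun)

lemma polyfun_eval4:
  assumes "f \<in> polyfun"
  shows "\<exists>F. \<forall>p. eval4 F p = f (coords p)"
  using assms
proof (induction rule: polyfun.induct)
  case (polyfun_const c)
  show ?case by (intro exI[of _ "[:[:[:[:c:]:]:]:]"]) (auto simp: eval4_def)
next
  case (polyfun_var i)
  consider "i = 0" | "i = 1" | "i = 2" | "i = 3" | "i \<ge> 4" by linarith
  then show ?case
  proof cases
    case 1 then show ?thesis by (intro exI[of _ "[:0, 1:]"]) (auto simp: eval4_def)
  next
    case 2 then show ?thesis by (intro exI[of _ "[:[:0, 1:]:]"]) (auto simp: eval4_def)
  next
    case 3 then show ?thesis by (intro exI[of _ "[:[:[:0, 1:]:]:]"]) (auto simp: eval4_def)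
  next
    case 4 then show ?thesis by (intro exI[of _ "[:[:[:[:0, 1:]:]:]:]"]) (auto simp: eval4_def)
  next
    case 5 then show ?thesis by (intro exI[of _ 0]) (auto simp: eval4_zero coords_ge_4)
  qed
next
  case (polyfun_add f g)
  then show ?case by (metis eval4_add)
next
  case (polyfun_mult f g)
  then show ?case by (metis eval4_mult)
qed

section \<open>Closed sets and irreducible components\<close>

lemma is_variety_zero_set: "is_variety (zero_set S)"
  by (auto simp: is_variety_def)

lemma is_variety_polyfun:
  assumes "f \<in> polyfun"
  shows "is_variety {p. f (coords p) = 0}"
proof -
  obtain F where "\<forall>p. eval4 F p = f (coords p)" using polyfun_eval4[OF assms] by auto
  then have "{p. f (coords p) = 0} = zero_set {F}" by (auto simp: zero_set_def)
  then show ?thesis by (auto simp: is_variety_def)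
qed

lemma is_variety_INT: "(\<And>a. a \<in> A \<Longrightarrow> is_variety (X a)) \<Longrightarrow> is_variety (\<Inter>a\<in>A. X a)"
proof -
  assume "\<And>a. a \<in> A \<Longrightarrow> is_variety (X a)"
  then obtain S where "\<And>a. a \<in> A \<Longrightarrow> X a = zero_set (S a)" unfolding is_variety_def by metis
  then have "(\<Inter>a\<in>A. X a) = zero_set (\<Union>a\<in>A. S a)" by (auto simp: zero_set_def)
  then show ?thesis by (auto simp: is_variety_def)
qed

lemma is_variety_Int: "is_variety X \<Longrightarrow> is_variety Y \<Longrightarrow> is_variety (X \<inter> Y)"
  using is_variety_INT[of "{X, Y}" "\<lambda>x. x"] by auto

lemma is_variety_Un: "is_variety X \<Longrightarrow> is_variety Y \<Longrightarrow> is_variety (X \<union> Y)"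
proof -
  assume "is_variety X" "is_variety Y"
  then obtain S T where "X = zero_set S" "Y = zero_set T" by (auto simp: is_variety_def)
  then have "X \<union> Y = zero_set ((\<lambda>(F, G). F * G) ` (S \<times> T))"
    by (auto simp: zero_set_def eval4_mult)
  then show ?thesis by (auto simp: is_variety_def)
qed

lemma is_variety_empty: "is_variety {}"
  using is_variety_polyfun[OF polyfun_const[of 1]] by simp

lemma is_variety_UN: "finite A \<Longrightarrow> (\<And>a. a \<in> A \<Longrightarrow> is_variety (X a)) \<Longrightarrow> is_variety (\<Union>a\<in>A. X a)"
  by (induction A rule: finite_induct) (auto intro: is_variety_Un is_variety_empty)

lemma is_variety_coord: "is_variety {p. coords p i = c}"
  using is_variety_polyfun[OF polyfun_diff[OF polyfun_var polyfun_const], of i c] by simp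

lemma is_variety_singleton: "is_variety {p}"
proof -
  have "{p} = (\<Inter>i\<in>{..<4}. {q. coords q i = coords p i})" by (auto intro: coords_eqI)
  then show ?thesis using is_variety_INT[OF is_variety_coord] by simp
qed

text \<open>Along an infinite descent take polynomials \<open>F i\<close> vanishing on
  \<open>X (Suc i)\<close> but not on \<open>X i\<close>. Noetherianity makes some
  \<open>F n\<close> a combination of its predecessors, which all vanish on
  \<open>X n\<close>.\<close>

lemma wf_variety: "wf {(X, Y). is_variety X \<and> is_variety Y \<and> X \<subset> Y}"
  unfolding wf_iff_no_infinite_down_chain
proof
  assume "\<exists>X. \<forall>i. (X (Suc i), X i) \<in> {(X, Y). is_variety X \<and> is_variety Y \<and> X \<subset> Y}"
  then obtain X where "\<forall>i. is_variety (X (Suc i)) \<and> is_variety (X i) \<and> X (Suc i) \<subset> X i" by auto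
  then have X: "\<And>i. is_variety (X i)" "\<And>i. X (Suc i) \<subset> X i" by blast+
  have "\<exists>F. (\<forall>p\<in>X (Suc i). eval4 F p = 0) \<and> (\<exists>p\<in>X i. eval4 F p \<noteq> 0)" for i
  proof -
    obtain S where "X (Suc i) = zero_set S" using X(1) by (auto simp: is_variety_def)
    moreover obtain p where "p \<in> X i" "p \<notin> X (Suc i)" using X(2) by blast
    ultimately show ?thesis by (auto simp: zero_set_def)
  qed
  then obtain F where F: "\<And>i p. p \<in> X (Suc i) \<Longrightarrow> eval4 (F i) p = 0" "\<And>i. \<exists>p\<in>X i. eval4 (F i) p \<noteq> 0"
    by metis
  obtain n where "F n \<in> lin_combs F n" using noetherian_on_mpoly4 unfolding noetherian_on_def by auto
  then obtain c where c: "F n = (\<Sum>i<n. c i * F i)" by (auto simp: lin_combs_def)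
  have "eval4 (F n) p = 0" if "p \<in> X n" for p
  proof -
    have "eval4 (F i) p = 0" if "i < n" for i
    proof -
      have "X n \<subseteq> X (Suc i)"
      proof (rule lift_Suc_antimono_le[of X])
      qed (use X(2) that in auto)
      then show ?thesis using F(1) \<open>p \<in> X n\<close> by blast
    qed
    then show ?thesis by (subst c) (auto simp: eval4_sum eval4_mult)
  qed
  then show False using F(2) by blast
qed

text \<open>A minimal zero set among those of finite subsets of \<open>S\<close> cannot shrink when
  further elements of \<open>S\<close> are added. Finiteness is what turns varieties into
  constructible sets.\<close>

lemma zero_set_finite:
  obtains T where "finite T" "T \<subseteq> S" "zero_set S = zero_set T"
proof -
  let ?Q = "{zero_set T | T. finite T \<and> T \<subseteq> S}"
  have "zero_set {} \<in> ?Q" by blast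
  then obtain Z where Z: "Z \<in> ?Q" "\<And>Y. Y \<subset> Z \<Longrightarrow> is_variety Y \<Longrightarrow> is_variety Z \<Longrightarrow> Y \<notin> ?Q"
    using wfE_min[OF wf_variety, of _ ?Q] by (metis (no_types, lifting) case_prodI mem_Collect_eq)
  then obtain T where T: "finite T" "T \<subseteq> S" "Z = zero_set T" by auto
  have "eval4 F p = 0" if "F \<in> S" "p \<in> Z" for F p
  proof (rule ccontr)
    assume "eval4 F p \<noteq> 0"
    then have "zero_set (insert F T) \<subset> Z" using T that by (auto simp: zero_set_def)
    moreover have "zero_set (insert F T) \<in> ?Q" using T that by blast
    ultimately show False using Z(2) T(3) is_variety_zero_set by blast
  qed
  then have "zero_set S = zero_set T" using T by (auto simp: zero_set_def)
  then show ?thesis using that T by blast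
qed

lemma constructible_variety:
  assumes "is_variety X"
  shows "{v. of_coords v \<in> X} \<in> constructible"
proof -
  obtain S where "X = zero_set S" using assms by (auto simp: is_variety_def)
  then obtain T where "finite T" "X = zero_set T" using zero_set_finite by metis
  then have "{v. of_coords v \<in> X} = (\<Inter>F\<in>T. {v. eval4 F (of_coords v) = 0})"
    by (auto simp: zero_set_def)
  then show ?thesis
    using \<open>finite T\<close> by (auto intro!: constructible_INT constructible_zero eval4_polyfun)
qed

lemma irreducible_varietyD: "irreducible_variety V \<Longrightarrow> is_variety V" "irreducible_variety V \<Longrightarrow> V \<noteq> {}"
  by (auto simp: irreducible_variety_def)

lemma irreducible_variety_singleton: "irreducible_variety {p}"
  by (auto simp: irreducible_variety_def is_variety_singleton)

lemma irreducible_variety_UN: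
  assumes "irreducible_variety V" "finite A" "\<And>a. a \<in> A \<Longrightarrow> is_variety (X a)" "V \<subseteq> (\<Union>a\<in>A. X a)"
  shows "\<exists>a\<in>A. V \<subseteq> X a"
  using assms(2-4)
proof (induction A rule: finite_induct)
  case empty
  then show ?case using assms(1) by (auto simp: irreducible_variety_def)
next
  case (insert a A)
  have "V \<subseteq> X a \<union> (\<Union>a\<in>A. X a)" using insert.prems by auto
  moreover have "is_variety (\<Union>a\<in>A. X a)" using insert by (intro is_variety_UN) auto
  ultimately have "V \<subseteq> X a \<or> V \<subseteq> (\<Union>a\<in>A. X a)"
    using assms(1) insert.prems(1)[of a] unfolding irreducible_variety_def by blast
  then show ?case using insert by auto
qed

lemma irreducible_variety_polyfun_mult:
  assumes "irreducible_variety V" "f \<in> polyfun" "g \<in> polyfun" "\<And>p. p \<in> V \<Longrightarrow> f (coords p) * g (coords p) = 0"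
  shows "(\<forall>p\<in>V. f (coords p) = 0) \<or> (\<forall>p\<in>V. g (coords p) = 0)"
proof -
  have "V \<subseteq> {p. f (coords p) = 0} \<union> {p. g (coords p) = 0}" using assms(4) by auto
  then have "V \<subseteq> {p. f (coords p) = 0} \<or> V \<subseteq> {p. g (coords p) = 0}"
    using assms is_variety_polyfun unfolding irreducible_variety_def by metis
  then show ?thesis by blast
qed

lemma irreducible_variety_finite:
  assumes "irreducible_variety V" "finite V"
  shows "\<exists>p. V = {p}"
proof -
  obtain p where "p \<in> V" "V \<subseteq> {p}"
    using irreducible_variety_UN[OF assms, of "\<lambda>p. {p}"] is_variety_singleton by auto
  then show ?thesis by blast
qed

lemma variety_irreducible_decomposition:
  assumes "is_variety X"
  shows "\<exists>VV. finite VV \<and> (\<forall>V\<in>VV. irreducible_variety V) \<and> X = \<Union>VV"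
  using assms
proof (induction X rule: wf_induct_rule[OF wf_variety])
  case (1 X)
  consider "X = {}" | "irreducible_variety X"
    | A B where "is_variety A" "is_variety B" "X \<subseteq> A \<union> B" "\<not> X \<subseteq> A" "\<not> X \<subseteq> B"
    using 1(2) unfolding irreducible_variety_def by blast
  then show ?case
  proof cases
    case 1
    then show ?thesis by (intro exI[of _ "{}"]) auto
  next
    case 2
    then show ?thesis by (intro exI[of _ "{X}"]) auto
  next
    case 3
    then have "X \<inter> A \<subset> X" "X \<inter> B \<subset> X" "is_variety (X \<inter> A)" "is_variety (X \<inter> B)"
      using 1(2) by (auto intro: is_variety_Int)
    then obtain VV WW where "finite VV" "\<forall>V\<in>VV. irreducible_variety V" "X \<inter> A = \<Union>VV"
      "finite WW" "\<forall>V\<in>WW. irreducible_variety V" "X \<inter> B = \<Union>WW"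
      using 1 by (metis (no_types, lifting) case_prodI mem_Collect_eq)
    moreover have "X = (X \<inter> A) \<union> (X \<inter> B)" using 3 by auto
    ultimately show ?thesis by (intro exI[of _ "VV \<union> WW"]) auto
  qed
qed

lemma irreducible_components_finite_cover:
  assumes "is_variety X"
  shows "finite (irreducible_components X)" "X = \<Union>(irreducible_components X)"
proof -
  obtain VV where VV: "finite VV" "\<And>V. V \<in> VV \<Longrightarrow> irreducible_variety V" "X = \<Union>VV"
    using variety_irreducible_decomposition[OF assms] by blast
  have contained: "\<exists>V\<in>VV. W \<subseteq> V" if "irreducible_variety W" "W \<subseteq> X" for W
    using irreducible_variety_UN[OF that(1) VV(1), of "\<lambda>V. V"] VV that irreducible_varietyD by auto
  have "irreducible_components X \<subseteq> VV"
  proof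
    fix W assume W: "W \<in> irreducible_components X"
    then obtain V where "V \<in> VV" "W \<subseteq> V" using contained[of W] by (auto simp: irreducible_components_def)
    moreover have "V \<subseteq> X" using \<open>V \<in> VV\<close> VV(3) by blast
    ultimately have "V = W" using W VV(2)[of V] by (auto simp: irreducible_components_def)
    then show "W \<in> VV" using \<open>V \<in> VV\<close> by simp
  qed
  then show "finite (irreducible_components X)" using VV(1) finite_subset by blast
  have "\<exists>W\<in>irreducible_components X. V \<subseteq> W" if V: "V \<in> VV" for V
  proof -
    from finite_has_maximal2[OF VV(1) V]
    obtain W where W: "W \<in> VV" "V \<subseteq> W" "\<forall>U\<in>VV. W \<subseteq> U \<longrightarrow> W = U" by auto
    have "U = W" if "irreducible_variety U" "W \<subseteq> U" "U \<subseteq> X" for U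
    proof -
      obtain U' where "U' \<in> VV" "U \<subseteq> U'" using contained[OF \<open>irreducible_variety U\<close> \<open>U \<subseteq> X\<close>] by auto
      moreover from this have "W = U'" using W(3) \<open>W \<subseteq> U\<close> by auto
      ultimately show ?thesis using \<open>W \<subseteq> U\<close> by auto
    qed
    moreover have "W \<subseteq> X" "irreducible_variety W" using W(1) VV(2,3) by auto
    ultimately have "W \<in> irreducible_components X" by (simp add: irreducible_components_def)
    then show ?thesis using W(2) by blast
  qed
  then have "X \<subseteq> \<Union>(irreducible_components X)" unfolding VV(3) by blast
  then show "X = \<Union>(irreducible_components X)" by (auto simp: irreducible_components_def)
qed

section \<open>Dimension and linear sections\<close>

lemma has_chain_subset: "has_chain X n \<Longrightarrow> X \<subseteq> Y \<Longrightarrow> has_chain Y n"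
  unfolding has_chain_def by blast

lemma has_chain_SucD:
  assumes "has_chain X (Suc n)"
  obtains V W where "irreducible_variety V" "V \<subseteq> X" "irreducible_variety W" "W \<subset> V" "has_chain W n"
proof -
  obtain f where f: "\<forall>i\<le>Suc n. irreducible_variety (f i)" "\<forall>i<Suc n. f i \<subset> f (Suc i)" "f (Suc n) \<subseteq> X"
    using assms unfolding has_chain_def by blast
  then have "has_chain (f n) n" unfolding has_chain_def by (intro exI[of _ f]) auto
  then show ?thesis using that[of "f (Suc n)" "f n"] f by auto
qed

lemma has_chain_SucI:
  assumes "irreducible_variety V" "W \<subset> V" "has_chain W n"
  shows "has_chain V (Suc n)"
proof -
  obtain f where f: "\<forall>i\<le>n. irreducible_variety (f i)" "\<forall>i<n. f i \<subset> f (Suc i)" "f n \<subseteq> W"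
    using assms(3) unfolding has_chain_def by blast
  show ?thesis
    unfolding has_chain_def
    using f assms by (intro exI[of _ "f(Suc n := V)"]) (auto simp: less_Suc_eq le_Suc_eq)
qed

lemma has_chain_Suc_imp: "has_chain X (Suc n) \<Longrightarrow> has_chain X n"
  by (metis has_chain_SucD has_chain_subset psubset_imp_subset subset_trans)

lemma has_chain_mono: "has_chain X n \<Longrightarrow> m \<le> n \<Longrightarrow> has_chain X m"
  by (induction n) (auto simp: le_Suc_eq dest: has_chain_Suc_imp)

lemma has_chain_0: "irreducible_variety V \<Longrightarrow> has_chain V 0"
  unfolding has_chain_def by auto

lemma variety_dim_eqI:
  assumes "has_chain X k" "\<not> has_chain X (Suc k)"
  shows "variety_dim X = k"
  unfolding variety_dim_def
proof (rule Greatest_equality)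
  fix n assume "has_chain X n"
  then show "n \<le> k" using assms(2) has_chain_mono[of X n "Suc k"] by (meson not_less_eq_eq)
qed (fact assms)

text \<open>A component through \<open>p\<close> that is larger than the point would sit on top of
  the chain starting at \<open>{p}\<close>.\<close>

lemma no_chain_1_finite:
  assumes "is_variety X" "\<not> has_chain X (Suc 0)"
  shows "finite X"
proof -
  have "finite V" if V: "V \<in> irreducible_components X" for V
  proof -
    have irr: "irreducible_variety V" "V \<subseteq> X" using V by (auto simp: irreducible_components_def)
    then obtain p where p: "p \<in> V" using irreducible_varietyD by blast
    have "V = {p}"
    proof (rule ccontr)
      assume "V \<noteq> {p}"
      then have "{p} \<subset> V" using p by auto
      then have "has_chain V (Suc 0)"
        using has_chain_SucI[OF irr(1)] has_chain_0[OF irreducible_variety_singleton] by blast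
      then show False using assms(2) has_chain_subset irr(2) by blast
    qed
    then show ?thesis by auto
  qed
  then show ?thesis using irreducible_components_finite_cover[OF assms(1)] by (metis finite_Union)
qed

lemma no_chain_proper_section:
  assumes "irreducible_variety V" "\<not> has_chain V (Suc n)" "\<not> V \<subseteq> A"
  shows "\<not> has_chain (V \<inter> A) n"
  using assms has_chain_SucI[of V "V \<inter> A" n] by blast

section \<open>Images of varieties and independent coordinates\<close>

definition join :: "pt4 \<Rightarrow> (nat \<Rightarrow> complex) \<Rightarrow> nat \<Rightarrow> complex" where
  "join p v = (\<lambda>i. if i < 4 then coords p i else v (i - 4))"

text \<open>The slots 0 to 3 of \<open>join p v\<close> hold the point and those from 4 on the
  parameters; four projections remove the point, and the parameters move back by four
  places.\<close>

lemma constructible_image: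
  assumes "is_variety X" "S \<in> constructible"
  shows "{v. \<exists>p\<in>X. join p v \<in> S} \<in> constructible"
proof -
  define T where "T = {w. of_coords w \<in> X} \<inter> S"
  have "T \<in> constructible" unfolding T_def
    using constructible_variety assms by (intro constructible_Int) auto
  then have "{w. \<exists>a. w(0 := a) \<in> {w. \<exists>b. w(1 := b) \<in> {w. \<exists>c. w(2 := c) \<in> {w. \<exists>d. w(3 := d) \<in> T}}}} \<in> constructible"
    by (intro constructible_projection)
  then have "{w. \<exists>a b c d. w(0 := a, 1 := b, 2 := c, 3 := d) \<in> T} \<in> constructible" (is "?U \<in> _") by simp
  then have "{v. (\<lambda>i. if i < 4 then 0 else v (i - 4)) \<in> ?U} \<in> constructible"
  proof (rule constructible_subst)
    fix i show "(\<lambda>v. if i < 4 then 0 else v (i - 4)) \<in> polyfun"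
      by (cases "i < 4") (auto intro: polyfun_intros)
  qed
  moreover have "(\<lambda>i. if i < 4 then 0 else v (i - 4)) \<in> ?U \<longleftrightarrow> (\<exists>p\<in>X. join p v \<in> S)" for v
  proof -
    have *: "(\<lambda>i. if i < 4 then 0 else v (i - 4))(0 := a, 1 := b, 2 := c, 3 := d) = join ((a, b), (c, d)) v" for a b c d
      by (rule ext) (auto simp: join_def coords_def)
    have "of_coords (join p v) = p" for p by (simp add: of_coords_def join_def)
    then show ?thesis unfolding mem_Collect_eq * T_def by auto
  qed
  ultimately show ?thesis by simp
qed

definition depends_only_on :: "nat set \<Rightarrow> ((nat \<Rightarrow> complex) \<Rightarrow> complex) \<Rightarrow> bool" where
  "depends_only_on I h \<longleftrightarrow> (\<forall>v w. (\<forall>i\<in>I. v i = w i) \<longrightarrow> h v = h w)"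

text \<open>Algebraic independence, as functions on \<open>V\<close>, of the coordinates with index
  in \<open>I\<close>; in other words, the projection of \<open>V\<close> to these coordinates is
  Zariski dense.\<close>

definition indep :: "pt4 set \<Rightarrow> nat set \<Rightarrow> bool" where
  "indep V I \<longleftrightarrow> (\<forall>h\<in>polyfun. depends_only_on I h \<longrightarrow> (\<forall>p\<in>V. h (coords p) = 0) \<longrightarrow> (\<forall>v. h v = 0))"

lemma polyfun_override: "h \<in> polyfun \<Longrightarrow> (\<lambda>v. h (\<lambda>n. if n \<in> I then v n else w n)) \<in> polyfun"
proof (erule polyfun_subst)
  show "(\<lambda>v. if i \<in> I then v i else w i) \<in> polyfun" for i
    by (cases "i \<in> I") (auto intro: polyfun_intros)
qed

text \<open>The image is constructible. If it lay in a hypersurface \<open>h = 0\<close>, freezing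
  the coordinates outside \<open>I\<close> at a point \<open>w\<close> with
  \<open>h w \<noteq> 0\<close> would turn \<open>h\<close> into a nontrivial relation between the
  coordinates in \<open>I\<close>.\<close>

lemma indep_dense_image:
  assumes V: "is_variety V" and I: "I \<subseteq> {..<4}" and indep: "indep V I"
  obtains h where "h \<in> polyfun" "\<exists>v. h v \<noteq> 0" "\<And>v. h v \<noteq> 0 \<Longrightarrow> \<exists>p\<in>V. \<forall>j\<in>I. coords p j = v j"
proof -
  define S where "S = {v. \<exists>p\<in>V. join p v \<in> (\<Inter>j\<in>I. {w. w j - w (j + 4) = 0})}"
  have "S \<in> constructible" unfolding S_def using finite_subset[OF I]
    by (intro constructible_image V constructible_INT constructible_zero polyfun_intros) auto
  have S: "S = {v. \<exists>p\<in>V. \<forall>j\<in>I. coords p j = v j}"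
  proof -
    have "join p v j - join p v (j + 4) = 0 \<longleftrightarrow> coords p j = v j" if "j \<in> I" for j p v
      using that I by (auto simp: join_def)
    then show ?thesis unfolding S_def by (simp cong: ball_cong)
  qed
  obtain h where h: "h \<in> polyfun" "\<exists>v. h v \<noteq> 0" "{v. h v \<noteq> 0} \<subseteq> S \<or> S \<subseteq> {v. h v = 0}"
    using constructible_dense_or_thin[OF \<open>S \<in> constructible\<close>] by (elim bexE conjE) (rule that)
  then obtain w where w: "h w \<noteq> 0" by blast
  have "\<not> S \<subseteq> {v. h v = 0}"
  proof
    assume thin: "S \<subseteq> {v. h v = 0}"
    define g where "g v = h (\<lambda>n. if n \<in> I then v n else w n)" for v
    have "g (coords p) = 0" if "p \<in> V" for p
    proof -
      have "(\<lambda>n. if n \<in> I then coords p n else w n) \<in> S" unfolding S using that by auto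
      then show ?thesis using thin by (auto simp: g_def)
    qed
    moreover have "g \<in> polyfun" unfolding g_def[abs_def] by (rule polyfun_override) fact
    moreover have "depends_only_on I g"
      unfolding depends_only_on_def g_def by (auto intro!: arg_cong[of _ _ h])
    ultimately have "g w = 0" using indep unfolding indep_def by blast
    then show False using w by (simp add: g_def)
  qed
  then show ?thesis using that[of h] h by (auto simp: S)
qed

text \<open>Slice by the hyperplane on which coordinate \<open>i\<close> takes the generic value
  \<open>w i\<close>. If every component of the slice had a relation between the remaining
  coordinates, the product of these relations would vanish on the slice, which however still reaches
  generic values of those coordinates.\<close>

lemma indep_hyperplane_component:
  assumes V: "irreducible_variety V" and I: "I \<subseteq> {..<4}" "i \<in> I" and indep: "indep V I"
  obtains W where "irreducible_variety W" "W \<subset> V" "indep W (I - {i})"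
proof -
  note V' = irreducible_varietyD(1)[OF V]
  obtain h w where h: "h \<in> polyfun" "h w \<noteq> 0" "\<And>v. h v \<noteq> 0 \<Longrightarrow> \<exists>p\<in>V. \<forall>j\<in>I. coords p j = v j"
    using indep_dense_image[OF V' I(1) indep] by metis
  define X where "X = V \<inter> {p. coords p i = w i}"
  have X: "is_variety X" unfolding X_def by (intro is_variety_Int V' is_variety_coord)
  note C = irreducible_components_finite_cover[OF X]
  have "\<exists>W\<in>irreducible_components X. indep W (I - {i})"
  proof (rule ccontr)
    assume "\<not> ?thesis"
    then have "\<forall>W\<in>irreducible_components X. \<exists>g\<in>polyfun. depends_only_on (I - {i}) g \<and> (\<forall>p\<in>W. g (coords p) = 0) \<and> (\<exists>v. g v \<noteq> 0)"
      unfolding indep_def by blast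
    then obtain g where g: "\<And>W. W \<in> irreducible_components X \<Longrightarrow> g W \<in> polyfun"
      "\<And>W. W \<in> irreducible_components X \<Longrightarrow> depends_only_on (I - {i}) (g W)"
      "\<And>W p. W \<in> irreducible_components X \<Longrightarrow> p \<in> W \<Longrightarrow> g W (coords p) = 0"
      "\<And>W. W \<in> irreducible_components X \<Longrightarrow> \<exists>v. g W v \<noteq> 0" by metis
    define G where "G v = (\<Prod>W\<in>irreducible_components X. g W v)" for v
    have G: "G \<in> polyfun" unfolding G_def[abs_def] by (rule polyfun_prod, rule g(1))
    have "\<exists>v. G v \<noteq> 0" 
      using polyfun_prod_nonzero[of "irreducible_components X" g] C(1) g(1,4) unfolding G_def by blast
    note G = G this
    have G0: "G (coords p) = 0" if "p \<in> X" for p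
    proof -
      have "p \<in> \<Union>(irreducible_components X)" using that by (subst C(2)[symmetric])
      then obtain W where "W \<in> irreducible_components X" "p \<in> W" by blast
      then show ?thesis using g(3) C(1) unfolding G_def by (metis prod_zero)
    qed
    \<comment> \<open>Only the coordinates in \<open>I - {i}\<close> stay variable, so any
      \<open>u\<close> with \<open>k u \<noteq> 0\<close> is realised there by a point of the
      slice.\<close>
    define k where "k v = h (\<lambda>n. if n \<in> I - {i} then v n else w n)" for v
    have "k \<in> polyfun" unfolding k_def[abs_def] by (rule polyfun_override) fact
    moreover have "k w \<noteq> 0" using h(2) by (simp add: k_def)
    ultimately obtain u where u: "k u \<noteq> 0" "G u \<noteq> 0" using polyfun_no_zero_divisors G by blast
    then obtain p where p: "p \<in> V" "\<forall>j\<in>I. coords p j = (if j \<in> I - {i} then u j else w j)"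
      using h(3) unfolding k_def by blast
    have "p \<in> X" using p I by (auto simp: X_def)
    have "g W (coords p) = g W u" if "W \<in> irreducible_components X" for W
      using g(2)[OF that] p(2) unfolding depends_only_on_def by (metis Diff_iff)
    then have "G (coords p) = G u" by (simp add: G_def)
    then show False using G0[OF \<open>p \<in> X\<close>] u(2) by simp
  qed
  then obtain W where W: "irreducible_variety W" "W \<subseteq> X" "indep W (I - {i})"
    by (auto simp: irreducible_components_def)
  moreover have "W \<noteq> V"
  proof
    assume "W = V"
    then have "\<forall>p\<in>V. coords p i - w i = 0" using W by (auto simp: X_def)
    moreover have "(\<lambda>v. v i - w i) \<in> polyfun" by (intro polyfun_intros)
    moreover have "depends_only_on I (\<lambda>v. v i - w i)" using I by (auto simp: depends_only_on_def)
    ultimately have "\<forall>v :: nat \<Rightarrow> complex. v i - w i = 0" using indep unfolding indep_def by blast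
    from spec[OF this, of "\<lambda>_. w i + 1"] show False by simp
  qed
  ultimately show ?thesis using that by (auto simp: X_def)
qed

text \<open>Used contrapositively: without a chain of length three, any three coordinates are
  algebraically dependent.\<close>

lemma indep_imp_has_chain:
  assumes "irreducible_variety V" "I \<subseteq> {..<4}" "indep V I"
  shows "has_chain V (card I)"
  using assms
proof (induction "card I" arbitrary: V I)
  case 0
  then show ?case by (simp add: has_chain_0)
next
  case (Suc n)
  then obtain i where i: "i \<in> I" by fastforce
  have "finite I" using Suc.prems(2) finite_subset by auto
  then have n: "n = card (I - {i})" using Suc.hyps(2) i by simp
  obtain W where W: "irreducible_variety W" "W \<subset> V" "indep W (I - {i})"
    using indep_hyperplane_component[OF Suc.prems(1,2) i Suc.prems(3)] .
  have "has_chain W n" unfolding n using Suc.hyps(1)[OF n W(1) _ W(3)] Suc.prems(2) by auto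
  then show ?case using has_chain_SucI[OF Suc.prems(1) W(2)] by (simp add: Suc.hyps(2)[symmetric])
qed

section \<open>Finite linear sections and the degree\<close>

definition lin_form :: "complex \<times> complex \<times> complex \<times> complex \<times> complex \<Rightarrow> pt4 \<Rightarrow> complex" where
  "lin_form = (\<lambda>(a, b, c, e, f) p. a * coords p 0 + b * coords p 1 + c * coords p 2 + e * coords p 3 - f)"

lemma lin_form_simp [simp]:
  "lin_form (a, b, c, e, f) p = a * coords p 0 + b * coords p 1 + c * coords p 2 + e * coords p 3 - f"
  by (simp add: lin_form_def)

lemma lin_set_altdef: "lin_set eqs = {p. \<forall>e\<in>set eqs. lin_form e p = 0}"
  by (auto simp: lin_set_def lin_form_def split_beta)

lemma is_variety_lin_set: "is_variety (lin_set eqs)"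
proof -
  have "is_variety {p. lin_form e p = 0}" for e
  proof -
    obtain a b c d f where [simp]: "e = (a, b, c, d, f)" by (cases e)
    have "(\<lambda>v. a * v 0 + b * v 1 + c * v 2 + d * v 3 - f) \<in> polyfun" by (intro polyfun_intros)
    from is_variety_polyfun[OF this] show ?thesis by simp
  qed
  then have "is_variety (\<Inter>e\<in>set eqs. {p. lin_form e p = 0})" by (rule is_variety_INT)
  moreover have "lin_set eqs = (\<Inter>e\<in>set eqs. {p. lin_form e p = 0})" by (auto simp: lin_set_altdef)
  ultimately show ?thesis by simp
qed

text \<open>For each \<open>q\<close> the incidence condition is a nonzero linear form in the
  coefficients \<open>v\<close> of a hyperplane through \<open>p\<close>, so some \<open>v\<close>
  avoids them all.\<close>

lemma exists_avoiding_hyperplane: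
  assumes "finite A" "p \<notin> A"
  obtains e where "p \<in> lin_set [e]" "\<And>q. q \<in> A \<Longrightarrow> q \<notin> lin_set [e]"
proof -
  define f where "f q v = (\<Sum>i<4. v i * (coords q i - coords p i))" for q v
  have "\<exists>v. f q v \<noteq> 0" if q: "q \<in> A" for q
  proof -
    have "q \<noteq> p" using q assms by auto
    then obtain i where i: "i < 4" "coords q i \<noteq> coords p i" using coords_eqI by metis
    have "f q (\<lambda>j. if j = i then 1 else 0) = coords q i - coords p i"
      using i(1) by (simp add: f_def if_distrib if_distribR cong: if_cong)
    then show ?thesis using i by (metis eq_iff_diff_eq_0)
  qed
  moreover have "f q \<in> polyfun" for q unfolding f_def[abs_def] by (intro polyfun_intros)
  ultimately obtain v where v: "(\<Prod>q\<in>A. f q v) \<noteq> 0" using polyfun_prod_nonzero[OF assms(1), of f] by blast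
  have f: "f q v = v 0 * coords q 0 + v 1 * coords q 1 + v 2 * coords q 2 + v 3 * coords q 3 -
    (v 0 * coords p 0 + v 1 * coords p 1 + v 2 * coords p 2 + v 3 * coords p 3)" for q
    by (simp add: f_def numeral_eq_Suc algebra_simps)
  define e where "e = (v 0, v 1, v 2, v 3, v 0 * coords p 0 + v 1 * coords p 1 + v 2 * coords p 2 + v 3 * coords p 3)"
  have "q \<in> lin_set [e] \<longleftrightarrow> f q v = 0" for q by (simp add: lin_set_altdef e_def f)
  moreover have "f p v = 0" by (simp add: f_def)
  moreover have "f q v \<noteq> 0" if "q \<in> A" for q using v that assms(1) by auto
  ultimately show ?thesis using that by blast
qed

lemma lin_set_Cons: "lin_set (e # eqs) = lin_set [e] \<inter> lin_set eqs"
  by (auto simp: lin_set_def)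

text \<open>A hyperplane through \<open>p\<close> that misses a point of every component other than
  \<open>{p}\<close> lowers the dimension by one. This serves to show that degrees are
  positive.\<close>

lemma exists_finite_section:
  assumes "is_variety X" "\<not> has_chain X (Suc k)" "p \<in> X"
  shows "\<exists>eqs. length eqs = k \<and> p \<in> lin_set eqs \<and> finite (X \<inter> lin_set eqs)"
  using assms
proof (induction k arbitrary: X)
  case 0
  then show ?case using no_chain_1_finite by (intro exI[of _ "[]"]) (auto simp: lin_set_def)
next
  case (Suc k)
  note C = irreducible_components_finite_cover[OF Suc.prems(1)]
  define B where "B = {V \<in> irreducible_components X. V \<noteq> {p}}"
  have "\<exists>q. q \<in> V \<and> q \<noteq> p" if "V \<in> B" for V
  proof -
    have "V \<noteq> {}" "V \<noteq> {p}" using that irreducible_varietyD by (auto simp: B_def irreducible_components_def)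
    then show ?thesis by blast
  qed
  then obtain q where q: "\<And>V. V \<in> B \<Longrightarrow> q V \<in> V" "\<And>V. V \<in> B \<Longrightarrow> q V \<noteq> p" by metis
  have "finite (q ` B)" "p \<notin> q ` B" using C(1) q(2) by (auto simp: B_def)
  then obtain e where e: "p \<in> lin_set [e]" "\<And>V. V \<in> B \<Longrightarrow> q V \<notin> lin_set [e]"
    using exists_avoiding_hyperplane by (metis imageI)
  let ?Y = "X \<inter> lin_set [e]"
  have "is_variety ?Y" using Suc.prems(1) is_variety_lin_set by (intro is_variety_Int) auto
  moreover have "\<not> has_chain ?Y (Suc k)"
  proof
    assume "has_chain ?Y (Suc k)"
    then obtain U W where U: "irreducible_variety U" "U \<subseteq> ?Y" "irreducible_variety W" "W \<subset> U" "has_chain W k"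
      using has_chain_SucD by metis
    have "U \<subseteq> (\<Union>V\<in>irreducible_components X. V)" using U(2) C(2) by auto
    then obtain V where V: "V \<in> irreducible_components X" "U \<subseteq> V"
      using irreducible_variety_UN[OF U(1) C(1), of "\<lambda>V. V"]
      by (auto simp: irreducible_components_def irreducible_varietyD)
    \<comment> \<open>A component \<open>{p}\<close> cannot be avoided, but it leaves no room for
      the strict inclusion of \<open>W\<close> in \<open>U\<close>.\<close>
    have "V \<noteq> {p}" using U V(2) irreducible_varietyD(2)[OF U(3)] by auto
    then have "V \<in> B" using V by (auto simp: B_def)
    then have "U \<subset> V" using e(2) q(1) U(2) V(2) by blast
    moreover have "has_chain U (Suc k)" using has_chain_SucI U by blast
    moreover have "irreducible_variety V" "V \<subseteq> X" using V by (auto simp: irreducible_components_def)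
    ultimately show False using Suc.prems(2) has_chain_SucI has_chain_subset by blast
  qed
  ultimately obtain eqs where "length eqs = k" "p \<in> lin_set eqs" "finite (?Y \<inter> lin_set eqs)"
    using Suc.IH Suc.prems(3) e(1) by blast
  then show ?case
    using e(1) lin_set_Cons[of e eqs] by (intro exI[of _ "e # eqs"]) (auto simp: Int_assoc)
qed

text \<open>All pairs of linear equations are treated at once, with the coefficients as parameters.
  The uniform bound for one-variable fibres then bounds the number of values that a coordinate takes
  on a finite section.\<close>

lemma coordinate_sections_bounded:
  assumes V: "is_variety V" and i: "i < 4"
  shows "\<exists>N. \<forall>e1 e2. finite (V \<inter> lin_set [e1, e2]) \<longrightarrow> card ((\<lambda>p. coords p i) ` (V \<inter> lin_set [e1, e2])) \<le> N"
proof -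
  define l where "l k w = w k * w 0 + w (k + 1) * w 1 + w (k + 2) * w 2 + w (k + 3) * w 3 - w (k + 4)"
    for k and w :: "nat \<Rightarrow> complex"
  \<comment> \<open>Slots 4 to 8 and 9 to 13 carry the coefficients of the two equations and slot 14
    the value of coordinate \<open>i\<close>; once the point is eliminated, the latter becomes
    parameter 10.\<close>
  define S where "S = {w. l 4 w = 0} \<inter> {w. l 9 w = 0} \<inter> {w. w i - w 14 = 0}"
  have "S \<in> constructible" unfolding S_def l_def by (intro constructible_Int constructible_zero polyfun_intros)
  then have "{v. \<exists>p\<in>V. join p v \<in> S} \<in> constructible" using constructible_image V by blast
  from constructible_fibres_bounded[OF this, of 10] obtain N where N:
    "\<And>v. (finite {z. \<exists>p\<in>V. join p (v(10 := z)) \<in> S} \<and> card {z. \<exists>p\<in>V. join p (v(10 := z)) \<in> S} \<le> N) \<or>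
      finite {z. \<not> (\<exists>p\<in>V. join p (v(10 := z)) \<in> S)}" by auto
  show ?thesis
  proof (intro exI[of _ N] allI impI)
    fix e1 e2 :: "complex \<times> complex \<times> complex \<times> complex \<times> complex"
    assume fin: "finite (V \<inter> lin_set [e1, e2])"
    obtain a1 b1 c1 d1 f1 a2 b2 c2 d2 f2 where e: "e1 = (a1, b1, c1, d1, f1)" "e2 = (a2, b2, c2, d2, f2)"
      by (metis prod.collapse)
    \<comment> \<open>Entry 10 is replaced by \<open>z\<close> and \<open>S\<close> does not look at
      later ones, so the list may end here.\<close>
    define v where "v n = [a1, b1, c1, d1, f1, a2, b2, c2, d2, f2] ! n" for n :: nat
    have v: "v 0 = a1" "v (Suc 0) = b1" "v 2 = c1" "v 3 = d1" "v 4 = f1" "v 5 = a2" "v 6 = b2" "v 7 = c2" "v 8 = d2" "v 9 = f2"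
      by (simp_all add: v_def numeral_eq_Suc)
    have "join p (v(10 := z)) \<in> S \<longleftrightarrow> p \<in> lin_set [e1, e2] \<and> coords p i = z" for p z
      using i by (simp add: S_def l_def join_def v lin_set_altdef e)
    then have eq: "{z. \<exists>p\<in>V. join p (v(10 := z)) \<in> S} = (\<lambda>p. coords p i) ` (V \<inter> lin_set [e1, e2])" by auto
    then have "finite {z. \<exists>p\<in>V. join p (v(10 := z)) \<in> S}" using fin by simp
    moreover have "\<not> finite {z. \<not> (\<exists>p\<in>V. join p (v(10 := z)) \<in> S)}"
    proof
      assume "finite {z. \<not> (\<exists>p\<in>V. join p (v(10 := z)) \<in> S)}"
      then have "finite ({z. \<exists>p\<in>V. join p (v(10 := z)) \<in> S} \<union> {z. \<not> (\<exists>p\<in>V. join p (v(10 := z)) \<in> S)})"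
        using calculation by blast
      moreover have "{z. \<exists>p\<in>V. join p (v(10 := z)) \<in> S} \<union> {z. \<not> (\<exists>p\<in>V. join p (v(10 := z)) \<in> S)} = UNIV" by blast
      ultimately show False using infinite_UNIV_char_0[where 'a = complex] by metis
    qed
    ultimately show "card ((\<lambda>p. coords p i) ` (V \<inter> lin_set [e1, e2])) \<le> N" using N[of v] eq by auto
  qed
qed

text \<open>A finite section lies in the box of its coordinate values. The bound makes the set
  behind \<open>irr_degree\<close> bounded above, so that its supremum really dominates every
  section.\<close>

lemma sections_bounded:
  assumes V: "is_variety V"
  shows "\<exists>N. \<forall>eqs. length eqs \<le> 2 \<longrightarrow> finite (V \<inter> lin_set eqs) \<longrightarrow> card (V \<inter> lin_set eqs) \<le> N"
proof -
  obtain N where N: "\<And>i e1 e2. i < 4 \<Longrightarrow> finite (V \<inter> lin_set [e1, e2]) \<Longrightarrow>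
    card ((\<lambda>p. coords p i) ` (V \<inter> lin_set [e1, e2])) \<le> N i"
    using coordinate_sections_bounded[OF V] by metis
  have *: "card (V \<inter> lin_set [e1, e2]) \<le> (N 0 * N 1) * (N 2 * N 3)" if fin: "finite (V \<inter> lin_set [e1, e2])" for e1 e2
  proof -
    let ?A = "V \<inter> lin_set [e1, e2]"
    let ?C = "\<lambda>i. (\<lambda>p. coords p i) ` ?A"
    have "?A \<subseteq> (?C 0 \<times> ?C 1) \<times> (?C 2 \<times> ?C 3)"
      by (force simp: image_iff)
    then have "card ?A \<le> card ((?C 0 \<times> ?C 1) \<times> (?C 2 \<times> ?C 3))"
      using fin by (intro card_mono finite_cartesian_product finite_imageI) auto
    also have "\<dots> = (card (?C 0) * card (?C 1)) * (card (?C 2) * card (?C 3))"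
      by (simp only: card_cartesian_product)
    also have "\<dots> \<le> (N 0 * N 1) * (N 2 * N 3)" by (intro mult_le_mono N fin) auto
    finally show ?thesis .
  qed
  have "card (V \<inter> lin_set eqs) \<le> (N 0 * N 1) * (N 2 * N 3)"
    if "length eqs \<le> 2" "finite (V \<inter> lin_set eqs)" for eqs
  proof -
    \<comment> \<open>The equation \<open>0 = 0\<close> pads shorter lists to length two.\<close>
    define z where "z = (0 :: complex, 0 :: complex, 0 :: complex, 0 :: complex, 0 :: complex)"
    have "\<exists>e1 e2. lin_set eqs = lin_set [e1, e2]"
    proof -
      consider "eqs = []" | e where "eqs = [e]" | e1 e2 where "eqs = [e1, e2]"
      proof (cases eqs)
        case (Cons e r)
        then show thesis using that(2)[of e] that(3)[of e "hd r"] \<open>length eqs \<le> 2\<close> by (cases r) auto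
      qed
      then show ?thesis
      proof cases
        case 1 then show ?thesis by (intro exI[of _ z]) (auto simp: lin_set_altdef z_def)
      next
        case 2 then show ?thesis by (intro exI[of _ e] exI[of _ z]) (auto simp: lin_set_altdef z_def)
      next
        case 3 then show ?thesis by blast
      qed
    qed
    then show ?thesis using * that(2) by auto
  qed
  then show ?thesis by blast
qed

lemma section_le_irr_degree:
  assumes "is_variety V" "variety_dim V \<le> 2" "length eqs = variety_dim V" "finite (V \<inter> lin_set eqs)"
  shows "card (V \<inter> lin_set eqs) \<le> irr_degree V"
proof -
  let ?S = "{card (V \<inter> lin_set eqs) | eqs. length eqs = variety_dim V \<and> finite (V \<inter> lin_set eqs)}"
  obtain N where "\<And>eqs. length eqs \<le> 2 \<Longrightarrow> finite (V \<inter> lin_set eqs) \<Longrightarrow> card (V \<inter> lin_set eqs) \<le> N"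
    using sections_bounded[OF assms(1)] by blast
  then have "bdd_above ?S" using assms(2) by (intro bdd_aboveI[of _ N]) auto
  moreover have "card (V \<inter> lin_set eqs) \<in> ?S" using assms by blast
  ultimately show ?thesis unfolding irr_degree_def by (rule cSup_upper[rotated])
qed

text \<open>Some finite section passes through a given point. Hence the number of components of
  \<open>X\<close> cannot exceed its degree.\<close>

lemma irr_degree_pos:
  assumes "irreducible_variety V" "\<not> has_chain V (Suc (Suc (Suc 0)))"
  shows "irr_degree V \<ge> 1"
proof -
  have "\<exists>k\<le>2. has_chain V k \<and> \<not> has_chain V (Suc k)"
    using has_chain_0[OF assms(1)] assms(2)
    by (cases "has_chain V 1"; cases "has_chain V 2") (auto simp: numeral_eq_Suc)
  then obtain k where k: "k \<le> 2" "has_chain V k" "\<not> has_chain V (Suc k)" by blast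
  have dim: "variety_dim V = k" using variety_dim_eqI k by blast
  obtain p where p: "p \<in> V" using irreducible_varietyD assms by blast
  obtain eqs where eqs: "length eqs = k" "p \<in> lin_set eqs" "finite (V \<inter> lin_set eqs)"
    using exists_finite_section[OF irreducible_varietyD(1) k(3) p] assms by blast
  have "card (V \<inter> lin_set eqs) \<ge> 1" using p eqs by (simp add: Suc_le_eq card_gt_0_iff) blast
  then show ?thesis
    using section_le_irr_degree[OF irreducible_varietyD(1)[OF assms(1)]] dim k eqs by fastforce
qed

section \<open>Bivariate and trivariate evaluation\<close>

definition eval2 :: "complex poly poly \<Rightarrow> complex \<Rightarrow> complex \<Rightarrow> complex" where
  "eval2 T a b = poly (poly T [:a:]) b"

definition eval3 :: "complex poly poly poly \<Rightarrow> complex \<Rightarrow> complex \<Rightarrow> complex \<Rightarrow> complex" where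
  "eval3 F a b c = eval2 (poly F [:[:a:]:]) b c"

lemma eval2_simps [simp]:
  "eval2 0 a b = 0" "eval2 1 a b = 1" "eval2 (S + T) a b = eval2 S a b + eval2 T a b"
  "eval2 (S - T) a b = eval2 S a b - eval2 T a b" "eval2 (S * T) a b = eval2 S a b * eval2 T a b"
  "eval2 (pCons q T) a b = poly q b + a * eval2 T a b"
  by (auto simp: eval2_def)

lemma eval3_simps [simp]:
  "eval3 0 a b c = 0" "eval3 1 a b c = 1" "eval3 (S + T) a b c = eval3 S a b c + eval3 T a b c"
  "eval3 (S - T) a b c = eval3 S a b c - eval3 T a b c" "eval3 (S * T) a b c = eval3 S a b c * eval3 T a b c"
  "eval3 (pCons q T) a b c = eval2 q b c + a * eval3 T a b c"
  by (auto simp: eval3_def) (simp add: eval2_def)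

lemma eval3_prod: "eval3 (\<Prod>x\<in>A. f x) a b c = (\<Prod>x\<in>A. eval3 (f x) a b c)"
  by (induction A rule: infinite_finite_induct) auto

lemma eval2_map_poly: "eval2 T a b = poly (map_poly (\<lambda>q. poly q b) T) a"
  by (induction T) (auto simp: map_poly_pCons)

lemma eval3_map_poly: "eval3 F a b c = poly (map_poly (\<lambda>q. eval2 q b c) F) a"
  by (induction F) (auto simp: map_poly_pCons)

lemma eval2_polyfun': "(\<lambda>v. eval2 T (v i) (v j)) \<in> polyfun"
  unfolding eval2_def by (rule eval2_polyfun)

lemma eval2_nonzero:
  assumes "T \<noteq> 0"
  shows "\<exists>a b. eval2 T a b \<noteq> 0"
proof (rule ccontr)
  assume "\<not> ?thesis"
  then have "poly T [:a:] = 0" for a unfolding eval2_def using poly_all_0_iff_0 by blast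
  then have "range (\<lambda>a. [:a:]) \<subseteq> {x. poly T x = 0}" by auto
  then have "finite (range (\<lambda>a::complex. [:a:]))" using poly_roots_finite[OF assms] finite_subset by blast
  then have "finite (UNIV :: complex set)" by (rule finite_imageD) (auto intro: injI)
  then show False using infinite_UNIV_char_0 by blast
qed

lemma polyfun_eval2:
  assumes "f \<in> polyfun"
  shows "\<exists>T. \<forall>a b. f (w(i := a, j := b)) = eval2 T a b"
  using assms
proof (induction rule: polyfun.induct)
  case (polyfun_const c)
  show ?case by (intro exI[of _ "[:[:c:]:]"]) auto
next
  case (polyfun_var n)
  show ?case
    by (intro exI[of _ "if n = j then [:[:0, 1:]:] else if n = i then [:0, 1:] else [:[:w n:]:]"]) (auto simp: eval2_def)
next
  case (polyfun_add f g)
  then show ?case by (metis eval2_simps(3))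
next
  case (polyfun_mult f g)
  then show ?case by (metis eval2_simps(5))
qed

lemma polyfun_eval3:
  assumes "f \<in> polyfun"
  shows "\<exists>F. \<forall>a b c. f (w(i := a, j := b, k := c)) = eval3 F a b c"
  using assms
proof (induction rule: polyfun.induct)
  case (polyfun_const c)
  show ?case by (intro exI[of _ "[:[:[:c:]:]:]"]) auto
next
  case (polyfun_var n)
  show ?case
    by (intro exI[of _ "if n = k then [:[:[:0, 1:]:]:] else if n = j then [:[:0, 1:]:] else if n = i then [:0, 1:] else [:[:[:w n:]:]:]"])
      (auto simp: eval3_def eval2_def)
next
  case (polyfun_add f g)
  then show ?case by (metis eval3_simps(3))
next
  case (polyfun_mult f g)
  then show ?case by (metis eval3_simps(5))
qed

lemma polyfun_cofinite:
  assumes "f \<in> polyfun" "f u \<noteq> 0"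
  shows "finite {z. f (u(i := z)) = 0}"
proof -
  obtain n P where P: "\<And>v z. f (v(i := z)) = poly (P v) z"
    using polyfun_as_polyfam[OF assms(1), of i] by metis
  have "poly (P u) (u i) \<noteq> 0" using P[of u "u i"] assms by simp
  then have "P u \<noteq> 0" by auto
  then show ?thesis unfolding P by (rule poly_roots_finite)
qed

text \<open>This replaces an appeal to the dimension of a proper subvariety: a polynomial that vanishes on
  \<^term>\<open>W\<close> but not on \<^term>\<open>V\<close> is algebraic over the coordinate \<^term>\<open>i\<close>, and the constant term of its
  equation restricts that coordinate to finitely many values on \<^term>\<open>W\<close>.\<close>

lemma coord_constant_on_proper_subvariety:
  assumes V: "irreducible_variety V" and W: "irreducible_variety W" "W \<subset> V" and i: "i < 4"
    and E: "finite E" "\<And>a. a \<notin> E \<Longrightarrow> finite {p \<in> V. coords p i = a}"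
  shows "\<exists>a. \<forall>p\<in>W. coords p i = a"
proof -
  obtain F where F: "\<forall>p\<in>W. eval4 F p = 0" "\<exists>p\<in>V. eval4 F p \<noteq> 0"
    using irreducible_varietyD(1)[OF W(1)] W(2) unfolding is_variety_def zero_set_def by blast
  define f where "f v = eval4 F (of_coords v)" for v
  have f: "f \<in> polyfun" unfolding f_def[abs_def] by (rule eval4_polyfun)
  define S where "S = {v. \<exists>p\<in>V. join p v \<in> {w. w i - w 4 = 0} \<inter> {w. f w - w 5 = 0}}"
  have "S \<in> constructible" unfolding S_def
    by (intro constructible_image irreducible_varietyD[OF V] constructible_Int constructible_zero polyfun_intros f)
  have S: "S = {v. \<exists>p\<in>V. coords p i = v 0 \<and> f (coords p) = v 1}"
    using i by (auto simp: S_def join_def f_def of_coords_def)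
  obtain h where h: "h \<in> polyfun" "\<exists>v. h v \<noteq> 0" "{v. h v \<noteq> 0} \<subseteq> S \<or> S \<subseteq> {v. h v = 0}"
    using constructible_dense_or_thin[OF \<open>S \<in> constructible\<close>] by (elim bexE conjE) (rule that)
  then obtain u where u: "h u \<noteq> 0" by blast
  \<comment> \<open>Over \<open>a \<notin> E\<close> only finitely many points of \<open>V\<close>
    remain, hence finitely many values of \<open>f\<close>, whereas a dense image would contain all
    but finitely many for a generic \<open>a\<close>.\<close>
  have "\<not> {v. h v \<noteq> 0} \<subseteq> S"
  proof
    assume dense: "{v. h v \<noteq> 0} \<subseteq> S"
    have "finite (E \<union> {a. h (u(0 := a)) = 0})" by (intro finite_UnI E(1) polyfun_cofinite[OF h(1) u])
    then obtain a where a: "a \<notin> E" "h (u(0 := a)) \<noteq> 0"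
      using ex_new_if_finite[OF infinite_UNIV_char_0] by blast
    let ?B = "{b. h ((u(0 := a))(1 := b)) = 0}"
    have "finite ?B" using polyfun_cofinite[OF h(1) a(2)] .
    have "b \<in> (\<lambda>p. f (coords p)) ` {p \<in> V. coords p i = a}" if "b \<notin> ?B" for b
    proof -
      have "u(0 := a, 1 := b) \<in> S" using dense that by blast
      then show ?thesis unfolding S by auto
    qed
    then have "UNIV \<subseteq> ?B \<union> (\<lambda>p. f (coords p)) ` {p \<in> V. coords p i = a}" by blast
    then have "finite (UNIV :: complex set)"
      using \<open>finite ?B\<close> E(2)[OF a(1)] by (meson finite_UnI finite_imageI finite_subset)
    then show False using infinite_UNIV_char_0 by blast
  qed
  then have thin: "S \<subseteq> {v. h v = 0}" using h(3) by blast
  obtain T0 where T0: "\<And>a b. h (u(1 := b, 0 := a)) = eval2 T0 b a" using polyfun_eval2[OF h(1)] by metis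
  have vanish: "eval2 T0 (f (coords p)) (coords p i) = 0" if "p \<in> V" for p
  proof -
    have "u(1 := f (coords p), 0 := coords p i) \<in> S" using that by (auto simp: S)
    then show ?thesis using thin T0 by (metis (mono_tags, lifting) mem_Collect_eq subsetD)
  qed
  have "T0 \<noteq> 0" using T0[of "u 1" "u 0"] u by auto
  \<comment> \<open>Among the relations between \<open>f\<close> and coordinate \<open>i\<close>,
    with \<open>f\<close> as the outer variable, one of least degree in \<open>f\<close> has a
    nonzero constant term \<open>q\<close>: otherwise \<open>f\<close> could be cancelled, as
    \<open>V\<close> is irreducible and \<open>f\<close> does not vanish on it.\<close>
  then obtain T where T: "T \<noteq> 0" "\<forall>p\<in>V. eval2 T (f (coords p)) (coords p i) = 0"
    "\<And>T'. T' \<noteq> 0 \<Longrightarrow> \<forall>p\<in>V. eval2 T' (f (coords p)) (coords p i) = 0 \<Longrightarrow> degree T \<le> degree T'"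
    using ex_has_least_nat[of "\<lambda>T. T \<noteq> 0 \<and> (\<forall>p\<in>V. eval2 T (f (coords p)) (coords p i) = 0)" T0 degree] vanish
    by blast
  obtain q T' where q: "T = pCons q T'" by (cases T)
  have "q \<noteq> 0"
  proof
    assume "q = 0"
    then have "\<And>p. p \<in> V \<Longrightarrow> f (coords p) * eval2 T' (f (coords p)) (coords p i) = 0" using T(2) q by simp
    moreover have "(\<lambda>v. if n = 0 then f v else v i) \<in> polyfun" for n :: nat
      using f by (cases "n = 0") (auto intro: polyfun_var)
    then have "(\<lambda>v. eval2 T' (f v) (v i)) \<in> polyfun"
      using polyfun_subst[OF eval2_polyfun'[of T' 0 1], of "\<lambda>v n. if n = 0 then f v else v i"] by simp
    ultimately have "(\<forall>p\<in>V. f (coords p) = 0) \<or> (\<forall>p\<in>V. eval2 T' (f (coords p)) (coords p i) = 0)"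
      using irreducible_variety_polyfun_mult[OF V f, of "\<lambda>v. eval2 T' (f v) (v i)"] by blast
    then have "\<forall>p\<in>V. eval2 T' (f (coords p)) (coords p i) = 0" using F(2) by (auto simp: f_def)
    moreover have "T' \<noteq> 0" using T(1) q \<open>q = 0\<close> by auto
    ultimately show False using T(3)[of T'] q by auto
  qed
  have "coords p i \<in> {a. poly q a = 0}" if "p \<in> W" for p
  proof -
    have "p \<in> V" "f (coords p) = 0" using that F(1) W(2) by (auto simp: f_def)
    then show ?thesis using T(2) q by fastforce
  qed
  then have "W \<subseteq> (\<Union>a\<in>{a. poly q a = 0}. {p. coords p i = a})" by auto
  then obtain a where "W \<subseteq> {p. coords p i = a}"
    using irreducible_variety_UN[OF W(1) poly_roots_finite[OF \<open>q \<noteq> 0\<close>], of "\<lambda>a. {p. coords p i = a}"] is_variety_coord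
    by blast
  then show ?thesis by blast
qed

section \<open>Resultants and common zeros\<close>

lemma exists_prime_elem_in_prime_ideal:
  fixes F :: "'a :: {factorial_semiring}"
  assumes "F \<noteq> 0" "P F" "\<And>u. is_unit u \<Longrightarrow> \<not> P u" "\<And>A B. P (A * B) \<Longrightarrow> P A \<or> P B"
  shows "\<exists>W. prime_elem W \<and> P W"
proof -
  obtain A where A: "\<And>x. x \<in># A \<Longrightarrow> prime_elem x" "normalize (prod_mset A) = normalize F"
    using prime_factorization_exists[OF assms(1)] by blast
  then obtain u where u: "is_unit u" "F = u * prod_mset A"
    by (metis associatedE1)
  have "P (prod_mset A)" using assms(2-4) u by metis
  then show ?thesis using A(1)
  proof (induction A)
    case empty
    then show ?case using assms(3)[of 1] by simp
  next
    case (add x A)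
    then show ?case using assms(4)[of x "prod_mset A"] by auto
  qed
qed

text \<open>The leading coefficients take care of degenerate specialisations: if both degrees
  survive, the resultant commutes with the homomorphism, and otherwise one of the extra factors is
  sent to zero.\<close>

definition elim_resultant :: "'a::comm_ring_1 poly \<Rightarrow> 'a poly \<Rightarrow> 'a" where
  "elim_resultant p q = lead_coeff p * lead_coeff q * resultant p q"

lemma elim_resultant_nonzero:
  fixes p q :: "'a :: {factorial_ring_gcd, semiring_gcd_mult_normalize} poly"
  assumes "p \<noteq> 0" "q \<noteq> 0" "coprime p q"
  shows "elim_resultant p q \<noteq> 0"
proof -
  have "resultant p q \<noteq> 0" using assms(3) by (simp add: resultant_0_gcd)
  then show ?thesis using assms by (simp add: elim_resultant_def)
qed

lemma elim_resultant_common_root: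
  fixes p q :: "'a :: {factorial_ring_gcd, semiring_gcd_mult_normalize} poly" and h :: "'a \<Rightarrow> complex"
  assumes "comm_ring_hom h" "poly (map_poly h p) z = 0" "poly (map_poly h q) z = 0"
  shows "h (elim_resultant p q) = 0"
proof -
  interpret comm_ring_hom h by fact
  show ?thesis
  proof (cases "h (lead_coeff p) = 0 \<or> h (lead_coeff q) = 0")
    case True
    then show ?thesis by (auto simp: elim_resultant_def hom_mult)
  next
    case False
    then have deg: "degree (map_poly h p) = degree p" "degree (map_poly h q) = degree q"
      by (auto intro!: degree_map_poly)
    have "map_poly h p \<noteq> 0" using False by (metis coeff_map_poly coeff_0 hom_zero)
    then have g: "gcd (map_poly h p) (map_poly h q) \<noteq> 0" by simp
    have "[:-z, 1:] dvd gcd (map_poly h p) (map_poly h q)"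
      using assms(2,3) by (simp add: poly_eq_0_iff_dvd)
    then have "degree (gcd (map_poly h p) (map_poly h q)) \<noteq> 0"
      using dvd_imp_degree_le[OF _ g] by fastforce
    then have "resultant (map_poly h p) (map_poly h q) = 0" by (simp add: resultant_0_gcd)
    then show ?thesis using resultant_map_poly[OF deg] by (simp add: elim_resultant_def hom_mult)
  qed
qed

lemma comm_ring_hom_eval1: "comm_ring_hom (\<lambda>q::complex poly. poly q b)"
  by unfold_locales auto

lemma comm_ring_hom_eval2: "comm_ring_hom (\<lambda>q. eval2 q b c)"
  by unfold_locales auto

lemma eliminate3:
  assumes "prime_elem F" "\<not> F dvd G"
  obtains r where "r \<noteq> 0" "\<And>a b c. eval3 F a b c = 0 \<Longrightarrow> eval3 G a b c = 0 \<Longrightarrow> eval2 r b c = 0"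
proof
  have "F \<noteq> 0" "G \<noteq> 0" using assms by auto
  then show "elim_resultant F G \<noteq> 0"
    using assms by (intro elim_resultant_nonzero prime_elem_imp_coprime)
  show "eval2 (elim_resultant F G) b c = 0" if "eval3 F a b c = 0" "eval3 G a b c = 0" for a b c
    using elim_resultant_common_root[OF comm_ring_hom_eval2] that unfolding eval3_map_poly by blast
qed

text \<open>The Sylvester matrix has size at most \<open>2 * e\<close> and entries of degree at most
  \<open>e\<close>; the two leading coefficients contribute the summand
  \<open>2 * e\<close>.\<close>

lemma degree_elim_resultant:
  fixes A B :: "complex poly poly"
  assumes "degree A \<le> e" "degree B \<le> e" "\<And>i. degree (coeff A i) \<le> e" "\<And>i. degree (coeff B i) \<le> e"
  shows "degree (elim_resultant A B) \<le> 2 * e + 2 * e * e"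
proof -
  define M where "M = sylvester_mat A B"
  define n where "n = degree A + degree B"
  have dim: "M \<in> carrier_mat n n" unfolding M_def n_def by (rule sylvester_carrier_mat)
  have entry: "degree (M $$ (i, j)) \<le> e" if "i < n" "j < n" for i j
    using that assms(3,4) unfolding M_def n_def by (subst sylvester_index_mat) auto
  have "degree (resultant A B) \<le> n * e"
    unfolding resultant_def M_def[symmetric] det_def'[OF dim]
  proof (rule degree_sum_le)
    fix \<pi> assume \<pi>: "\<pi> \<in> {\<pi>. \<pi> permutes {0..<n}}"
    have "degree (\<Prod>i = 0..<n. M $$ (i, \<pi> i)) \<le> (\<Sum>i = 0..<n. degree (M $$ (i, \<pi> i)))"
      using degree_prod_sum_le[of "{0..<n}" "\<lambda>i. M $$ (i, \<pi> i)"] by (simp add: o_def)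
    also have "\<dots> \<le> (\<Sum>i = 0..<n. e)"
      using \<pi> permutes_in_image[of \<pi> "{0..<n}"] by (intro sum_mono entry) auto
    finally have "degree (\<Prod>i = 0..<n. M $$ (i, \<pi> i)) \<le> n * e" by simp
    moreover have "degree (signof \<pi> * (\<Prod>i = 0..<n. M $$ (i, \<pi> i))) \<le> degree (\<Prod>i = 0..<n. M $$ (i, \<pi> i))"
      by (auto simp: sign_def)
    ultimately show "degree (signof \<pi> * (\<Prod>i = 0..<n. M $$ (i, \<pi> i))) \<le> n * e" by linarith
  qed (simp add: finite_permutations)
  moreover have "n * e \<le> 2 * e * e" using assms(1,2) by (simp add: n_def)
  ultimately have "degree (resultant A B) \<le> 2 * e * e" by linarith
  moreover have "degree (elim_resultant A B) \<le> degree (lead_coeff A) + degree (lead_coeff B) + degree (resultant A B)"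
    unfolding elim_resultant_def by (meson add_le_mono1 degree_mult_le order_trans)
  ultimately show ?thesis using assms(3)[of "degree A"] assms(4)[of "degree B"] by linarith
qed

text \<open>The second coordinate of a common zero is one of at most
  \<open>2 * e + 2 * e * e\<close> roots of the resultant, and each has at most \<open>e\<close>
  common zeros over it. For the second count one of \<open>A\<close>, \<open>B\<close> must not
  vanish identically there, which coprimality guarantees.\<close>

lemma coprime_common_zeros:
  fixes A B :: "complex poly poly"
  assumes "degree A \<le> e" "degree B \<le> e" "\<And>i. degree (coeff A i) \<le> e" "\<And>i. degree (coeff B i) \<le> e"
    and nz: "A \<noteq> 0" "B \<noteq> 0" and cop: "coprime A B"
  shows "finite {(a, b). eval2 A a b = 0 \<and> eval2 B a b = 0}"
    "card {(a, b). eval2 A a b = 0 \<and> eval2 B a b = 0} \<le> (2 * e + 2 * e * e) * e"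
proof -
  let ?r = "elim_resultant A B"
  let ?R = "{b. poly ?r b = 0}"
  have r: "?r \<noteq> 0" using elim_resultant_nonzero nz cop by blast
  have R: "finite ?R" "card ?R \<le> 2 * e + 2 * e * e"
    using poly_roots_finite[OF r] card_poly_roots_bound[OF r] degree_elim_resultant[OF assms(1-4)] by auto
  have fibre: "finite {a. eval2 A a b = 0 \<and> eval2 B a b = 0} \<and> card {a. eval2 A a b = 0 \<and> eval2 B a b = 0} \<le> e" for b
  proof -
    let ?h = "map_poly (\<lambda>q. poly q b)"
    have *: "finite {a. poly (?h C) a = 0 \<and> poly (?h D) a = 0} \<and> card {a. poly (?h C) a = 0 \<and> poly (?h D) a = 0} \<le> e"
      if "?h C \<noteq> 0" "degree C \<le> e" for C D
    proof -
      have "finite {a. poly (?h C) a = 0}" "card {a. poly (?h C) a = 0} \<le> e"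
        using poly_roots_finite[OF that(1)] card_poly_roots_bound[OF that(1)] degree_map_poly_le[of "\<lambda>q. poly q b" C] that(2) by auto
      moreover have "{a. poly (?h C) a = 0 \<and> poly (?h D) a = 0} \<subseteq> {a. poly (?h C) a = 0}" by auto
      ultimately show ?thesis by (meson card_mono finite_subset order_trans)
    qed
    have "?h A \<noteq> 0 \<or> ?h B \<noteq> 0"
    proof (rule ccontr)
      have "[:[:-b, 1:]:] dvd C" if "?h C = 0" for C
      proof -
        have "poly (coeff C i) b = 0" for i using that by (metis coeff_map_poly coeff_0 poly_0)
        then show ?thesis by (simp add: const_poly_dvd_iff poly_eq_0_iff_dvd)
      qed
      moreover assume "\<not> ?thesis"
      ultimately have "is_unit [:[:-b, 1:]:]" using cop coprime_common_divisor by blast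
      then have "is_unit [:-b, 1:]" by (simp add: is_unit_const_poly_iff)
      then show False by (simp add: is_unit_poly_iff)
    qed
    then show ?thesis unfolding eval2_map_poly using *[of A B] *[of B A] assms(1,2) by (auto simp: conj_commute)
  qed
  let ?Z = "{(a, b). eval2 A a b = 0 \<and> eval2 B a b = 0}"
  let ?S = "Sigma ?R (\<lambda>b. {a. eval2 A a b = 0 \<and> eval2 B a b = 0})"
  have "b \<in> ?R" if "eval2 A a b = 0" "eval2 B a b = 0" for a b
    using elim_resultant_common_root[OF comm_ring_hom_eval1] that unfolding eval2_map_poly by blast
  then have sub: "?Z \<subseteq> prod.swap ` ?S" by (force simp: image_iff)
  have S: "finite ?S" using R(1) fibre by (intro finite_SigmaI) auto
  have "card ?S \<le> card ?R * e"
    using card_SigmaI[OF R(1), of "\<lambda>b. {a. eval2 A a b = 0 \<and> eval2 B a b = 0}"] fibre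
      sum_bounded_above[of ?R "\<lambda>b. card {a. eval2 A a b = 0 \<and> eval2 B a b = 0}" e] by auto
  also have "\<dots> \<le> (2 * e + 2 * e * e) * e" using R(2) by (rule mult_le_mono1)
  finally have "card ?S \<le> (2 * e + 2 * e * e) * e" .
  moreover have "card ?Z \<le> card (prod.swap ` ?S)" using sub S by (intro card_mono) auto
  moreover have "card (prod.swap ` ?S) \<le> card ?S" using S by (rule card_image_le)
  ultimately show "card ?Z \<le> (2 * e + 2 * e * e) * e" by linarith
  show "finite ?Z" using sub S finite_subset by blast
qed

lemma prime_elem_common_zeros_finite:
  fixes A B :: "complex poly poly"
  assumes "prime_elem A" "\<not> A dvd B"
  shows "finite {(a, b). eval2 A a b = 0 \<and> eval2 B a b = 0}"
proof -
  define D where "D C = Max (insert (degree C) ((\<lambda>i. degree (coeff C i)) ` {..degree C}))" for C :: "complex poly poly"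
  have D: "degree C \<le> D C" "degree (coeff C i) \<le> D C" for C i
  proof -
    show "degree C \<le> D C" by (simp add: D_def)
    show "degree (coeff C i) \<le> D C"
    proof (cases "i \<le> degree C")
      case True
      then show ?thesis unfolding D_def by (intro Max_ge) auto
    qed (simp add: coeff_eq_0)
  qed
  have "A \<noteq> 0" "B \<noteq> 0" using assms by auto
  then show ?thesis
    using coprime_common_zeros(1)[of A "max (D A) (D B)" B] D assms prime_elem_imp_coprime
    by (meson max.cobounded1 max.cobounded2 order_trans)
qed

text \<open>Modulo the prime \<open>q\<close> this is the finiteness of the roots of a nonzero
  polynomial over a domain; dividing off one root at a time avoids the quotient ring.\<close>

lemma prime_dvd_infinitely_many_values:
  fixes F :: "complex poly poly poly"
  assumes "prime_elem q" "infinite {s. q dvd poly F [:[:s:]:]}"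
  shows "[:q:] dvd F"
  using assms(2)
proof (induction "degree F" arbitrary: F)
  case 0
  then obtain f where "F = [:f:]" by (metis degree_eq_zeroE)
  moreover obtain s where "q dvd poly F [:[:s:]:]" using infinite_imp_nonempty[OF 0(2)] by auto
  ultimately show ?case by simp
next
  case (Suc n)
  obtain s0 where s0: "q dvd poly F [:[:s0:]:]" using infinite_imp_nonempty[OF Suc(3)] by auto
  let ?c = "[:[:s0:]:]"
  let ?G = "synthetic_div F ?c"
  have F: "F = [:-?c, 1:] * ?G + [:poly F ?c:]" by (rule synthetic_div_correct'[symmetric])
  have "q dvd poly ?G [:[:s:]:]" if s: "q dvd poly F [:[:s:]:]" "s \<noteq> s0" for s
  proof -
    have "poly F [:[:s:]:] = [:[:s - s0:]:] * poly ?G [:[:s:]:] + poly F ?c"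
      by (subst F) (simp flip: smult_add_left)
    then have "q dvd [:[:s - s0:]:] * poly ?G [:[:s:]:]"
      using s(1) s0 by (metis dvd_add_left_iff)
    moreover have "\<not> q dvd [:[:s - s0:]:]"
    proof
      assume "q dvd [:[:s - s0:]:]"
      moreover have "is_unit [:[:s - s0:]:]" using s(2) by (simp add: is_unit_const_poly_iff)
      ultimately show False using assms(1) by (metis dvd_unit_imp_unit not_prime_elem_one prime_elem_not_unit)
    qed
    ultimately show ?thesis using assms(1) prime_elem_dvd_mult_iff by blast
  qed
  then have "{s. q dvd poly F [:[:s:]:]} \<subseteq> insert s0 {s. q dvd poly ?G [:[:s:]:]}" by blast
  then have "infinite {s. q dvd poly ?G [:[:s:]:]}"
    using Suc.prems by (meson finite_insert finite_subset)
  moreover have "n = degree ?G" using Suc.hyps(2) by (simp add: degree_synthetic_div)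
  ultimately have "[:q:] dvd ?G" by (intro Suc.hyps(1))
  moreover have "[:q:] dvd [:poly F ?c:]" using s0 by simp
  ultimately show ?case by (subst F) (intro dvd_add dvd_mult)
qed

text \<open>The points in question are common zeros of all coefficients of \<open>F\<close>. Two
  polynomials suffice to catch them: the leading coefficient and the specialisation of
  \<open>F\<close> at a generic constant \<open>s\<close>. They are coprime, since a prime dividing
  infinitely many specialisations would divide \<open>F\<close>. Both inherit the bound
  \<open>e\<close>, so the count is independent of the degree of \<open>F\<close> in its outer
  variable.\<close>

lemma prime_elem_vertical_lines:
  fixes F :: "complex poly poly poly"
  assumes F: "prime_elem F" "degree F > 0"
    and deg: "\<And>k. degree (coeff F k) \<le> e" "\<And>k j. degree (coeff (coeff F k) j) \<le> e"
  shows "finite {(b, c). \<forall>a. eval3 F a b c = 0}"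
    "card {(b, c). \<forall>a. eval3 F a b c = 0} \<le> (2 * e + 2 * e * e) * e"
proof -
  let ?A = "lead_coeff F"
  have "F \<noteq> 0" using F by auto
  then have A: "?A \<noteq> 0" by simp
  have fin: "finite {s. q dvd poly F [:[:s:]:]}" if q: "prime_elem q" for q
  proof (rule ccontr)
    assume "infinite {s. q dvd poly F [:[:s:]:]}"
    then have "[:q:] dvd F" using prime_dvd_infinitely_many_values[OF q] by blast
    then obtain X where X: "F = [:q:] * X" ..
    have "is_unit [:q:] \<or> is_unit X"
      using F(1) X by (metis irreducible_def prime_elem_imp_irreducible)
    moreover have "\<not> is_unit [:q:]" using q by (simp add: is_unit_const_poly_iff)
    moreover have "\<not> is_unit X"
    proof
      assume "is_unit X"
      then have "degree X = 0" by (auto simp: is_unit_poly_iff)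
      then show False using F(2) X degree_mult_le[of "[:q:]" X] by simp
    qed
    ultimately show False by blast
  qed
  have "finite {s. poly F [:[:s:]:] = 0}"
  proof -
    have "finite {x. poly F x = 0}" using poly_roots_finite[OF \<open>F \<noteq> 0\<close>] .
    then have "finite ((\<lambda>s. [:[:s:]:]) -` {x. poly F x = 0})" by (intro finite_vimageI injI) auto
    then show ?thesis by (simp add: vimage_def)
  qed
  then have "finite ({s. poly F [:[:s:]:] = 0} \<union> (\<Union>q\<in>prime_factors ?A. {s. q dvd poly F [:[:s:]:]}))"
    using fin by (intro finite_UnI finite_UN_I) (auto dest: in_prime_factors_imp_prime)
  then obtain s where "s \<notin> {s. poly F [:[:s:]:] = 0} \<union> (\<Union>q\<in>prime_factors ?A. {s. q dvd poly F [:[:s:]:]})"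
    using ex_new_if_finite[OF infinite_UNIV_char_0[where 'a = complex]] by blast
  then have s: "poly F [:[:s:]:] \<noteq> 0" "\<And>q. q \<in> prime_factors ?A \<Longrightarrow> \<not> q dvd poly F [:[:s:]:]" by auto
  let ?B = "poly F [:[:s:]:]"
  have "coprime ?A ?B"
  proof (rule ccontr)
    assume "\<not> coprime ?A ?B"
    then have "\<not> is_unit (gcd ?A ?B)" by (simp add: coprime_iff_gcd_eq_1)
    moreover have "gcd ?A ?B \<noteq> 0" using A by simp
    ultimately obtain q where "prime q" "q dvd gcd ?A ?B" using prime_divisor_exists by blast
    then have "q \<in> prime_factors ?A" "q dvd ?B" using A by (auto simp: in_prime_factors_iff)
    then show False using s(2) by blast
  qed
  have B: "?B = (\<Sum>k\<le>degree F. smult [:s^k:] (coeff F k))"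
  proof -
    have "[:[:s:]:] ^ k = [:[:s ^ k:]:]" for k by (induction k) (simp_all add: mult.commute flip: one_pCons)
    then show ?thesis unfolding poly_altdef by (auto intro!: sum.cong)
  qed
  have "degree ?B \<le> e" unfolding B
    using deg(1) by (intro degree_sum_le) (auto intro: order_trans[OF degree_smult_le])
  moreover have "degree (coeff ?B i) \<le> e" for i unfolding B coeff_sum
    using deg(2) by (intro degree_sum_le) (auto intro: order_trans[OF degree_smult_le])
  ultimately have Z: "finite {(a, b). eval2 ?A a b = 0 \<and> eval2 ?B a b = 0}"
    "card {(a, b). eval2 ?A a b = 0 \<and> eval2 ?B a b = 0} \<le> (2 * e + 2 * e * e) * e"
    using coprime_common_zeros[of ?A e ?B] deg A s(1) \<open>coprime ?A ?B\<close> by blast+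
  have "eval2 ?A b c = 0 \<and> eval2 ?B b c = 0" if "\<forall>a. eval3 F a b c = 0" for b c
  proof
    have "map_poly (\<lambda>q. eval2 q b c) F = 0" using that by (simp add: eval3_map_poly poly_all_0_iff_0)
    then show "eval2 ?A b c = 0" by (metis coeff_0 coeff_map_poly eval2_simps(1))
    show "eval2 ?B b c = 0" using that by (simp add: eval3_def)
  qed
  then have sub: "{(b, c). \<forall>a. eval3 F a b c = 0} \<subseteq> {(a, b). eval2 ?A a b = 0 \<and> eval2 ?B a b = 0}" by auto
  show "finite {(b, c). \<forall>a. eval3 F a b c = 0}" using sub Z(1) finite_subset by blast
  show "card {(b, c). \<forall>a. eval3 F a b c = 0} \<le> (2 * e + 2 * e * e) * e"
    using card_mono[OF Z(1) sub] Z(2) by linarith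
qed

section \<open>Exchanging variables\<close>

definition swap2 :: "'a::comm_ring_1 poly poly \<Rightarrow> 'a poly poly" where
  "swap2 p = (\<Sum>i\<le>degree p. map_poly (\<lambda>c. monom c i) (coeff p i))"

lemma coeff_swap2 [simp]: "coeff (coeff (swap2 p) j) i = coeff (coeff p i) j"
proof -
  have "coeff (coeff (swap2 p) j) i = (\<Sum>k\<le>degree p. if k = i then coeff (coeff p k) j else 0)"
    unfolding swap2_def coeff_sum by (intro sum.cong) (auto simp: coeff_map_poly)
  then show ?thesis by (auto simp: coeff_eq_0 not_le)
qed

lemma poly_poly_eqI: "(\<And>i j. coeff (coeff p i) j = coeff (coeff q i) j) \<Longrightarrow> p = q"
  by (intro poly_eqI)

lemma swap2_swap2 [simp]: "swap2 (swap2 p) = p"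
  by (rule poly_poly_eqI) simp

lemma swap2_mult: "swap2 (p * q) = swap2 p * swap2 q"
proof (rule poly_poly_eqI)
  fix i j
  show "coeff (coeff (swap2 (p * q)) i) j = coeff (coeff (swap2 p * swap2 q) i) j"
    unfolding coeff_swap2 coeff_mult coeff_sum by (rule sum.swap)
qed

lemma comm_ring_hom_swap2: "comm_ring_hom swap2"
proof unfold_locales
  show "swap2 1 = 1" by (rule poly_poly_eqI) (simp add: coeff_1 one_poly_eq_simps coeff_pCons split: nat.split)
qed (auto intro!: poly_poly_eqI simp: swap2_mult)

lemma swap2_pCons: "swap2 (pCons a p) = map_poly (\<lambda>c. [:c:]) a + smult [:0, 1:] (swap2 p)"
  by (rule poly_poly_eqI) (simp add: coeff_map_poly coeff_pCons split: nat.split)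

lemma poly_swap2: "poly (poly (swap2 p) [:a:]) b = poly (poly p [:b:]) a"
proof (induction p)
  case 0
  show ?case by (simp add: swap2_def)
next
  case (pCons q p)
  have "poly (map_poly (\<lambda>c. [:c:]) q) [:a:] = [:poly q a:]"
    by (induction q) (auto simp: map_poly_pCons)
  then show ?case using pCons.IH by (simp add: swap2_pCons algebra_simps)
qed

text \<open>Swapping turns degrees of coefficients into an outer degree, so bounds on the outer
  degree of rearranged polynomials control the degrees in the inner variables.\<close>

lemma degree_coeff_swap2: "degree (coeff p i) \<le> degree (swap2 p)"
proof (rule degree_le, intro allI impI)
  fix j assume "degree (swap2 p) < j"
  then have "coeff (coeff (swap2 p) j) i = 0" by (simp add: coeff_eq_0)
  then show "coeff (coeff p i) j = 0" by simp
qed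

text \<open>Multiplicative involutions preserve divisibility, hence primality; so a prime relation
  stays prime when its variables are reordered.\<close>

lemma prime_elem_involution:
  fixes \<phi> :: "'a::factorial_ring_gcd \<Rightarrow> 'a"
  assumes hom: "\<And>a b. \<phi> (a * b) = \<phi> a * \<phi> b" "\<phi> 0 = 0" "\<phi> 1 = 1" and inv: "\<And>a. \<phi> (\<phi> a) = a"
    and p: "prime_elem p"
  shows "prime_elem (\<phi> p)" "\<phi> p dvd \<phi> q \<longleftrightarrow> p dvd q"
proof -
  have *: "\<phi> a dvd \<phi> b" if "a dvd b" for a b using that hom(1) by (metis dvd_def)
  have **: "\<phi> a dvd b \<longleftrightarrow> a dvd \<phi> b" for a b using *[of a "\<phi> b"] *[of "\<phi> a" b] inv by metis
  show "prime_elem (\<phi> p)"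
  proof (rule prime_elemI)
    show "\<phi> p \<noteq> 0" using p hom(2) inv by (metis prime_elem_not_zeroI)
    show "\<not> is_unit (\<phi> p)" unfolding ** using p hom(3) by auto
    show "\<phi> p dvd a \<or> \<phi> p dvd b" if "\<phi> p dvd a * b" for a b
      using that p unfolding ** hom(1) by (simp add: prime_elem_dvd_mult_iff)
  qed
  show "\<phi> p dvd \<phi> q \<longleftrightarrow> p dvd q" unfolding ** inv ..
qed

definition swap_outer :: "complex poly poly poly \<Rightarrow> complex poly poly poly" where
  "swap_outer = swap2"

definition swap_inner :: "complex poly poly poly \<Rightarrow> complex poly poly poly" where
  "swap_inner = map_poly swap2"

lemma eval3_swap_outer [simp]: "eval3 (swap_outer F) b a c = eval3 F a b c"
  by (simp add: eval3_def eval2_def swap_outer_def poly_swap2)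

lemma eval3_swap_inner [simp]: "eval3 (swap_inner F) a c b = eval3 F a b c"
proof -
  interpret comm_ring_hom "swap2 :: complex poly poly \<Rightarrow> _" by (rule comm_ring_hom_swap2)
  have "eval2 (swap2 q) c b = eval2 q b c" for q by (simp add: eval2_def poly_swap2)
  then show ?thesis
    by (simp add: eval3_map_poly swap_inner_def map_poly_map_poly o_def)
qed

lemma prime_elem_swap_outer:
  assumes "prime_elem F"
  shows "prime_elem (swap_outer F)" "swap_outer F dvd swap_outer G \<longleftrightarrow> F dvd G"
proof -
  interpret comm_ring_hom "swap2 :: complex poly poly poly \<Rightarrow> _" by (rule comm_ring_hom_swap2)
  show "prime_elem (swap_outer F)" "swap_outer F dvd swap_outer G \<longleftrightarrow> F dvd G"
    unfolding swap_outer_def using prime_elem_involution(1)[of swap2 F] prime_elem_involution(2)[of swap2 F G] assms by (auto simp: hom_mult)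
qed

lemma swap_inner_swap_inner [simp]: "swap_inner (swap_inner F) = F"
proof -
  interpret comm_ring_hom "swap2 :: complex poly poly \<Rightarrow> _" by (rule comm_ring_hom_swap2)
  show ?thesis by (simp add: swap_inner_def map_poly_map_poly o_def)
qed

lemma swap_outer_swap_outer [simp]: "swap_outer (swap_outer F) = F"
  by (simp add: swap_outer_def)

lemma prime_elem_swap_inner:
  assumes "prime_elem F"
  shows "prime_elem (swap_inner F)" "swap_inner F dvd swap_inner G \<longleftrightarrow> F dvd G"
proof -
  interpret comm_ring_hom "swap2 :: complex poly poly \<Rightarrow> _" by (rule comm_ring_hom_swap2)
  interpret mp: map_poly_comm_ring_hom "swap2 :: complex poly poly \<Rightarrow> _" ..
  have "swap_inner (a * b) = swap_inner a * swap_inner b" "swap_inner 0 = 0" "swap_inner 1 = 1" for a b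
    by (simp_all add: swap_inner_def mp.hom_mult)
  then show "prime_elem (swap_inner F)" "swap_inner F dvd swap_inner G \<longleftrightarrow> F dvd G"
    using prime_elem_involution(1)[of swap_inner F] prime_elem_involution(2)[of swap_inner F G] assms by auto
qed

section \<open>Relations between three coordinates\<close>

lemma prime_elem_dvd_prod:
  assumes "finite A" "prime_elem p" "p dvd (\<Prod>a\<in>A. f a)"
  shows "\<exists>a\<in>A. p dvd f a"
  using assms(1,3)
proof (induction A rule: finite_induct)
  case empty
  then show ?case using assms(2) prime_elem_not_unit by auto
next
  case (insert a A)
  then show ?case using assms(2) by (auto simp: prime_elem_dvd_mult_iff)
qed

lemma card_simple_roots:
  fixes p :: "complex poly"
  assumes "p \<noteq> 0" "\<And>z. poly p z = 0 \<Longrightarrow> poly (pderiv p) z \<noteq> 0"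
  shows "card {z. poly p z = 0} = degree p"
proof -
  have "rsquarefree p" using assms(2) by (auto simp: rsquarefree_roots)
  then have "p = smult (lead_coeff p) (\<Prod>z | poly p z = 0. [:-z, 1:])"
    using complex_poly_decompose_rsquarefree by metis
  then have "degree p = degree (\<Prod>z | poly p z = 0. [:-z, 1:])"
    using assms(1) by (metis degree_smult_eq leading_coeff_0_iff)
  also have "\<dots> = card {z. poly p z = 0}"
    by (subst degree_prod_eq_sum_degree) auto
  finally show ?thesis ..
qed

lemma pderiv_map_poly:
  assumes "comm_ring_hom h"
  shows "pderiv (map_poly h p) = map_poly h (pderiv p)"
proof -
  interpret comm_ring_hom h by fact
  have "h (of_nat n) = of_nat n" for n by (induction n) (auto simp: hom_add)
  then show ?thesis
    by (intro poly_eqI) (simp add: coeff_pderiv hom_mult hom_add)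
qed

text \<open>The ideal of the projection of \<open>V\<close> to three coordinates. The outermost
  variable \<open>k\<close> is the unknown over the plane of \<open>i\<close> and \<open>j\<close>,
  so the order of the indices decides which degree is the outer one.\<close>

definition relations :: "pt4 set \<Rightarrow> nat \<Rightarrow> nat \<Rightarrow> nat \<Rightarrow> complex poly poly poly set" where
  "relations V k i j = {F. \<forall>p\<in>V. eval3 F (coords p k) (coords p i) (coords p j) = 0}"

lemma eval3_polyfun': "(\<lambda>v. eval3 F (v i) (v j) (v k)) \<in> polyfun"
  unfolding eval3_def eval2_def by (rule eval3_polyfun)

lemma relations_mult:
  assumes "irreducible_variety V" "F * G \<in> relations V k i j"
  shows "F \<in> relations V k i j \<or> G \<in> relations V k i j"
  using irreducible_variety_polyfun_mult[OF assms(1) eval3_polyfun' eval3_polyfun', of F k i j G k i j] assms(2)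
  by (auto simp: relations_def)

lemma relations_unit:
  assumes "irreducible_variety V" "is_unit u"
  shows "u \<notin> relations V k i j"
proof
  assume u: "u \<in> relations V k i j"
  obtain p where p: "p \<in> V" using irreducible_varietyD(2)[OF assms(1)] by blast
  obtain w where "1 = u * w" using assms(2) by blast
  moreover have "eval3 (u * w) (coords p k) (coords p i) (coords p j) = 0"
    using u p by (simp add: relations_def)
  ultimately show False by (metis eval3_simps(2) zero_neq_one)
qed

lemma exists_prime_relation:
  assumes "irreducible_variety V" "F \<noteq> 0" "F \<in> relations V k i j"
  shows "\<exists>W. prime_elem W \<and> W \<in> relations V k i j"
  using exists_prime_elem_in_prime_ideal[of F "\<lambda>F. F \<in> relations V k i j"] assms
    relations_mult relations_unit by metis

lemma three_coords_related:
  assumes "irreducible_variety V" "\<not> has_chain V 3" "k < 4" "i < 4" "j < 4" "distinct [k, i, j]"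
  shows "\<exists>F. F \<noteq> 0 \<and> F \<in> relations V k i j"
proof -
  have "\<not> indep V {k, i, j}"
    using indep_imp_has_chain[of V "{k, i, j}"] assms by (auto simp: numeral_3_eq_3)
  then obtain h w where h: "h \<in> polyfun" "depends_only_on {k, i, j} h" "\<forall>p\<in>V. h (coords p) = 0" "h w \<noteq> 0"
    unfolding indep_def by blast
  obtain F where F: "\<And>a b c. h (w(k := a, i := b, j := c)) = eval3 F a b c"
    using polyfun_eval3[OF h(1)] by metis
  have "eval3 F (w k) (w i) (w j) \<noteq> 0" using h(4) by (simp flip: F)
  moreover have "eval3 F (coords p k) (coords p i) (coords p j) = 0" if "p \<in> V" for p
  proof -
    have "h (w(k := coords p k, i := coords p i, j := coords p j)) = h (coords p)"
      using assms(6) by (intro h(2)[unfolded depends_only_on_def, rule_format]) auto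
    then show ?thesis using h(3) that F by simp
  qed
  ultimately show ?thesis by (auto simp: relations_def intro!: exI[of _ F])
qed

lemma not_indep2_related:
  assumes "\<not> indep V {i, j}" "i \<noteq> j"
  shows "\<exists>r. r \<noteq> 0 \<and> (\<forall>p\<in>V. eval2 r (coords p i) (coords p j) = 0)"
proof -
  obtain h w where h: "h \<in> polyfun" "depends_only_on {i, j} h" "\<forall>p\<in>V. h (coords p) = 0" "h w \<noteq> 0"
    using assms(1) unfolding indep_def by blast
  obtain F where F: "\<And>a b. h (w(i := a, j := b)) = eval2 F a b"
    using polyfun_eval2[OF h(1)] by metis
  have "eval2 F (w i) (w j) \<noteq> 0" using h(4) by (simp flip: F)
  moreover have "eval2 F (coords p i) (coords p j) = 0" if "p \<in> V" for p
  proof -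
    have "h (w(i := coords p i, j := coords p j)) = h (coords p)"
      using assms(2) by (intro h(2)[unfolded depends_only_on_def, rule_format]) auto
    then show ?thesis using h(3) that F by simp
  qed
  ultimately show ?thesis by (intro exI[of _ F]) auto
qed

lemma indep2_unrelated:
  assumes "indep V {i, j}" "i \<noteq> j" "r \<noteq> 0"
  shows "\<exists>p\<in>V. eval2 r (coords p i) (coords p j) \<noteq> 0"
proof (rule ccontr)
  assume "\<not> ?thesis"
  moreover have "(\<lambda>v. eval2 r (v i) (v j)) \<in> polyfun" by (rule eval2_polyfun')
  moreover have "depends_only_on {i, j} (\<lambda>v. eval2 r (v i) (v j))" by (auto simp: depends_only_on_def)
  ultimately have zero: "\<forall>v :: nat \<Rightarrow> complex. eval2 r (v i) (v j) = 0"
    using assms(1) unfolding indep_def by blast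
  obtain a b where "eval2 r a b \<noteq> 0" using eval2_nonzero[OF assms(3)] by blast
  moreover have "eval2 r a b = 0" using spec[OF zero, of "(\<lambda>_. 0)(i := a, j := b)"] assms(2) by simp
  ultimately show False by blast
qed

text \<open>If \<open>W\<close> did not divide \<open>H\<close>, eliminating the unknown from both
  would leave a relation between \<open>i\<close> and \<open>j\<close> alone.\<close>

lemma prime_relation_generates:
  assumes V: "irreducible_variety V" and "indep V {i, j}" "i \<noteq> j"
    and W: "prime_elem W" "W \<in> relations V k i j" and H: "H \<in> relations V k i j"
  shows "W dvd H"
proof (rule ccontr)
  assume "\<not> W dvd H"
  then obtain r where r: "r \<noteq> 0" "\<And>a b c. eval3 W a b c = 0 \<Longrightarrow> eval3 H a b c = 0 \<Longrightarrow> eval2 r b c = 0"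
    using eliminate3[OF W(1)] by metis
  then show False using indep2_unrelated[OF assms(2,3) r(1)] W H by (auto simp: relations_def)
qed

text \<open>The alternative between dense and thin constructible sets, relative to the surface
  \<open>W = 0\<close>: a basic set whose equations are multiples of \<open>W\<close> and whose
  inequation is not contains an open part of the surface. If there were none, each piece would
  satisfy an equation not divisible by \<open>W\<close>, yet their product would vanish on
  \<open>V\<close>.\<close>

lemma relation_image_dense:
  assumes V: "irreducible_variety V" and lt: "k < 4" "i < 4" "j < 4"
    and W: "prime_elem W" "W \<in> relations V k i j" and gen: "\<And>H. H \<in> relations V k i j \<Longrightarrow> W dvd H"
  shows "\<exists>h. \<not> W dvd h \<and> (\<forall>a b c. eval3 W a b c = 0 \<longrightarrow> eval3 h a b c \<noteq> 0 \<longrightarrow>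
    (\<exists>p\<in>V. coords p k = a \<and> coords p i = b \<and> coords p j = c))"
proof -
  define S where "S = {v. \<exists>p\<in>V. join p v \<in> {w. w k - w 4 = 0} \<inter> {w. w i - w 5 = 0} \<inter> {w. w j - w 6 = 0}}"
  have "S \<in> constructible" unfolding S_def
    by (intro constructible_image irreducible_varietyD[OF V] constructible_Int constructible_zero polyfun_intros)
  then obtain D where D: "\<forall>(A, g)\<in>set D. set A \<subseteq> polyfun \<and> g \<in> polyfun" "S = (\<Union>d\<in>set D. basic_constructible d)"
    using constructible_imp_dnf unfolding dnf_constructible_def by blast
  define e where "e a b c = (\<lambda>_::nat. 0::complex)(0 := a, 1 := b, 2 := c)" for a b c
  have e: "e a b c \<in> S \<longleftrightarrow> (\<exists>p\<in>V. coords p k = a \<and> coords p i = b \<and> coords p j = c)" for a b c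
    using lt by (auto simp: S_def join_def e_def)
  have "\<exists>F. \<forall>a b c. f (e a b c) = eval3 F a b c" if "f \<in> polyfun" for f
    using polyfun_eval3[OF that] by (auto simp: e_def)
  then obtain rep where rep: "\<And>f a b c. f \<in> polyfun \<Longrightarrow> f (e a b c) = eval3 (rep f) a b c" by metis
  have dvd0: "eval3 G a b c = 0" if "W dvd G" "eval3 W a b c = 0" for G a b c
    using that by (auto elim!: dvdE)
  show ?thesis
  proof (rule ccontr)
    assume contra: "\<not> ?thesis"
    have "\<exists>h. \<not> W dvd h \<and> (\<forall>a b c. e a b c \<in> basic_constructible d \<longrightarrow> eval3 W a b c = 0 \<longrightarrow> eval3 h a b c = 0)"
      if d: "d \<in> set D" for d
    proof -
      obtain A g where dA: "d = (A, g)" by force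
      have A: "\<And>f. f \<in> set A \<Longrightarrow> f \<in> polyfun" "g \<in> polyfun" using D(1) d dA by auto
      have mem: "e a b c \<in> basic_constructible d \<longleftrightarrow> (\<forall>f\<in>set A. eval3 (rep f) a b c = 0) \<and> eval3 (rep g) a b c \<noteq> 0" for a b c
        using A rep by (auto simp: dA basic_constructible_def)
      consider f where "f \<in> set A" "\<not> W dvd rep f" | "\<forall>f\<in>set A. W dvd rep f" "\<not> W dvd rep g" | "W dvd rep g"
        by blast
      then show ?thesis
      proof cases
        case 1
        then show ?thesis using mem by blast
      next
        case 2
        have "e a b c \<in> S" if "eval3 W a b c = 0" "eval3 (rep g) a b c \<noteq> 0" for a b c
        proof -
          have "e a b c \<in> basic_constructible d" unfolding mem using that 2(1) dvd0 by blast
          then show ?thesis unfolding D(2) using d by blast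
        qed
        then show ?thesis using contra 2(2) e by blast
      next
        case 3
        then show ?thesis using mem dvd0 W(1) by (intro exI[of _ 1]) auto
      qed
    qed
    then obtain h where h: "\<And>d. d \<in> set D \<Longrightarrow> \<not> W dvd h d"
      "\<And>d a b c. d \<in> set D \<Longrightarrow> e a b c \<in> basic_constructible d \<Longrightarrow> eval3 W a b c = 0 \<Longrightarrow> eval3 (h d) a b c = 0"
      by metis
    have "(\<Prod>d\<in>set D. h d) \<in> relations V k i j"
      unfolding relations_def
    proof (intro CollectI ballI)
      fix p assume p: "p \<in> V"
      then have "e (coords p k) (coords p i) (coords p j) \<in> S" using e by blast
      then obtain d where d: "d \<in> set D" "e (coords p k) (coords p i) (coords p j) \<in> basic_constructible d"
        using D(2) by blast
      moreover have "eval3 W (coords p k) (coords p i) (coords p j) = 0" using W(2) p by (auto simp: relations_def)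
      ultimately have "eval3 (h d) (coords p k) (coords p i) (coords p j) = 0" using h(2) by blast
      then show "eval3 (\<Prod>d\<in>set D. h d) (coords p k) (coords p i) (coords p j) = 0"
        unfolding eval3_prod using d(1) by (intro prod_zero) auto
    qed
    then show False using gen prime_elem_dvd_prod[OF _ W(1), of "set D" h] h(1) by blast
  qed
qed

text \<open>Over a generic point of the \<^term>\<open>(i, j)\<close>-plane the equation \<^term>\<open>W\<close> has \<^term>\<open>degree W\<close> simple roots,
  and each of them lifts to a point of a finite plane section of \<^term>\<open>V\<close>.\<close>

lemma degree_generating_relation_le:
  assumes V: "irreducible_variety V" "\<not> has_chain V 3"
    and lt: "k < 4" "i < 4" "j < 4" and dist: "distinct [k, i, j]"
    and W: "prime_elem W" "W \<in> relations V k i j" and gen: "\<And>H. H \<in> relations V k i j \<Longrightarrow> W dvd H"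
    and sec: "\<And>a b. finite {p \<in> V. coords p i = a \<and> coords p j = b} \<Longrightarrow> card {p \<in> V. coords p i = a \<and> coords p j = b} \<le> d"
  shows "degree W \<le> d"
proof (cases "degree W = 0")
  case False
  \<comment> \<open>A relation between \<open>i\<close> and \<open>j\<close> alone would be a
    multiple of \<open>W\<close>, although \<open>W\<close> has positive degree in the
    unknown.\<close>
  have indep: "indep V {i, j}"
  proof (rule ccontr)
    assume "\<not> indep V {i, j}"
    then obtain r where r: "r \<noteq> 0" "\<forall>p\<in>V. eval2 r (coords p i) (coords p j) = 0"
      using not_indep2_related dist by (metis distinct_length_2_or_more)
    then have "W dvd [:r:]" by (intro gen) (auto simp: relations_def)
    then have "degree W \<le> degree [:r:]" using r(1) by (intro dvd_imp_degree_le) auto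
    then show False using False by simp
  qed
  obtain l where l: "l < 4" "l \<notin> {k, i, j}" and cover: "\<And>n. n < 4 \<Longrightarrow> n \<in> {k, i, j, l}"
  proof -
    have "card {k, i, j} < card {..<4::nat}" using dist by simp
    then have "\<not> {..<4} \<subseteq> {k, i, j}" by (meson card_mono finite.emptyI finite_insert not_less)
    then obtain l where l: "l < 4" "l \<notin> {k, i, j}" by blast
    have "{k, i, j, l} = {..<4}" using l lt dist by (intro card_subset_eq) auto
    then show ?thesis using that l by blast
  qed
  \<comment> \<open>A relation for the fourth coordinate is needed to make the section over
    \<open>(b, c)\<close> finite.\<close>
  obtain W' where W': "W' \<noteq> 0" "W' \<in> relations V l i j"
    using three_coords_related[OF V l(1) lt(2,3)] dist l(2) by auto
  obtain h where h: "\<not> W dvd h" "\<And>a b c. eval3 W a b c = 0 \<Longrightarrow> eval3 h a b c \<noteq> 0 \<Longrightarrow>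
    \<exists>p\<in>V. coords p k = a \<and> coords p i = b \<and> coords p j = c"
    using relation_image_dense[OF V(1) lt W gen] by blast
  have "pderiv W \<noteq> 0" using False by (simp add: pderiv_eq_0_iff)
  then have "\<not> W dvd pderiv W" using dvd_imp_degree_le[of W "pderiv W"] False by (auto simp: degree_pderiv)
  then obtain r1 where r1: "r1 \<noteq> 0" "\<And>a b c. eval3 W a b c = 0 \<Longrightarrow> eval3 (pderiv W) a b c = 0 \<Longrightarrow> eval2 r1 b c = 0"
    using eliminate3[OF W(1)] by metis
  obtain r2 where r2: "r2 \<noteq> 0" "\<And>a b c. eval3 W a b c = 0 \<Longrightarrow> eval3 h a b c = 0 \<Longrightarrow> eval2 r2 b c = 0"
    using eliminate3[OF W(1) h(1)] by metis
  have "W \<noteq> 0" using W(1) by auto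
  \<comment> \<open>A point \<open>(b, c)\<close> outside the zeros of this product sees
    \<open>W\<close> with full degree, without multiple roots and with all roots lifting to
    \<open>V\<close>, and keeps \<open>W'\<close> nonzero.\<close>
  then have "r1 * r2 * lead_coeff W * lead_coeff W' \<noteq> 0" using r1(1) r2(1) W'(1) by simp
  then obtain b c where "eval2 (r1 * r2 * lead_coeff W * lead_coeff W') b c \<noteq> 0" using eval2_nonzero by blast
  then have bc: "eval2 r1 b c \<noteq> 0" "eval2 r2 b c \<noteq> 0" "eval2 (lead_coeff W) b c \<noteq> 0" "eval2 (lead_coeff W') b c \<noteq> 0" by auto
  let ?h = "map_poly (\<lambda>q. eval2 q b c)"
  let ?R = "{z. poly (?h W) z = 0}" and ?R' = "{z. poly (?h W') z = 0}"
  have nz: "?h W \<noteq> 0" "?h W' \<noteq> 0" using bc(3,4)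
    by (metis coeff_0 coeff_map_poly eval2_simps(1))+
  have deg: "degree (?h W) = degree W" using bc(3) by (intro degree_map_poly) auto
  have "poly (pderiv (?h W)) z \<noteq> 0" if "poly (?h W) z = 0" for z
    using that r1(2)[of z b c] bc(1) by (auto simp: pderiv_map_poly[OF comm_ring_hom_eval2] eval3_map_poly)
  then have card_R: "card ?R = degree W" using card_simple_roots[OF nz(1)] deg by simp
  let ?Z = "{p \<in> V. coords p i = b \<and> coords p j = c}"
  have "inj_on (\<lambda>p. (coords p k, coords p l)) ?Z"
  proof (rule inj_onI)
    fix p q assume pq: "p \<in> ?Z" "q \<in> ?Z" "(coords p k, coords p l) = (coords q k, coords q l)"
    then have "coords p n = coords q n" if "n < 4" for n using cover[OF that] by auto
    then show "p = q" by (rule coords_eqI)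
  qed
  moreover have "(\<lambda>p. (coords p k, coords p l)) ` ?Z \<subseteq> ?R \<times> ?R'"
    using W(2) W'(2) by (auto simp: relations_def eval3_map_poly)
  moreover have "finite (?R \<times> ?R')" using nz poly_roots_finite by blast
  ultimately have fin: "finite ?Z" by (meson finite_imageD finite_subset)
  have "?R \<subseteq> (\<lambda>p. coords p k) ` ?Z"
  proof
    fix z assume "z \<in> ?R"
    then have "eval3 W z b c = 0" "eval3 h z b c \<noteq> 0" using r2(2)[of z b c] bc(2) by (auto simp: eval3_map_poly)
    then show "z \<in> (\<lambda>p. coords p k) ` ?Z" using h(2) by fastforce
  qed
  then have "card ?R \<le> card ?Z" using fin by (meson surj_card_le)
  then show ?thesis using sec[OF fin] card_R by linarith
qed simp

text \<open>Where coordinate \<open>k\<close> takes infinitely many values, \<open>W\<close>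
  vanishes identically in its unknown. Counting such points requires the degrees of \<open>W\<close>
  in \<open>i\<close> and \<open>j\<close>, obtained by making these the unknown; therefore sections
  over all pairs of coordinates are assumed to be bounded.\<close>

lemma infinite_fibres_bounded:
  assumes V: "irreducible_variety V" "\<not> has_chain V 3"
    and lt: "k < 4" "i < 4" "j < 4" and dist: "distinct [k, i, j]"
    and indep: "indep V {i, j}"
    and sec: "\<And>i j a b. i < 4 \<Longrightarrow> j < 4 \<Longrightarrow> i \<noteq> j \<Longrightarrow> finite {p \<in> V. coords p i = a \<and> coords p j = b} \<Longrightarrow>
      card {p \<in> V. coords p i = a \<and> coords p j = b} \<le> d"
  defines "B \<equiv> {(a, b). infinite {coords p k | p. p \<in> V \<and> coords p i = a \<and> coords p j = b}}"
  shows "finite B" "card B \<le> (2 * d + 2 * d * d) * d"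
proof -
  obtain W where W: "prime_elem W" "W \<in> relations V k i j"
    using three_coords_related[OF V lt dist] exists_prime_relation[OF V(1)] by blast
  have gen: "W dvd H" if "H \<in> relations V k i j" for H
    using prime_relation_generates[OF V(1) indep _ W that] dist by simp
  have "degree W > 0"
  proof (rule ccontr)
    assume "\<not> degree W > 0"
    then obtain w where w: "W = [:w:]" by (metis degree_eq_zeroE gr_zeroI)
    then have "w \<noteq> 0" using W(1) by auto
    then show False using indep2_unrelated[OF indep] dist W(2) w by (auto simp: relations_def)
  qed
  let ?W1 = "swap_outer W" and ?W2 = "swap_outer (swap_inner W)"
  have "degree ?W1 \<le> d"
  proof (rule degree_generating_relation_le[OF V, where k = i and i = k and j = j])
    show "?W1 \<in> relations V i k j" using W(2) by (simp add: relations_def)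
    show "?W1 dvd H" if "H \<in> relations V i k j" for H
    proof -
      have "swap_outer H \<in> relations V k i j" using that by (simp add: relations_def)
      then show ?thesis using gen prime_elem_swap_outer(2)[OF W(1), of "swap_outer H"] by simp
    qed
  qed (use lt dist sec prime_elem_swap_outer(1)[OF W(1)] in auto)
  then have deg1: "degree (coeff W n) \<le> d" for n
    using degree_coeff_swap2[of W n] by (simp add: swap_outer_def)
  \<comment> \<open>The order \<open>(k, i, j)\<close> becomes \<open>(k, j, i)\<close> and then
    \<open>(j, k, i)\<close>.\<close>
  have "degree ?W2 \<le> d"
  proof (rule degree_generating_relation_le[OF V, where k = j and i = k and j = i])
    show "?W2 \<in> relations V j k i" using W(2) by (simp add: relations_def)
    show "?W2 dvd H" if "H \<in> relations V j k i" for H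
    proof -
      have "swap_inner (swap_outer H) \<in> relations V k i j" using that by (simp add: relations_def)
      then have "W dvd swap_inner (swap_outer H)" by (rule gen)
      then have "swap_inner W dvd swap_outer H"
        using prime_elem_swap_inner(2)[OF W(1), of "swap_inner (swap_outer H)"] by simp
      then show ?thesis
        using prime_elem_swap_outer(2)[OF prime_elem_swap_inner(1)[OF W(1)], of "swap_outer H"] by simp
    qed
  qed (use lt dist sec prime_elem_swap_outer(1)[OF prime_elem_swap_inner(1)[OF W(1)]] in auto)
  then have deg2': "degree (coeff (swap_inner W) n) \<le> d" for n
    using degree_coeff_swap2[of "swap_inner W" n] by (simp add: swap_outer_def)
  have deg2: "degree (coeff (coeff W n) m) \<le> d" for n m
  proof -
    interpret comm_ring_hom "swap2 :: complex poly poly \<Rightarrow> _" by (rule comm_ring_hom_swap2)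
    have "degree (coeff (coeff W n) m) \<le> degree (swap2 (coeff W n))" by (rule degree_coeff_swap2)
    also have "\<dots> = degree (coeff (swap_inner W) n)" by (simp add: swap_inner_def coeff_map_poly)
    finally show ?thesis using deg2'[of n] by linarith
  qed
  have "B \<subseteq> {(b, c). \<forall>a. eval3 W a b c = 0}"
  proof clarify
    fix b c a assume "(b, c) \<in> B"
    then have inf: "infinite {coords p k | p. p \<in> V \<and> coords p i = b \<and> coords p j = c}" by (simp add: B_def)
    have "{coords p k | p. p \<in> V \<and> coords p i = b \<and> coords p j = c} \<subseteq> {z. poly (map_poly (\<lambda>q. eval2 q b c) W) z = 0}"
      using W(2) by (auto simp: relations_def eval3_map_poly)
    then have "infinite {z. poly (map_poly (\<lambda>q. eval2 q b c) W) z = 0}" using inf finite_subset by blast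
    then have "map_poly (\<lambda>q. eval2 q b c) W = 0" using poly_roots_finite by blast
    then show "eval3 W a b c = 0" by (simp add: eval3_map_poly)
  qed
  moreover note prime_elem_vertical_lines[OF W(1) \<open>degree W > 0\<close> deg1 deg2]
  ultimately show "finite B" "card B \<le> (2 * d + 2 * d * d) * d"
    by (meson finite_subset, meson card_mono order_trans)
qed

section \<open>Products of plane curves\<close>

lemma exists_const_nonroot:
  fixes F :: "'a::idom poly" and e :: "complex \<Rightarrow> 'a"
  assumes "F \<noteq> 0" "inj e"
  shows "\<exists>x. poly F (e x) \<noteq> 0"
proof (rule ccontr)
  assume "\<not> ?thesis"
  then have "range e \<subseteq> {x. poly F x = 0}" by auto
  then have "finite (range e)" using poly_roots_finite[OF assms(1)] finite_subset by blast
  then have "finite (UNIV :: complex set)" using assms(2) by (rule finite_imageD)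
  then show False using infinite_UNIV_char_0 by blast
qed

lemma eval4_eval3: "eval4 F ((x, y), (s, t)) = eval3 (poly F [:[:[:x:]:]:]) y s t"
  by (simp add: eval4_def eval3_def eval2_def)

lemma eval4_eqI:
  assumes "\<And>p. eval4 F p = eval4 G p"
  shows "F = G"
proof (rule ccontr)
  assume "F \<noteq> G"
  then have "F - G \<noteq> 0" by simp
  then obtain x where "poly (F - G) [:[:[:x:]:]:] \<noteq> 0"
    using exists_const_nonroot[of "F - G" "\<lambda>x. [:[:[:x:]:]:]"] by (auto simp: inj_def simp del: poly_diff)
  then obtain y where "poly (poly (F - G) [:[:[:x:]:]:]) [:[:y:]:] \<noteq> 0"
    using exists_const_nonroot[of "poly (F - G) [:[:[:x:]:]:]" "\<lambda>x. [:[:x:]:]"] by (auto simp: inj_def simp del: poly_diff)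
  then obtain s t where "eval2 (poly (poly (F - G) [:[:[:x:]:]:]) [:[:y:]:]) s t \<noteq> 0"
    using eval2_nonzero by blast
  then have "eval3 (poly (F - G) [:[:[:x:]:]:]) y s t \<noteq> 0" by (simp add: eval3_def)
  then have "eval4 F ((x, y), (s, t)) \<noteq> eval4 G ((x, y), (s, t))" by (simp add: eval4_eval3)
  then show False using assms by blast
qed

lemma eval4_embXY: "eval4 (embXY G) p = eval2 G (coords p 0) (coords p 1)"
proof -
  have 1: "poly (map_poly (\<lambda>c. [:[:c:]:]) q) [:[:y:]:] = [:[:poly q y:]:]" for q :: "complex poly" and y
    by (induction q) (auto simp: map_poly_pCons)
  have 2: "poly (poly (embXY G) [:[:[:x:]:]:]) [:[:y:]:] = [:[:eval2 G x y:]:]" for x y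
    by (induction G) (auto simp: embXY_def map_poly_pCons 1)
  show ?thesis by (cases p) (auto simp: eval4_def 2)
qed

lemma eval4_embST: "eval4 (embST K) p = eval2 K (coords p 2) (coords p 3)"
  by (cases p) (auto simp: eval4_def eval2_def embST_def)

definition curve :: "complex poly poly \<Rightarrow> (complex \<times> complex) set" where
  "curve G = {(a, b). eval2 G a b = 0}"

lemma infinite_curve:
  assumes "prime_elem G"
  shows "infinite (curve G)"
proof (cases "degree G = 0")
  case True
  then obtain g where g: "G = [:g:]" by (metis degree_eq_zeroE)
  have "G \<noteq> 0" "\<not> is_unit G" using assms prime_elem_not_unit by auto
  then have "g \<noteq> 0" "\<not> is_unit g" by (auto simp: g is_unit_const_poly_iff)
  then have "degree g \<noteq> 0" by (simp add: is_unit_iff_degree)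
  then obtain b where b: "poly g b = 0" using fundamental_theorem_of_algebra constant_degree by metis
  have "range (\<lambda>a. (a, b)) \<subseteq> curve G" by (auto simp: curve_def g b)
  moreover have "infinite (range (\<lambda>a::complex. (a, b)))"
    using infinite_UNIV_char_0 finite_imageD[of "\<lambda>a. (a, b)" UNIV] by (auto simp: inj_def)
  ultimately show ?thesis using finite_subset by blast
next
  case False
  have "lead_coeff G \<noteq> 0" using assms by auto
  then have fin: "finite {b. poly (lead_coeff G) b = 0}" by (rule poly_roots_finite)
  have "b \<in> snd ` curve G" if b: "poly (lead_coeff G) b \<noteq> 0" for b
  proof -
    have "degree (map_poly (\<lambda>q. poly q b) G) = degree G" using b by (intro degree_map_poly) auto
    then have "\<not> constant (poly (map_poly (\<lambda>q. poly q b) G))" using False by (simp add: constant_degree)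
    then obtain a where "poly (map_poly (\<lambda>q. poly q b) G) a = 0" using fundamental_theorem_of_algebra by blast
    then have "(a, b) \<in> curve G" by (simp add: curve_def eval2_map_poly)
    then show ?thesis by force
  qed
  then have "UNIV \<subseteq> {b. poly (lead_coeff G) b = 0} \<union> snd ` curve G" by blast
  then show ?thesis
    using fin infinite_UNIV_char_0 by (metis finite_UnI finite_imageI finite_subset)
qed

lemma finite_curve_section:
  assumes "prime_elem G" "\<not> G dvd H"
  shows "finite {c \<in> curve G. eval2 H (fst c) (snd c) = 0}"
proof -
  have "{c \<in> curve G. eval2 H (fst c) (snd c) = 0} = {(a, b). eval2 G a b = 0 \<and> eval2 H a b = 0}"
    by (auto simp: curve_def)
  then show ?thesis using prime_elem_common_zeros_finite[OF assms] by simp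
qed

text \<open>A polynomial not divisible by \<open>G\<close> vanishes at only finitely many points of
  the curve, but the curve is infinite over the complex numbers.\<close>

lemma dvd_if_vanishes_on_curve:
  assumes "prime_elem G" "\<And>c. c \<in> curve G \<Longrightarrow> eval2 H (fst c) (snd c) = 0"
  shows "G dvd H"
proof (rule ccontr)
  assume "\<not> G dvd H"
  then have "finite {c \<in> curve G. eval2 H (fst c) (snd c) = 0}" using finite_curve_section assms(1) by blast
  moreover have "{c \<in> curve G. eval2 H (fst c) (snd c) = 0} = curve G" using assms(2) by auto
  ultimately show False using infinite_curve[OF assms(1)] by simp
qed

lemma curve_dvd_vanishes: "G dvd H \<Longrightarrow> c \<in> curve G \<Longrightarrow> eval2 H (fst c) (snd c) = 0"
  by (auto simp: curve_def elim!: dvdE)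

text \<open>If \<open>G\<close> divides a polynomial \<open>x - a\<close>, the curve lies on a
  vertical line, where the second coordinate is injective; otherwise every vertical line meets it in
  finitely many points.\<close>

lemma finite_coordinate_fibres:
  assumes "prime_elem G"
  shows "(\<forall>a. finite {c \<in> curve G. fst c = a}) \<or> (\<forall>b. finite {c \<in> curve G. snd c = b})"
proof (cases "\<exists>a. G dvd [:[:-a:], 1:]")
  case True
  then obtain a where "G dvd [:[:-a:], 1:]" by blast
  then have "fst c = a" if "c \<in> curve G" for c
    using curve_dvd_vanishes[OF _ that, of "[:[:-a:], 1:]"] by (simp add: eval2_def)
  then have "{c \<in> curve G. snd c = b} \<subseteq> {(a, b)}" for b by auto
  then show ?thesis by (meson finite.emptyI finite_insert finite_subset)
next
  case False
  have "finite {c \<in> curve G. eval2 [:[:-a:], 1:] (fst c) (snd c) = 0}" for a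
    using finite_curve_section[OF assms] False by blast
  then have "finite {c \<in> curve G. fst c = a}" for a by (simp add: eval2_def)
  then show ?thesis by blast
qed

text \<open>A polynomial in four variables as a sum of pure tensors; the number of summands is the
  induction measure below.\<close>

definition split_value :: "(mpoly2 \<times> mpoly2) list \<Rightarrow> pt4 \<Rightarrow> complex" where
  "split_value L p = (\<Sum>(a, b)\<leftarrow>L. eval2 a (coords p 0) (coords p 1) * eval2 b (coords p 2) (coords p 3))"

lemma split_value_simps [simp]:
  "split_value [] p = 0"
  "split_value ((a, b) # L) p = eval2 a (coords p 0) (coords p 1) * eval2 b (coords p 2) (coords p 3) + split_value L p"
  "split_value (L @ M) p = split_value L p + split_value M p"
  by (auto simp: split_value_def)

lemma split_value_product:
  "split_value (map (\<lambda>((a, b), (c, d)). (a * c, b * d)) (List.product L M)) p = split_value L p * split_value M p"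
proof (induction L)
  case (Cons x L)
  have "split_value (map (\<lambda>((a, b), (c, d)). (a * c, b * d)) (map (Pair x) M)) p = split_value [x] p * split_value M p"
    by (induction M) (auto simp: algebra_simps split: prod.splits)
  then show ?case using Cons by (cases x) (simp add: algebra_simps)
qed simp

lemma polyfun_split: "f \<in> polyfun \<Longrightarrow> \<exists>L. \<forall>p. f (coords p) = split_value L p"
proof (induction rule: polyfun.induct)
  case (polyfun_const c)
  show ?case by (intro exI[of _ "[([:[:c:]:], 1)]"]) auto
next
  case (polyfun_var i)
  consider "i = 0" | "i = 1" | "i = 2" | "i = 3" | "i \<ge> 4" by linarith
  then show ?case
  proof cases
    case 1 then show ?thesis by (intro exI[of _ "[([:0, 1:], 1)]"]) (auto simp: eval2_def)
  next
    case 2 then show ?thesis by (intro exI[of _ "[([:[:0, 1:]:], 1)]"]) (auto simp: eval2_def)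
  next
    case 3 then show ?thesis by (intro exI[of _ "[(1, [:0, 1:])]"]) (auto simp: eval2_def)
  next
    case 4 then show ?thesis by (intro exI[of _ "[(1, [:[:0, 1:]:])]"]) (auto simp: eval2_def)
  next
    case 5 then show ?thesis by (intro exI[of _ "[]"]) (auto simp: coords_ge_4)
  qed
next
  case (polyfun_add f g)
  then show ?case by (metis split_value_simps(3))
next
  case (polyfun_mult f g)
  then show ?case by (metis split_value_product)
qed

text \<open>A sum of \<^term>\<open>n\<close> products vanishing on a product of curves is shortened modulo the ideal: at a point of the
  second curve where some second factor does not vanish, it gives a linear relation between the first factors.\<close>

lemma vanishing_on_product_of_curves:
  assumes G: "prime_elem G" and K: "prime_elem K"
    and "\<And>p. p \<in> curve G \<times> curve K \<Longrightarrow> split_value L p = 0"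
  shows "\<exists>A B. \<forall>p. split_value L p = eval4 (embXY G * A + embST K * B) p"
  using assms(3)
proof (induction "length L" arbitrary: L rule: less_induct)
  case less
  show ?case
  proof (cases "\<forall>(a, b)\<in>set L. K dvd b")
    case True
    then have "\<exists>B. \<forall>p. split_value L p = eval4 (embST K * B) p"
    proof (induction L)
      case Nil
      then show ?case by (intro exI[of _ 0]) (simp add: eval4_zero)
    next
      case (Cons x L)
      obtain a b where x: "x = (a, b)" by force
      then obtain b' B where b': "b = K * b'" and B: "\<forall>p. split_value L p = eval4 (embST K * B) p"
        using Cons by (auto elim!: dvdE)
      then show ?case
        by (intro exI[of _ "embXY a * embST b' + B"])
          (simp add: x eval4_mult eval4_add eval4_embXY eval4_embST algebra_simps)
    qed
    then obtain B where "\<forall>p. split_value L p = eval4 (embST K * B) p" by blast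
    then show ?thesis by (intro exI[of _ 0] exI[of _ B]) simp
  next
    case False
    then obtain a0 b0 where "(a0, b0) \<in> set L" "\<not> K dvd b0" by blast
    then obtain L1 L2 where L: "L = L1 @ (a0, b0) # L2" by (metis split_list)
    have "\<exists>q\<in>curve K. eval2 b0 (fst q) (snd q) \<noteq> 0"
      using dvd_if_vanishes_on_curve[OF K, of b0] \<open>\<not> K dvd b0\<close> by blast
    then obtain s t where q: "(s, t) \<in> curve K" "eval2 b0 s t \<noteq> 0" by force
    define c where "c b = [:[:eval2 b s t / eval2 b0 s t:]:]" for b
    define M where "M = L1 @ L2"
    have c: "eval2 (c b) u v = eval2 b s t / eval2 b0 s t" for b u v by (simp add: c_def)
    \<comment> \<open>The linear relation read off at the point \<open>(s, t)\<close>, normalised so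
      that \<open>a0\<close> has coefficient one.\<close>
    define R where "R = a0 + (\<Sum>(a, b)\<leftarrow>M. c b * a)"
    have eval_sum: "eval2 (\<Sum>(a, b)\<leftarrow>N. c b * a) u v = split_value N ((u, v), (s, t)) / eval2 b0 s t" for N u v
      by (induction N) (auto simp: c add_divide_distrib)
    have split_L: "split_value L p = split_value M p + eval2 a0 (coords p 0) (coords p 1) * eval2 b0 (coords p 2) (coords p 3)" for p
      by (simp add: L M_def)
    have "eval2 R (fst z) (snd z) = 0" if "z \<in> curve G" for z
    proof -
      have "split_value L (z, (s, t)) = 0" using less.prems that q(1) by auto
      moreover have "eval2 R (fst z) (snd z) = split_value L (z, (s, t)) / eval2 b0 s t"
        using q(2) by (simp add: R_def eval_sum split_L add_divide_distrib)
      ultimately show ?thesis by simp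
    qed
    then obtain h where h: "R = G * h" using dvd_if_vanishes_on_curve[OF G] by blast
    \<comment> \<open>Modulo \<open>G\<close>, the factor \<open>a0\<close> is minus the combination
      of the other first factors; absorbing it into the second factors removes one summand.\<close>
    define M' where "M' = map (\<lambda>(a, b). (a, b - c b * b0)) M"
    have M': "split_value N p = split_value (map (\<lambda>(a, b). (a, b - c b * b0)) N) p +
      eval2 (\<Sum>(a, b)\<leftarrow>N. c b * a) (coords p 0) (coords p 1) * eval2 b0 (coords p 2) (coords p 3)" for N p
      by (induction N) (auto simp: c algebra_simps)
    have eq: "split_value L p = split_value M' p + eval4 (embXY G * (embXY h * embST b0)) p" for p
    proof -
      define \<sigma> where "\<sigma> = eval2 (\<Sum>(a, b)\<leftarrow>M. c b * a) (coords p 0) (coords p 1)"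
      have "eval2 R (coords p 0) (coords p 1) = eval2 a0 (coords p 0) (coords p 1) + \<sigma>"
        unfolding R_def \<sigma>_def by (rule eval2_simps)
      then have a0: "eval2 a0 (coords p 0) (coords p 1) =
        eval2 G (coords p 0) (coords p 1) * eval2 h (coords p 0) (coords p 1) - \<sigma>"
        by (simp add: h)
      have "split_value M p = split_value M' p + \<sigma> * eval2 b0 (coords p 2) (coords p 3)"
        unfolding M'_def \<sigma>_def by (rule M')
      then show ?thesis unfolding split_L a0 eval4_mult eval4_embXY eval4_embST by (simp add: algebra_simps)
    qed
    have "split_value M' p = 0" if "p \<in> curve G \<times> curve K" for p
      using less.prems[OF that] eq[of p] that by (auto simp: eval4_mult eval4_embXY curve_def)
    moreover have "length M' < length L" by (simp add: M'_def M_def L)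
    ultimately obtain A B where "\<forall>p. split_value M' p = eval4 (embXY G * A + embST K * B) p"
      using less.hyps by blast
    then show ?thesis
      by (intro exI[of _ "A + embXY h * embST b0"] exI[of _ B])
        (simp add: eq eval4_add eval4_mult algebra_simps)
  qed
qed

lemma vanishing_ideal_product_of_curves:
  assumes "prime_elem G" "prime_elem K" "F \<in> vanishing_ideal X" "curve G \<times> curve K \<subseteq> X"
  shows "cartesian_poly G K F"
proof -
  obtain L where L: "\<And>p. eval4 F p = split_value L p"
    using polyfun_split[OF eval4_polyfun[of F]] by auto
  have "split_value L p = 0" if "p \<in> curve G \<times> curve K" for p
    using that assms(3,4) L by (force simp: vanishing_ideal_def)
  then obtain A B where "\<forall>p. split_value L p = eval4 (embXY G * A + embST K * B) p"
    using vanishing_on_product_of_curves[OF assms(1,2)] by blast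
  then have "F = embXY G * A + embST K * B" using L by (intro eval4_eqI) auto
  then show ?thesis by (auto simp: cartesian_poly_def)
qed

lemma nonconst2_prime_elem:
  assumes "prime_elem G"
  shows "nonconst2 G"
  unfolding nonconst2_def
proof
  assume "\<exists>c. G = [:[:c:]:]"
  then obtain c where c: "G = [:[:c:]:]" by blast
  have "c \<noteq> 0" using assms c by auto
  then have "is_unit G" by (simp add: c is_unit_const_poly_iff)
  then show False using assms prime_elem_not_unit by blast
qed

lemma exists_prime_relation2:
  assumes V: "irreducible_variety V" and "\<not> indep V {i, j}" "i \<noteq> j"
  shows "\<exists>G. prime_elem G \<and> (\<forall>p\<in>V. eval2 G (coords p i) (coords p j) = 0)"
proof -
  obtain r where r: "r \<noteq> 0" "\<forall>p\<in>V. eval2 r (coords p i) (coords p j) = 0"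
    using not_indep2_related assms(2,3) by blast
  show ?thesis
  proof (rule exists_prime_elem_in_prime_ideal[where P = "\<lambda>r. \<forall>p\<in>V. eval2 r (coords p i) (coords p j) = 0", OF r])
    fix u :: mpoly2 assume "is_unit u"
    then obtain w where "1 = u * w" by blast
    then have "eval2 u a b * eval2 w a b = 1" for a b by (metis eval2_simps(2,5))
    moreover obtain p where "p \<in> V" using irreducible_varietyD(2)[OF V] by blast
    ultimately show "\<not> (\<forall>p\<in>V. eval2 u (coords p i) (coords p j) = 0)" by (metis mult_zero_left zero_neq_one)
  next
    fix A B assume "\<forall>p\<in>V. eval2 (A * B) (coords p i) (coords p j) = 0"
    then show "(\<forall>p\<in>V. eval2 A (coords p i) (coords p j) = 0) \<or> (\<forall>p\<in>V. eval2 B (coords p i) (coords p j) = 0)"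
      using irreducible_variety_polyfun_mult[OF V eval2_polyfun' eval2_polyfun', of A i j B i j] by simp
  qed
qed

text \<open>Take a coordinate with finite fibres on \<open>C\<close>. Apart from finitely many
  values its slices of \<open>V\<close> are finite, so it is constant on \<open>W\<close>, and
  \<open>W\<close> lies over finitely many points of \<open>C\<close>.\<close>

lemma finite_projection_of_proper_subvariety:
  fixes \<pi> :: "pt4 \<Rightarrow> complex \<times> complex"
  assumes V: "irreducible_variety V" and W: "irreducible_variety W" "W \<subset> V"
    and ij: "i < 4" "j < 4" "\<And>p. \<pi> p = (coords p i, coords p j)"
    and C: "\<And>p. p \<in> V \<Longrightarrow> \<pi> p \<in> C" "(\<forall>a. finite {c \<in> C. fst c = a}) \<or> (\<forall>b. finite {c \<in> C. snd c = b})"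
    and E: "finite E" "\<And>c. c \<in> C - E \<Longrightarrow> finite {p \<in> V. \<pi> p = c}"
  shows "finite (\<pi> ` W)"
proof -
  have *: "finite (\<pi> ` W)" if k: "k < 4" "\<And>p. coords p k = f (\<pi> p)" and fin: "\<And>a. finite {c \<in> C. f c = a}" for k f
  proof -
    have "finite {p \<in> V. coords p k = a}" if "a \<notin> f ` E" for a
    proof -
      have "{p \<in> V. coords p k = a} \<subseteq> (\<Union>c\<in>{c \<in> C. f c = a}. {p \<in> V. \<pi> p = c})"
        using C(1) k(2) by auto
      moreover have "finite (\<Union>c\<in>{c \<in> C. f c = a}. {p \<in> V. \<pi> p = c})"
        using fin[of a] E(2) that by (intro finite_UN_I) auto
      ultimately show ?thesis using finite_subset by blast
    qed
    then obtain a where "\<forall>p\<in>W. coords p k = a"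
      using coord_constant_on_proper_subvariety[OF V W k(1), of "f ` E"] E(1) by blast
    then have "\<pi> ` W \<subseteq> {c \<in> C. f c = a}" using C(1) W(2) k(2) by auto
    then show ?thesis using fin finite_subset by blast
  qed
  show ?thesis using C(2) *[of i fst] *[of j snd] ij by auto
qed

text \<open>Suppose a point of the product of the two curves is missing from \<open>V\<close>. Then
  all but finitely many fibres of \<open>V\<close> over either curve are finite, so every proper
  irreducible subvariety projects to finite sets on both sides and is a point. A chain of length two
  contradicts this.\<close>

lemma cartesian_if_both_dependent:
  assumes V: "irreducible_variety V" and chain: "has_chain V 2"
    and dep: "\<not> indep V {0, 1}" "\<not> indep V {2, 3}"
  shows "cartesian V"
proof -
  obtain G where G: "prime_elem G" "\<forall>p\<in>V. eval2 G (coords p 0) (coords p 1) = 0"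
    using exists_prime_relation2[OF V dep(1)] by auto
  obtain K where K: "prime_elem K" "\<forall>p\<in>V. eval2 K (coords p 2) (coords p 3) = 0"
    using exists_prime_relation2[OF V dep(2)] by auto
  have VC: "fst p \<in> curve G" "snd p \<in> curve K" if "p \<in> V" for p
    using G(2) K(2) that by (auto simp: curve_def)
  have "curve G \<times> curve K \<subseteq> V"
  proof (rule ccontr)
    assume "\<not> curve G \<times> curve K \<subseteq> V"
    then obtain c0 q0 where cq: "c0 \<in> curve G" "q0 \<in> curve K" "(c0, q0) \<notin> V" by auto
    have separate: "\<exists>F. (\<forall>p\<in>V. eval4 F p = 0) \<and> eval4 F p0 \<noteq> 0" if "p0 \<notin> V" for p0
      using irreducible_varietyD(1)[OF V] that unfolding is_variety_def zero_set_def by blast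
    have upd1: "of_coords ((coords (c, q))(0 := a, 1 := b)) = ((a, b), q)"
      and upd2: "of_coords ((coords (c, q))(2 := a, 3 := b)) = (c, (a, b))" for c q a b
      by (simp_all add: of_coords_def)
    \<comment> \<open>The restriction to the first plane of a polynomial separating
      \<open>(c0, q)\<close> from \<open>V\<close> is not divisible by \<open>G\<close>.\<close>
    have finite_C: "finite {c \<in> curve G. (c, q) \<in> V}" if cq: "c0 \<in> curve G" "(c0, q) \<notin> V" for c0 q
    proof -
      obtain F where F: "\<forall>p\<in>V. eval4 F p = 0" "eval4 F (c0, q) \<noteq> 0" using separate[OF cq(2)] by blast
      obtain H where "\<And>a b. eval4 F (of_coords ((coords (c0, q))(0 := a, 1 := b))) = eval2 H a b"
        using polyfun_eval2[OF eval4_polyfun[of F]] by metis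
      then have "eval2 H a b = eval4 F ((a, b), q)" for a b by (metis upd1)
      then have H: "eval2 H (fst c) (snd c) = eval4 F (c, q)" for c by simp
      have "\<not> G dvd H" using curve_dvd_vanishes[OF _ cq(1), of H] F(2) H by auto
      then have "finite {c \<in> curve G. eval2 H (fst c) (snd c) = 0}" using finite_curve_section G(1) by blast
      moreover have "{c \<in> curve G. (c, q) \<in> V} \<subseteq> {c \<in> curve G. eval2 H (fst c) (snd c) = 0}"
        using F(1) H by auto
      ultimately show ?thesis using finite_subset by blast
    qed
    have finite_K: "finite {q \<in> curve K. (c, q) \<in> V}" if cq: "q0 \<in> curve K" "(c, q0) \<notin> V" for c q0
    proof -
      obtain F where F: "\<forall>p\<in>V. eval4 F p = 0" "eval4 F (c, q0) \<noteq> 0" using separate[OF cq(2)] by blast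
      obtain H where "\<And>a b. eval4 F (of_coords ((coords (c, q0))(2 := a, 3 := b))) = eval2 H a b"
        using polyfun_eval2[OF eval4_polyfun[of F]] by metis
      then have "eval2 H a b = eval4 F (c, (a, b))" for a b by (metis upd2)
      then have H: "eval2 H (fst q) (snd q) = eval4 F (c, q)" for q by simp
      have "\<not> K dvd H" using curve_dvd_vanishes[OF _ cq(1), of H] F(2) H by auto
      then have "finite {q \<in> curve K. eval2 H (fst q) (snd q) = 0}" using finite_curve_section K(1) by blast
      moreover have "{q \<in> curve K. (c, q) \<in> V} \<subseteq> {q \<in> curve K. eval2 H (fst q) (snd q) = 0}"
        using F(1) H by auto
      ultimately show ?thesis using finite_subset by blast
    qed
    obtain W' W where W': "irreducible_variety W'" "W' \<subseteq> V" and W: "irreducible_variety W" "W \<subset> W'" "has_chain W 1"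
      using has_chain_SucD[of V 1] chain by (auto simp: numeral_2_eq_2)
    have "W \<subset> V" using W W' by blast
    \<comment> \<open>The possible exceptions are the \<open>c\<close> with
      \<open>(c, q0) \<in> V\<close>, finite in number because \<open>(c0, q0)\<close> is missing;
      over any other \<open>c\<close> in the curve the point \<open>(c, q0)\<close> itself is
      missing, which makes the fibre finite.\<close>
    have "finite (fst ` W)"
    proof (rule finite_projection_of_proper_subvariety[OF V W(1) \<open>W \<subset> V\<close>, of 0 1 fst "curve G" "{c \<in> curve G. (c, q0) \<in> V}"])
      show "finite {p \<in> V. fst p = c}" if "c \<in> curve G - {c \<in> curve G. (c, q0) \<in> V}" for c
      proof -
        have "{p \<in> V. fst p = c} \<subseteq> Pair c ` {q \<in> curve K. (c, q) \<in> V}" using VC by force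
        then show ?thesis using finite_K[of q0 c] cq that finite_subset by blast
      qed
    qed (use VC finite_coordinate_fibres G finite_C cq in auto)
    moreover have "finite (snd ` W)"
    proof (rule finite_projection_of_proper_subvariety[OF V W(1) \<open>W \<subset> V\<close>, of 2 3 snd "curve K" "{q \<in> curve K. (c0, q) \<in> V}"])
      show "finite {p \<in> V. snd p = q}" if "q \<in> curve K - {q \<in> curve K. (c0, q) \<in> V}" for q
      proof -
        have "{p \<in> V. snd p = q} \<subseteq> (\<lambda>c. (c, q)) ` {c \<in> curve G. (c, q) \<in> V}" using VC by force
        then show ?thesis using finite_C[of c0 q] cq that finite_subset by blast
      qed
    qed (use VC finite_coordinate_fibres K finite_K cq in auto)
    moreover have "W \<subseteq> fst ` W \<times> snd ` W" by (auto simp: image_iff) force+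
    ultimately have "finite W" using finite_subset[OF _ finite_cartesian_product] by blast
    then obtain p where p: "W = {p}" using irreducible_variety_finite W(1) by blast
    have "has_chain W (Suc 0)" using W(3) by simp
    then obtain U U' where "irreducible_variety U'" "U' \<subset> U" "U \<subseteq> W" by (rule has_chain_SucD)
    then show False using irreducible_varietyD(2)[of U'] p by blast
  qed
  then have "\<forall>F\<in>vanishing_ideal V. cartesian_poly G K F"
    using vanishing_ideal_product_of_curves G(1) K(1) by blast
  then show ?thesis unfolding cartesian_def using nonconst2_prime_elem G(1) K(1) by blast
qed

section \<open>Counting points over finite grids\<close>

text \<open>A good fibre has at most \<open>d\<close> points; each of the at most \<open>b\<close>
  exceptional ones may contain all of \<open>Q\<close>.\<close>

lemma card_le_by_fst_fibres:
  assumes "finite P" "finite Q" "A \<subseteq> P \<times> Q" "finite B" "card B \<le> b"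
    and fibre: "\<And>c. c \<in> P - B \<Longrightarrow> card {p \<in> A. fst p = c} \<le> d"
  shows "card A \<le> d * card P + b * card Q"
proof -
  have fin: "finite A" using assms(1-3) finite_subset by blast
  have "card A = (\<Sum>c\<in>P. card {p \<in> A. fst p = c})"
  proof -
    have "A = (\<Union>c\<in>P. {p \<in> A. fst p = c})" using assms(3) by auto
    moreover have "card (\<Union>c\<in>P. {p \<in> A. fst p = c}) = (\<Sum>c\<in>P. card {p \<in> A. fst p = c})"
      using assms(1) fin by (intro card_UN_disjoint) auto
    ultimately show ?thesis by simp
  qed
  also have "\<dots> \<le> (\<Sum>c\<in>P. d + (if c \<in> B then card Q else 0))"
  proof (rule sum_mono)
    fix c assume c: "c \<in> P"
    have "{p \<in> A. fst p = c} \<subseteq> Pair c ` Q" using assms(3) by auto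
    then have "card {p \<in> A. fst p = c} \<le> card (Pair c ` Q)" using assms(2) by (intro card_mono) auto
    also have "\<dots> \<le> card Q" using assms(2) by (rule card_image_le)
    finally show "card {p \<in> A. fst p = c} \<le> d + (if c \<in> B then card Q else 0)"
      using fibre[of c] c by auto
  qed
  also have "\<dots> = d * card P + card (P \<inter> B) * card Q"
    using assms(1) by (simp add: sum.distrib sum.If_cases Int_def)
  also have "\<dots> \<le> d * card P + b * card Q"
    using card_mono[of B "P \<inter> B"] assms(4,5) by (intro add_left_mono mult_le_mono1) auto
  finally show ?thesis .
qed

lemma card_le_by_snd_fibres:
  assumes "finite P" "finite Q" "A \<subseteq> P \<times> Q" "finite B" "card B \<le> b"
    and fibre: "\<And>c. c \<in> Q - B \<Longrightarrow> card {p \<in> A. snd p = c} \<le> d"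
  shows "card A \<le> d * card Q + b * card P"
proof -
  have "card {p \<in> prod.swap ` A. fst p = c} = card {p \<in> A. snd p = c}" for c
  proof -
    have "{p \<in> prod.swap ` A. fst p = c} = prod.swap ` {p \<in> A. snd p = c}" by auto
    then show ?thesis by (simp add: card_image)
  qed
  then have "card (prod.swap ` A) \<le> d * card Q + b * card P"
    using assms by (intro card_le_by_fst_fibres[of Q P _ B]) auto
  then show ?thesis by (simp add: card_image)
qed

definition coord_eq :: "nat \<Rightarrow> complex \<Rightarrow> complex \<times> complex \<times> complex \<times> complex \<times> complex" where
  "coord_eq i a = (of_bool (i = 0), of_bool (i = 1), of_bool (i = 2), of_bool (i = 3), a)"

lemma lin_form_coord_eq: "i < 4 \<Longrightarrow> lin_form (coord_eq i a) p = coords p i - a"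
  by (auto simp: coord_eq_def less_4_cases)

text \<open>The summand \<open>d\<close> bounds good fibres, the doubled term counts exceptional
  points for the two remaining coordinates, and the final \<open>1\<close> covers components over a
  single point of the first plane.\<close>

definition fibre_const :: "nat \<Rightarrow> nat" where
  "fibre_const d = d + 2 * ((2 * d + 2 * d * d) * d) + 1"

lemma fibre_const_mono: "d \<le> e \<Longrightarrow> fibre_const d \<le> fibre_const e"
  unfolding fibre_const_def by (intro add_mono mult_le_mono) auto

lemma weighted_card_le:
  fixes a b c m n x :: nat
  assumes "x \<le> a * m + b * n" "a \<le> c" "b \<le> c"
  shows "x \<le> c * (m + n)"
proof -
  have "a * m + b * n \<le> c * m + c * n" using assms(2,3) by (intro add_mono mult_le_mono1)
  then show ?thesis using assms(1) by (simp add: add_mult_distrib2)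
qed

lemma component_bound:
  assumes V: "irreducible_variety V" and chain: "\<not> has_chain V 3" and cart: "\<not> cartesian V"
    and PQ: "finite P" "finite Q"
  shows "card (V \<inter> (P \<times> Q)) \<le> fibre_const (irr_degree V) * (card P + card Q)"
proof -
  define d where "d = irr_degree V"
  define b where "b = (2 * d + 2 * d * d) * d"
  let ?A = "V \<inter> (P \<times> Q)"
  note V' = irreducible_varietyD(1)[OF V]
  have A: "?A \<subseteq> P \<times> Q" "finite ?A" using PQ by auto
  consider (zero) "\<not> has_chain V 1" | (one) "has_chain V 1" "\<not> has_chain V 2" | (two) "has_chain V 2" by blast
  then have "card ?A \<le> fibre_const d * (card P + card Q)"
  proof cases
    case zero
    then obtain p where "V = {p}" using no_chain_1_finite[OF V'] irreducible_variety_finite[OF V] by auto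
    then have B: "?A \<subseteq> {p}" by auto
    have "card ?A \<le> 0 * card P + 1 * card Q"
    proof (rule card_le_by_fst_fibres[OF PQ A(1), of "{fst p}"])
      show "card {q \<in> ?A. fst q = c} \<le> 0" if "c \<in> P - {fst p}" for c
      proof -
        have "{q \<in> ?A. fst q = c} = {}" using that B by auto
        then show ?thesis by (simp only: card.empty)
      qed
    qed auto
    then show ?thesis by (rule weighted_card_le) (auto simp: fibre_const_def)
  next
    case one
    have dim: "variety_dim V = 1" using variety_dim_eqI[of V 1] one by (simp add: numeral_2_eq_2)
    have slice: "finite {p \<in> V. coords p i = a} \<and> card {p \<in> V. coords p i = a} \<le> d"
      if i: "i < 4" "\<not> V \<subseteq> {p. coords p i = a}" for i a
    proof -
      have eq: "V \<inter> {p. coords p i = a} = {p \<in> V. coords p i = a}" "V \<inter> lin_set [coord_eq i a] = {p \<in> V. coords p i = a}"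
        using lin_form_coord_eq[OF i(1)] by (auto simp: lin_set_altdef)
      have "\<not> has_chain (V \<inter> {p. coords p i = a}) 1"
        using no_chain_proper_section[OF V _ i(2), of 1] one(2) by (simp add: numeral_2_eq_2)
      then have fin: "finite {p \<in> V. coords p i = a}"
        using no_chain_1_finite[OF is_variety_Int[OF V' is_variety_coord], of i a] by (simp add: eq)
      then show ?thesis
        using section_le_irr_degree[OF V', of "[coord_eq i a]"] dim by (simp add: eq d_def)
    qed
    \<comment> \<open>A nonconstant coordinate of the first plane has proper, hence finite slices;
      if both are constant, \<open>V\<close> lies over a single point of that plane.\<close>
    show ?thesis
    proof (cases "\<exists>i\<in>{0, 1}. \<forall>a. \<not> V \<subseteq> {p. coords p i = a}")
      case True
      then obtain i where i: "i \<in> {0, 1}" "\<And>a. \<not> V \<subseteq> {p. coords p i = a}" by blast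
      have "card ?A \<le> d * card P + 0 * card Q"
      proof (rule card_le_by_fst_fibres[OF PQ A(1), of "{}"])
        fix c :: "complex \<times> complex"
        define a where "a = (if i = 0 then fst c else snd c)"
        have "{p \<in> ?A. fst p = c} \<subseteq> {p \<in> V. coords p i = a}" using i(1) by (auto simp: a_def)
        moreover have "finite {p \<in> V. coords p i = a}" "card {p \<in> V. coords p i = a} \<le> d"
          using slice[of i a] i by auto
        ultimately show "card {p \<in> ?A. fst p = c} \<le> d" by (meson card_mono order_trans)
      qed auto
      then show ?thesis by (rule weighted_card_le) (auto simp: fibre_const_def)
    next
      case False
      then obtain a a' where a: "V \<subseteq> {p. coords p 0 = a}" "V \<subseteq> {p. coords p 1 = a'}" by blast
      have "card ?A \<le> 0 * card P + 1 * card Q"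
      proof (rule card_le_by_fst_fibres[OF PQ A(1), of "{(a, a')}"])
        show "card {q \<in> ?A. fst q = c} \<le> 0" if "c \<in> P - {(a, a')}" for c
        proof -
          have "fst q = (a, a')" if "q \<in> V" for q
            using subsetD[OF a(1) that] subsetD[OF a(2) that] by (simp add: prod_eq_iff)
          then have "{q \<in> ?A. fst q = c} = {}" using that by blast
          then show ?thesis by (simp only: card.empty)
        qed
      qed auto
      then show ?thesis by (rule weighted_card_le) (auto simp: fibre_const_def)
    qed
  next
    case two
    have dim: "variety_dim V = 2" using variety_dim_eqI[of V 2] two chain by (simp add: numeral_3_eq_3)
    have sec: "card {p \<in> V. coords p i = a \<and> coords p j = a'} \<le> d"
      if "i < 4" "j < 4" "i \<noteq> j" "finite {p \<in> V. coords p i = a \<and> coords p j = a'}" for i j a a'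
    proof -
      have eq: "V \<inter> lin_set [coord_eq i a, coord_eq j a'] = {p \<in> V. coords p i = a \<and> coords p j = a'}"
        using lin_form_coord_eq that(1,2) by (auto simp: lin_set_altdef)
      show ?thesis
        using section_le_irr_degree[OF V', of "[coord_eq i a, coord_eq j a']"] dim that(4) by (simp add: eq d_def)
    qed
    let ?B = "\<lambda>k i j. {(a, a'). infinite {coords p k | p. p \<in> V \<and> coords p i = a \<and> coords p j = a'}}"
    \<comment> \<open>Off both exceptional sets the two remaining coordinates take finitely many
      values and determine the point, so the fibre is a finite section.\<close>
    have bad: "finite (?B k i j \<union> ?B l i j) \<and> card (?B k i j \<union> ?B l i j) \<le> 2 * b \<and>
        (\<forall>a a'. (a, a') \<notin> ?B k i j \<union> ?B l i j \<longrightarrow>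
          finite {p \<in> V. coords p i = a \<and> coords p j = a'} \<and> card {p \<in> V. coords p i = a \<and> coords p j = a'} \<le> d)"
      if ind: "indep V {i, j}" and lt: "i < 4" "j < 4" "k < 4" "l < 4" and dist: "distinct [i, j, k, l]" for i j k l
    proof (intro conjI allI impI)
      have K: "finite (?B k i j)" "card (?B k i j) \<le> b"
        using infinite_fibres_bounded[OF V chain _ _ _ _ ind sec, where k = k] lt dist unfolding b_def by simp_all
      have L: "finite (?B l i j)" "card (?B l i j) \<le> b"
        using infinite_fibres_bounded[OF V chain _ _ _ _ ind sec, where k = l] lt dist unfolding b_def by simp_all
      show "finite (?B k i j \<union> ?B l i j)" using K L by blast
      show "card (?B k i j \<union> ?B l i j) \<le> 2 * b" using card_Un_le[of "?B k i j" "?B l i j"] K L by linarith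
      fix a a' assume good: "(a, a') \<notin> ?B k i j \<union> ?B l i j"
      let ?Z = "{p \<in> V. coords p i = a \<and> coords p j = a'}"
      let ?K = "{coords p k | p. p \<in> V \<and> coords p i = a \<and> coords p j = a'}"
      let ?L = "{coords p l | p. p \<in> V \<and> coords p i = a \<and> coords p j = a'}"
      have "{i, j, k, l} = {..<4}" using lt dist by (intro card_subset_eq) auto
      then have cover: "n \<in> {i, j, k, l}" if "n < 4" for n using that by blast
      have "inj_on (\<lambda>p. (coords p k, coords p l)) ?Z"
      proof (rule inj_onI)
        fix p q assume pq: "p \<in> ?Z" "q \<in> ?Z" "(coords p k, coords p l) = (coords q k, coords q l)"
        then have "coords p n = coords q n" if "n < 4" for n using cover[OF that] by auto
        then show "p = q" by (rule coords_eqI)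
      qed
      moreover have "(\<lambda>p. (coords p k, coords p l)) ` ?Z \<subseteq> ?K \<times> ?L" by blast
      moreover have "finite (?K \<times> ?L)" using good by blast
      ultimately show "finite ?Z" by (meson finite_imageD finite_subset)
      then show "card ?Z \<le> d" using sec lt dist by simp
    qed
    have "indep V {0, 1} \<or> indep V {2, 3}" using cartesian_if_both_dependent[OF V two] cart by blast
    then show ?thesis
    proof
      assume "indep V {0, 1}"
      note B = bad[OF this, of 2 3]
      have "card ?A \<le> d * card P + (2 * b) * card Q"
      proof (rule card_le_by_fst_fibres[OF PQ A(1), of "?B 2 0 1 \<union> ?B 3 0 1"])
        fix c assume c: "c \<in> P - (?B 2 0 1 \<union> ?B 3 0 1)"
        let ?Z = "{p \<in> V. coords p 0 = fst c \<and> coords p 1 = snd c}"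
        have "{p \<in> ?A. fst p = c} \<subseteq> ?Z" by auto
        moreover have "finite ?Z" "card ?Z \<le> d"
          using conjunct2[OF conjunct2[OF B], rule_format, of "fst c" "snd c"] c by simp_all
        ultimately show "card {p \<in> ?A. fst p = c} \<le> d" by (meson card_mono order_trans)
      qed (use B in auto)
      then show ?thesis by (rule weighted_card_le) (auto simp: fibre_const_def b_def)
    next
      assume "indep V {2, 3}"
      note B = bad[OF this, of 0 1]
      have "card ?A \<le> d * card Q + (2 * b) * card P"
      proof (rule card_le_by_snd_fibres[OF PQ A(1), of "?B 0 2 3 \<union> ?B 1 2 3"])
        fix c assume c: "c \<in> Q - (?B 0 2 3 \<union> ?B 1 2 3)"
        let ?Z = "{p \<in> V. coords p 2 = fst c \<and> coords p 3 = snd c}"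
        have "{p \<in> ?A. snd p = c} \<subseteq> ?Z" by auto
        moreover have "finite ?Z" "card ?Z \<le> d"
          using conjunct2[OF conjunct2[OF B], rule_format, of "fst c" "snd c"] c by simp_all
        ultimately show "card {p \<in> ?A. snd p = c} \<le> d" by (meson card_mono order_trans)
      qed (use B in auto)
      then have "card ?A \<le> fibre_const d * (card Q + card P)"
        by (rule weighted_card_le) (auto simp: fibre_const_def b_def)
      then show ?thesis by (simp add: add.commute)
    qed
  qed
  then show ?thesis by (simp add: d_def)
qed

theorem theorem1p2:
  fixes d :: nat
  shows "\<exists>C::real. \<forall>(X::pt4 set) (P::(complex \<times> complex) set) (Q::(complex \<times> complex) set).
    is_variety X \<and> (has_dim X 1 \<or> has_dim X 2) \<and> variety_degree X = d \<and>
    finite P \<and> finite Q \<and> \<not> cartesian X \<longrightarrow>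
      real (card (X \<inter> (P \<times> Q))) \<le> C * (real (card P) + real (card Q))"
proof (intro exI[of _ "real (d * fibre_const d)"] allI impI, elim conjE)
  \<comment> \<open>The factor \<open>d\<close> counts components, and \<open>fibre_const d\<close>
    dominates the constant of each, whose degree is at most \<open>d\<close>.\<close>
  fix X :: "pt4 set" and P Q :: "(complex \<times> complex) set"
  assume X: "is_variety X" and dim: "has_dim X 1 \<or> has_dim X 2" and deg: "variety_degree X = d"
    and PQ: "finite P" "finite Q" and cart: "\<not> cartesian X"
  let ?I = "irreducible_components X"
  note cover = irreducible_components_finite_cover[OF X]
  have "\<not> has_chain X 3"
    using dim has_chain_mono[of X 3 "Suc 1"] by (auto simp: has_dim_def numeral_3_eq_3 numeral_2_eq_2)
  then have comp: "irreducible_variety V" "V \<subseteq> X" "\<not> has_chain V 3" if "V \<in> ?I" for V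
    using that has_chain_subset by (auto simp: irreducible_components_def)
  have not_cart: "\<not> cartesian V" if "V \<in> ?I" for V
    using comp(2)[OF that] cart unfolding cartesian_def vanishing_ideal_def by blast
  have d: "d = (\<Sum>V\<in>?I. irr_degree V)" using deg by (simp add: variety_degree_def)
  have le_d: "irr_degree V \<le> d" if "V \<in> ?I" for V
    unfolding d using that cover(1) by (intro member_le_sum) auto
  have "irr_degree V \<ge> 1" if "V \<in> ?I" for V
    using irr_degree_pos comp[OF that] by (simp add: numeral_3_eq_3)
  then have card_I: "card ?I \<le> d"
    unfolding d using sum_mono[of ?I "\<lambda>_. 1" irr_degree] by simp
  have "card (X \<inter> (P \<times> Q)) = card (\<Union>V\<in>?I. V \<inter> (P \<times> Q))"
    by (subst cover(2)) (auto intro: arg_cong[of _ _ card])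
  also have "\<dots> \<le> (\<Sum>V\<in>?I. card (V \<inter> (P \<times> Q)))" using cover(1) by (rule card_UN_le)
  also have "\<dots> \<le> (\<Sum>V\<in>?I. fibre_const d * (card P + card Q))"
  proof (rule sum_mono)
    fix V assume V: "V \<in> ?I"
    have "card (V \<inter> (P \<times> Q)) \<le> fibre_const (irr_degree V) * (card P + card Q)"
      using component_bound comp[OF V] not_cart[OF V] PQ by blast
    also have "\<dots> \<le> fibre_const d * (card P + card Q)"
      using fibre_const_mono[OF le_d[OF V]] by (rule mult_le_mono1)
    finally show "card (V \<inter> (P \<times> Q)) \<le> fibre_const d * (card P + card Q)" .
  qed
  also have "\<dots> = card ?I * (fibre_const d * (card P + card Q))" by simp
  also have "\<dots> \<le> d * (fibre_const d * (card P + card Q))" using card_I by (rule mult_le_mono1)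
  finally have "card (X \<inter> (P \<times> Q)) \<le> d * fibre_const d * (card P + card Q)" by (simp only: mult.assoc)
  then have "real (card (X \<inter> (P \<times> Q))) \<le> real (d * fibre_const d * (card P + card Q))" by (rule of_nat_mono)
  then show "real (card (X \<inter> (P \<times> Q))) \<le> real (d * fibre_const d) * (real (card P) + real (card Q))"
    by (simp only: of_nat_mult of_nat_add)
qed

end
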